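(* Let $k$ be a commutative unital ring and let $\lambda\in k$ be invertible with $\lambda\neq 0,1$. Put $B=k[x,\tfrac1x,\tfrac1{x-1}]$ and $A=k[x,\tfrac1x,\tfrac1{x-1},\tfrac1{x-\lambda}]$, and let $\mathbb{A}$ be the diagram of $k$-algebras consisting of $B$, $A$ and the two $k$-algebra morphisms $f,g:B\to A$ determined by $f(x)=x$ and $g(x)=\lambda^{-1}x$. Then the dimension of $H^2(\mathbb{A},\mathbb{A})$ is infinite. Its generators divide into two classes. The first contains a single (expected) element, corresponding to the number of parameters (namely one) of the four-punctured sphere. The second class is infinite; if a natural condition on the regularity of the derivations that are allowed is imposed (regularity at $x=1$ and at $x=\lambda$), then the second class is eliminated.
   Context: When $k=\mathbb{C}$, $A$ is the algebra of functions on the Riemann sphere punctured at $\infty,0,1,\lambda$ (the four-punctured sphere), and $B$ is that of the sphere punctured at $\infty,0,1$. Cohomology of the diagram. An $n$-cochain of $\mathbb{A}$ with coefficients in itself is a quadruple $\Gamma=(\Gamma^B,\Gamma^A,\Gamma^f,\Gamma^g)$, where $\Gamma^B\in C^n(B,B)$ and $\Gamma^A\in C^n(A,A)$ are Hochschild $n$-cochains over $k$, and $\Gamma^f,\Gamma^g\in C^{n-1}(B,A)$ are Hochschild $(n-1)$-cochains, with $A$ regarded as a $B$-bimodule via $f$ and via $g$ respectively (these two components are absent when $n=0$). The coboundary is $$\delta\Gamma=(\delta\Gamma^B,\ \delta\Gamma^A,\ f\circ\Gamma^B-\Gamma^A\circ f-\delta\Gamma^f,\ g\circ\Gamma^B-\Gamma^A\circ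 g-\delta\Gamma^g),$$ where $\delta$ on the right denotes Hochschild coboundaries and $(\Gamma^A\circ f)(b_1,\dots,b_n)=\Gamma^A(fb_1,\dots,fb_n)$, similarly for $g$. $H^n(\mathbb{A},\mathbb{A})$ is the $n$-th cohomology of this complex. The derivations in question. Every $2$-cocycle of $\mathbb{A}$ is cohomologous to one of the form $(0,0,\Gamma^f,\Gamma^g)$ with $\Gamma^f,\Gamma^g:B\to A$ derivations (for the bimodule structures via $f$ and $g$), each determined by its value on $x$, which can be any element of $A$. The class depends only on the element $\Gamma^f(x)-\lambda\Gamma^g(x)$ of $A$. The single element of the first class of generators is the one corresponding to the element $x$; the second class of generators consists of those corresponding to $1/(x-1)^N$, $N>0$. The regularity condition requires the derivations not to be singular at $x=1$ and $x=\lambda$.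
   Formalization: That the two classes generate H^2, and that the regular part is spanned by the first class alone, is stated only when 1-λ^m is invertible for all m>0; it fails otherwise, e.g. for k=ℂ, λ=-1, where x^3 gives a further regular class. "Infinite dimension" is read as not finitely generated over k. *)

theory Defs
  imports
    "HOL-Computational_Algebra.Polynomial_FPS"
    "HOL-Computational_Algebra.Formal_Laurent_Series"
    "HOL-Library.Function_Algebras"
    "HOL-Library.Product_Plus"
    "HOL-Library.Set_Algebras"
begin

section \<open>The algebras\<close>

text \<open>
  All algebras are realised as \<open>k\<close>-subalgebras of the ring of formal Laurent series over \<open>k\<close> in
  the variable \<open>x\<close> (written \<^const>\<open>fls_X\<close>). Since \<open>x\<close> is invertible there, and so is \<open>x - s\<close> for
  every unit \<open>s\<close> of \<open>k\<close> (lemma \<open>linear_invertible\<close>), this ring contains the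
  localisations of \<open>k[x]\<close> at the monic polynomials that are products of such factors
  (lemma \<open>punctured_iff\<close>); polynomials embed injectively, and monic polynomials are
  not zero divisors.
\<close>

inductive_set subalgebra_gen :: "'k::comm_ring_1 fls set \<Rightarrow> 'k fls set" for S where
  const: "fls_const c \<in> subalgebra_gen S"
| gen: "s \<in> S \<Longrightarrow> s \<in> subalgebra_gen S"
| add: "a \<in> subalgebra_gen S \<Longrightarrow> b \<in> subalgebra_gen S \<Longrightarrow> a + b \<in> subalgebra_gen S"
| mult: "a \<in> subalgebra_gen S \<Longrightarrow> b \<in> subalgebra_gen S \<Longrightarrow> a * b \<in> subalgebra_gen S"

text \<open>
  The algebra generated by \<open>x\<close> and all \<open>1/(x - s)\<close> with \<open>s \<in> P\<close>: the functions on the Riemann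
  sphere punctured at infinity and at the points of \<open>P\<close>. To be used only
  when every \<open>s \<in> P\<close> is \<open>0\<close> or a unit, as otherwise \<open>x - s\<close> has no inverse among Laurent series.
\<close>

definition punctured :: "'k::comm_ring_1 set \<Rightarrow> 'k fls set" where
  "punctured P = subalgebra_gen
     (insert fls_X {y. \<exists>s\<in>P. y * (fls_X - fls_const s) = 1})"

definition algebra_hom ::
    "'k::comm_ring_1 fls set \<Rightarrow> 'k fls set \<Rightarrow> ('k fls \<Rightarrow> 'k fls) \<Rightarrow> bool" where
  "algebra_hom B A \<phi> \<longleftrightarrow>
     (\<forall>b\<in>B. \<phi> b \<in> A) \<and> (\<forall>c. \<phi> (fls_const c) = fls_const c) \<and>
     (\<forall>a\<in>B. \<forall>b\<in>B. \<phi> (a + b) = \<phi> a + \<phi> b \<and> \<phi> (a * b) = \<phi> a * \<phi> b)"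

definition laurent_of_poly :: "'k::comm_ring_1 poly \<Rightarrow> 'k fls" where
  "laurent_of_poly p = fps_to_fls (fps_of_poly p)"

text \<open>
  Regularity at the point \<open>c\<close>: being a fraction whose denominator takes an invertible value at
  \<open>c\<close>. Such a denominator is not a zero divisor, because a polynomial
  zero divisor is annihilated by a nonzero constant.
\<close>

definition regular_at :: "'k::comm_ring_1 \<Rightarrow> 'k fls \<Rightarrow> bool" where
  "regular_at c a \<longleftrightarrow>
     (\<exists>p q. poly q c dvd 1 \<and> laurent_of_poly q * a = laurent_of_poly p)"


section \<open>Hochschild cochains\<close>

text \<open>
  An \<open>n\<close>-cochain of \<open>B\<close> with values in \<open>A\<close> is a function on lists; it is
  extended by \<open>0\<close> from the lists of length \<open>n\<close> over \<open>B\<close> to all lists, so that equality of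
  cochains is equality of functions.
\<close>

type_synonym 'k cochain = "'k fls list \<Rightarrow> 'k fls"

definition hochschild_cochains ::
    "'k::comm_ring_1 fls set \<Rightarrow> 'k fls set \<Rightarrow> nat \<Rightarrow> 'k cochain set" where
  "hochschild_cochains B A n = {h.
     (\<forall>bs. (bs \<in> lists B \<and> length bs = n \<longrightarrow> h bs \<in> A) \<and>
           (\<not> (bs \<in> lists B \<and> length bs = n) \<longrightarrow> h bs = 0)) \<and>
     (\<forall>bs\<in>lists B. length bs = n \<longrightarrow>
       (\<forall>i<n. \<forall>c. \<forall>a\<in>B. \<forall>b\<in>B.
          h (bs[i := fls_const c * a + b]) = fls_const c * h (bs[i := a]) + h (bs[i := b])))}"

text \<open>
  The Hochschild coboundary, for the bimodule structure \<open>b \<cdot> m \<cdot> b' = \<phi> b * m * \<phi> b'\<close>. The sum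
  runs over the adjacent pairs \<open>(bs ! i, bs ! Suc i)\<close>; the degree of the cochain is one less
  than \<open>length bs\<close>.
\<close>

definition hochschild_d ::
    "'k::comm_ring_1 fls set \<Rightarrow> ('k fls \<Rightarrow> 'k fls) \<Rightarrow> 'k cochain \<Rightarrow> 'k cochain" where
  "hochschild_d B \<phi> h bs =
     (if bs \<in> lists B \<and> bs \<noteq> [] then
        \<phi> (hd bs) * h (tl bs)
        + (\<Sum>i<length bs - 1.
             (-1) ^ Suc i * h (take i bs @ [bs ! i * bs ! Suc i] @ drop (Suc (Suc i)) bs))
        + (-1) ^ length bs * (h (butlast bs) * \<phi> (last bs))
      else 0)"

definition derivation ::
    "'k::comm_ring_1 fls set \<Rightarrow> 'k fls set \<Rightarrow> ('k fls \<Rightarrow> 'k fls) \<Rightarrow> 'k cochain \<Rightarrow> bool" where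
  "derivation B A \<phi> D \<longleftrightarrow> D \<in> hochschild_cochains B A 1 \<and>
     (\<forall>a\<in>B. \<forall>b\<in>B. D [a * b] = \<phi> a * D [b] + D [a] * \<phi> b)"


section \<open>The cohomology of a diagram of two parallel morphisms\<close>

type_synonym 'k quad = "'k cochain \<times> 'k cochain \<times> 'k cochain \<times> 'k cochain"

definition diag_cochains ::
    "'k::comm_ring_1 fls set \<Rightarrow> 'k fls set \<Rightarrow> nat \<Rightarrow> 'k quad set" where
  "diag_cochains B A n =
     hochschild_cochains B B n \<times> hochschild_cochains A A n \<times>
     (if n = 0 then {0} else hochschild_cochains B A (n - 1)) \<times>
     (if n = 0 then {0} else hochschild_cochains B A (n - 1))"

definition pushforward :: "('k fls \<Rightarrow> 'k fls) \<Rightarrow> 'k cochain \<Rightarrow> 'k::comm_ring_1 cochain" where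
  "pushforward \<phi> h bs = \<phi> (h bs)"

definition pullback ::
    "'k fls set \<Rightarrow> ('k fls \<Rightarrow> 'k fls) \<Rightarrow> 'k cochain \<Rightarrow> 'k::comm_ring_1 cochain" where
  "pullback B \<phi> h bs = (if bs \<in> lists B then h (map \<phi> bs) else 0)"

definition diag_d ::
    "'k::comm_ring_1 fls set \<Rightarrow> 'k fls set \<Rightarrow> ('k fls \<Rightarrow> 'k fls) \<Rightarrow> ('k fls \<Rightarrow> 'k fls)
      \<Rightarrow> 'k quad \<Rightarrow> 'k quad" where
  "diag_d B A f g = (\<lambda>(GB, GA, Gf, Gg).
     (hochschild_d B id GB,
      hochschild_d A id GA,
      pushforward f GB - pullback B f GA - hochschild_d B f Gf,
      pushforward g GB - pullback B g GA - hochschild_d B g Gg))"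

definition diag_cocycles ::
    "'k::comm_ring_1 fls set \<Rightarrow> 'k fls set \<Rightarrow> ('k fls \<Rightarrow> 'k fls) \<Rightarrow> ('k fls \<Rightarrow> 'k fls)
      \<Rightarrow> nat \<Rightarrow> 'k quad set" where
  "diag_cocycles B A f g n = {G \<in> diag_cochains B A n. diag_d B A f g G = 0}"

definition diag_coboundaries ::
    "'k::comm_ring_1 fls set \<Rightarrow> 'k fls set \<Rightarrow> ('k fls \<Rightarrow> 'k fls) \<Rightarrow> ('k fls \<Rightarrow> 'k fls)
      \<Rightarrow> nat \<Rightarrow> 'k quad set" where
  "diag_coboundaries B A f g n =
     (if n = 0 then {0} else diag_d B A f g ` diag_cochains B A (n - 1))"

definition diag_class ::
    "'k::comm_ring_1 fls set \<Rightarrow> 'k fls set \<Rightarrow> ('k fls \<Rightarrow> 'k fls) \<Rightarrow> ('k fls \<Rightarrow> 'k fls)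
      \<Rightarrow> nat \<Rightarrow> 'k quad \<Rightarrow> 'k quad set" where
  "diag_class B A f g n G = G +o diag_coboundaries B A f g n"

definition diag_cohomology ::
    "'k::comm_ring_1 fls set \<Rightarrow> 'k fls set \<Rightarrow> ('k fls \<Rightarrow> 'k fls) \<Rightarrow> ('k fls \<Rightarrow> 'k fls)
      \<Rightarrow> nat \<Rightarrow> 'k quad set set" where
  "diag_cohomology B A f g n = diag_class B A f g n ` diag_cocycles B A f g n"


section \<open>Linear algebra in a quotient module\<close>

definition quad_scale :: "'k::comm_ring_1 \<Rightarrow> 'k quad \<Rightarrow> 'k quad" where
  "quad_scale c = (\<lambda>(GB, GA, Gf, Gg).
     ((\<lambda>bs. fls_const c * GB bs), (\<lambda>bs. fls_const c * GA bs),
      (\<lambda>bs. fls_const c * Gf bs), (\<lambda>bs. fls_const c * Gg bs)))"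

text \<open>
  In the following, \<open>W\<close> is a submodule of the module of quadruples, and the sets of quadruples
  are sets of cosets of \<open>W\<close>. A linear combination of cosets is a Minkowski sum;
  the summand \<open>W\<close> is the zero of the quotient, and makes the sum a full
  coset even if it is empty or the coefficients are not units.
\<close>

definition coset_comb ::
    "'k::comm_ring_1 quad set \<Rightarrow> 'k quad set set \<Rightarrow> ('k quad set \<Rightarrow> 'k) \<Rightarrow> 'k quad set" where
  "coset_comb W S c = W + (\<Sum>U\<in>S. quad_scale (c U) ` U)"

definition coset_span :: "'k::comm_ring_1 quad set \<Rightarrow> 'k quad set set \<Rightarrow> 'k quad set set" where
  "coset_span W G = {coset_comb W S c | S c. finite S \<and> S \<subseteq> G}"

definition coset_independent :: "'k::comm_ring_1 quad set \<Rightarrow> 'k quad set set \<Rightarrow> bool" where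
  "coset_independent W G \<longleftrightarrow>
     (\<forall>S c. finite S \<and> S \<subseteq> G \<and> coset_comb W S c = W \<longrightarrow> (\<forall>U\<in>S. c U = 0))"

definition coset_finite_dim :: "'k::comm_ring_1 quad set \<Rightarrow> 'k quad set set \<Rightarrow> bool" where
  "coset_finite_dim W H \<longleftrightarrow> (\<exists>G. finite G \<and> G \<subseteq> H \<and> coset_span W G = H)"


section \<open>Classes given by pairs of derivations\<close>

definition classes_of ::
    "'k::comm_ring_1 fls set \<Rightarrow> 'k fls set \<Rightarrow> ('k fls \<Rightarrow> 'k fls) \<Rightarrow> ('k fls \<Rightarrow> 'k fls)
      \<Rightarrow> 'k \<Rightarrow> 'k fls \<Rightarrow> 'k quad set set" where
  "classes_of B A f g lam a = {diag_class B A f g 2 (0, 0, Gf, Gg) | Gf Gg.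
     derivation B A f Gf \<and> derivation B A g Gg \<and>
     Gf [fls_X] - fls_const lam * Gg [fls_X] = a}"

definition first_class ::
    "'k::comm_ring_1 fls set \<Rightarrow> 'k fls set \<Rightarrow> ('k fls \<Rightarrow> 'k fls) \<Rightarrow> ('k fls \<Rightarrow> 'k fls)
      \<Rightarrow> 'k \<Rightarrow> 'k quad set set" where
  "first_class B A f g lam = classes_of B A f g lam fls_X"

definition second_class ::
    "'k::comm_ring_1 fls set \<Rightarrow> 'k fls set \<Rightarrow> ('k fls \<Rightarrow> 'k fls) \<Rightarrow> ('k fls \<Rightarrow> 'k fls)
      \<Rightarrow> 'k \<Rightarrow> 'k quad set set" where
  "second_class B A f g lam =
     (\<Union>a\<in>{a. \<exists>N>0. a * (fls_X - 1) ^ N = 1}. classes_of B A f g lam a)"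

text \<open>
  A derivation \<open>D\<close> is \<open>D(x)\<close> times the differentiation of functions, up to a unit of \<open>k\<close>;
  it is singular where the coefficient \<open>D(x)\<close> is.
\<close>

definition regular_classes ::
    "'k::comm_ring_1 fls set \<Rightarrow> 'k fls set \<Rightarrow> ('k fls \<Rightarrow> 'k fls) \<Rightarrow> ('k fls \<Rightarrow> 'k fls)
      \<Rightarrow> 'k \<Rightarrow> 'k quad set set" where
  "regular_classes B A f g lam = {diag_class B A f g 2 (0, 0, Gf, Gg) | Gf Gg.
     derivation B A f Gf \<and> derivation B A g Gg \<and>
     (\<forall>c\<in>{1, lam}. regular_at c (Gf [fls_X]) \<and> regular_at c (Gg [fls_X]))}"


section \<open>The model is adequate\<close>

lemma linear_invertible:
  includes fps_syntax
  fixes s :: "'k::comm_ring_1"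
  assumes "s = 0 \<or> s dvd 1"
  shows "\<exists>y. y * (fls_X - fls_const s) = 1"
proof (cases "s = 0")
  case True
  then have "fls_X_inv * (fls_X - fls_const s) = 1"
    by (simp add: fls_X_inv_times_conv_shift)
  then show ?thesis by blast
next
  case False
  then obtain t where t: "s * t = 1" using assms by (auto elim!: dvdE)
  define u where "u = Abs_fps (\<lambda>n. - (t ^ Suc n))"
  have "u * (fps_X - fps_const s) = 1"
  proof (rule fps_ext)
    fix n
    have ts: "t * s = 1" using t by (simp add: mult.commute)
    show "(u * (fps_X - fps_const s)) $ n = 1 $ n"
    proof (cases n)
      case 0
      then show ?thesis by (simp add: u_def right_diff_distrib ts)
    next
      case (Suc m)
      have "t * t ^ m * t * s = t * t ^ m" using ts by (simp add: mult.assoc)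
      then show ?thesis
        using Suc by (simp add: u_def right_diff_distrib algebra_simps)
    qed
  qed
  then have "fps_to_fls u * fps_to_fls (fps_X - fps_const s) = fps_to_fls 1"
    by (metis fls_times_fps_to_fls)
  then show ?thesis
    by (metis fps_to_fls_minus fps_X_to_fls fps_const_to_fls fps_one_to_fls)
qed

lemma laurent_of_poly_simps:
  "laurent_of_poly (p + q) = laurent_of_poly p + laurent_of_poly q"
  "laurent_of_poly (p * q) = laurent_of_poly p * laurent_of_poly q"
  "laurent_of_poly [:c:] = fls_const c"
  "laurent_of_poly [:0, 1:] = fls_X"
  "laurent_of_poly 1 = 1"
  "laurent_of_poly [:- s, 1:] = fls_X - fls_const s"
  "laurent_of_poly (p ^ n) = laurent_of_poly p ^ n"
  by (simp_all add: laurent_of_poly_def fps_of_poly_add fps_of_poly_mult fls_times_fps_to_fls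
      fps_of_poly_const fps_of_poly_power fps_to_fls_power fps_of_poly_pCons)

lemma laurent_of_poly_prod:
  "laurent_of_poly (prod h I) = (\<Prod>i\<in>I. laurent_of_poly (h i))"
  by (induction I rule: infinite_finite_induct) (simp_all add: laurent_of_poly_simps)

lemma laurent_of_poly_inj: "laurent_of_poly p = laurent_of_poly q \<longleftrightarrow> p = q"
  by (simp add: laurent_of_poly_def fps_of_poly_eq_iff)

lemma laurent_of_poly_in_gen: "fls_X \<in> S \<Longrightarrow> laurent_of_poly p \<in> subalgebra_gen S"
proof (induction p)
  case 0
  show ?case using subalgebra_gen.const[of 0] by (simp add: laurent_of_poly_def)
next
  case (pCons a p)
  have "pCons a p = [:a:] + [:0, 1:] * p" by simp
  then show ?case
    using pCons by (simp only: laurent_of_poly_simps) (blast intro: subalgebra_gen.intros)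
qed

text \<open>\<^const>\<open>punctured\<close> is the localisation of the polynomial ring at the product of the \<open>x - s\<close>.\<close>

lemma punctured_iff:
  fixes P :: "'k::comm_ring_1 set"
  assumes fin: "finite P" and inv: "\<And>s. s \<in> P \<Longrightarrow> s = 0 \<or> s dvd 1"
  shows "a \<in> punctured P \<longleftrightarrow>
    (\<exists>p n. a * (\<Prod>s\<in>P. fls_X - fls_const s) ^ n = laurent_of_poly p)"
proof -
  let ?S = "insert fls_X {y. \<exists>s\<in>P. y * (fls_X - fls_const s) = 1}"
  let ?Q = "\<Prod>s\<in>P. fls_X - fls_const s"
  define q where "q = (\<Prod>s\<in>P. [:- s, 1:])"
  have q: "?Q = laurent_of_poly q"
    by (simp add: q_def laurent_of_poly_prod laurent_of_poly_simps)
  show ?thesis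
  proof
    assume "a \<in> punctured P"
    then have "a \<in> subalgebra_gen ?S" by (simp add: punctured_def)
    then show "\<exists>p n. a * ?Q ^ n = laurent_of_poly p"
    proof induction
      case (const c)
      have "fls_const c * ?Q ^ 0 = laurent_of_poly [:c:]" by (simp add: laurent_of_poly_simps)
      then show ?case by blast
    next
      case (gen y)
      then consider "y = fls_X" | s where "s \<in> P" "y * (fls_X - fls_const s) = 1" by blast
      then show ?case
      proof cases
        case 1
        then have "y * ?Q ^ 0 = laurent_of_poly [:0, 1:]" by (simp add: laurent_of_poly_simps)
        then show ?thesis by blast
      next
        case 2
        have "y * ?Q ^ 1 = y * (fls_X - fls_const s) * (\<Prod>s\<in>P - {s}. fls_X - fls_const s)"
          using fin 2(1) by (simp add: prod.remove mult.assoc)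
        also have "\<dots> = laurent_of_poly (\<Prod>s\<in>P - {s}. [:- s, 1:])"
          using 2(2) by (simp add: laurent_of_poly_prod laurent_of_poly_simps)
        finally show ?thesis by blast
      qed
    next
      case (add a b)
      then obtain p n p' m where *: "a * ?Q ^ n = laurent_of_poly p" "b * ?Q ^ m = laurent_of_poly p'"
        by blast
      have "(a + b) * ?Q ^ (n + m) = (a * ?Q ^ n) * ?Q ^ m + (b * ?Q ^ m) * ?Q ^ n"
        by (simp add: power_add algebra_simps)
      also have "\<dots> = laurent_of_poly (p * q ^ m + p' * q ^ n)"
        unfolding * by (simp add: q laurent_of_poly_simps)
      finally show ?case by blast
    next
      case (mult a b)
      then obtain p n p' m where *: "a * ?Q ^ n = laurent_of_poly p" "b * ?Q ^ m = laurent_of_poly p'"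
        by blast
      have "(a * b) * ?Q ^ (n + m) = (a * ?Q ^ n) * (b * ?Q ^ m)"
        by (simp add: power_add algebra_simps)
      also have "\<dots> = laurent_of_poly (p * p')"
        unfolding * by (simp add: laurent_of_poly_simps)
      finally show ?case by blast
    qed
  next
    assume "\<exists>p n. a * ?Q ^ n = laurent_of_poly p"
    then obtain p n where pn: "a * ?Q ^ n = laurent_of_poly p" by blast
    obtain y where y: "\<And>s. s \<in> P \<Longrightarrow> y s * (fls_X - fls_const s) = 1"
      using linear_invertible inv by metis
    have Y: "prod y P * ?Q = 1" using y by (simp flip: prod.distrib)
    have "prod y I \<in> subalgebra_gen ?S" if "I \<subseteq> P" for I
      using finite_subset[OF that fin] that
    proof (induction I)
      case empty
      show ?case using subalgebra_gen.const[of 1] by simp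
    next
      case (insert s I)
      have "y s \<in> subalgebra_gen ?S" using insert.prems y by (blast intro: subalgebra_gen.gen)
      then show ?case using insert by (simp add: subalgebra_gen.mult)
    qed
    then have yp: "prod y P ^ m \<in> subalgebra_gen ?S" for m
      using subalgebra_gen.const[of 1 ?S] by (induction m) (simp_all add: subalgebra_gen.mult)
    have "a = a * ?Q ^ n * prod y P ^ n"
      using Y by (simp add: mult.assoc mult.commute[of ?Q] flip: power_mult_distrib)
    also have "\<dots> \<in> subalgebra_gen ?S"
      unfolding pn by (intro subalgebra_gen.mult yp laurent_of_poly_in_gen) simp
    finally show "a \<in> punctured P" by (simp add: punctured_def)
  qed
qed

text \<open>The morphism with \<open>x \<mapsto> x/lam\<close> exists (the one with \<open>x \<mapsto> x\<close> is the inclusion).\<close>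

lemma rescaling_exists:
  includes fps_syntax
  fixes lam mu :: "'k::comm_ring_1"
  assumes "lam * mu = 1"
  shows "\<exists>g. algebra_hom (punctured {0, 1}) (punctured {0, 1, lam}) g \<and>
    g fls_X = fls_const mu * fls_X"
proof -
  define w :: "int \<Rightarrow> 'k" where
    "w n = (if n \<ge> 0 then mu ^ nat n else lam ^ nat (- n))" for n
  have w_Suc: "w (n + 1) = mu * w n" for n
  proof (cases "n \<ge> 0")
    case True
    then have "nat (n + 1) = Suc (nat n)" by simp
    then show ?thesis using True by (simp add: w_def)
  next
    case False
    show ?thesis
    proof (cases "n = -1")
      case True
      then show ?thesis using assms by (simp add: w_def mult.commute)
    next
      case n: False
      then have *: "nat (- n) = Suc (nat (- (n + 1)))" using False by linarith
      have "mu * (lam * z) = z" for z using assms by (metis mult.assoc mult.commute mult_1)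
      then show ?thesis using False n by (simp add: w_def *)
    qed
  qed
  have w0: "w 0 = 1" and w1: "w 1 = mu" by (simp_all add: w_def)
  have w_add: "w (m + n) = w m * w n" for m n
  proof (induction m rule: int_induct[where k = 0])
    case base
    show ?case by (simp add: w0)
  next
    case (step1 i)
    have "w (i + 1 + n) = w ((i + n) + 1)" by (simp add: algebra_simps)
    then show ?case using step1 by (simp only: w_Suc mult.assoc)
  next
    case (step2 i)
    have "mu * w (i - 1 + n) = w (i + n)" "mu * w (i - 1) = w i"
      using w_Suc[of "i - 1 + n"] w_Suc[of "i - 1"] by (simp_all add: algebra_simps)
    then have "lam * (mu * w (i - 1 + n)) = lam * (mu * w (i - 1)) * w n"
      using step2 by (simp add: mult.assoc)
    then show ?case using assms by (metis mult.assoc mult_1)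
  qed
  define g :: "'k fls \<Rightarrow> 'k fls" where "g a = Abs_fls (\<lambda>n. w n * a $$ n)" for a
  have g_nth: "g a $$ n = w n * a $$ n" for a n
    unfolding g_def by (rule nth_Abs_fls_lower_bound[of "fls_subdegree a"]) simp
  have g_zero: "n < fls_subdegree a \<Longrightarrow> g a $$ n = 0" for a n by (simp add: g_nth)
  have g_const: "g (fls_const c) = fls_const c" for c
    by (rule fls_eqI) (simp add: g_nth w0)
  have g_X: "g fls_X = fls_const mu * fls_X"
    by (rule fls_eqI) (simp add: g_nth w1)
  have g_add: "g (a + b) = g a + g b" for a b
    by (rule fls_eqI) (simp add: g_nth algebra_simps)
  have g_mult: "g (a * b) = g a * g b" for a b
  proof (rule fls_eqI)
    fix n
    have sub: "fls_subdegree (g c) = fls_subdegree c" for c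
    proof (cases "c = 0")
      case True
      then show ?thesis by (simp add: g_const[of 0, simplified])
    next
      case False
      have "w (- fls_subdegree c) * w (fls_subdegree c) = 1"
        by (simp add: w0 flip: w_add)
      then have "w (fls_subdegree c) * c $$ fls_subdegree c \<noteq> 0"
        using False by (metis mult.assoc mult_1 mult_zero_right nth_fls_subdegree_nonzero)
      then show ?thesis
        by (intro fls_subdegree_eqI) (simp_all add: g_nth)
    qed
    have "g (a * b) $$ n = (\<Sum>i=fls_subdegree a..n - fls_subdegree b. w n * (a $$ i * b $$ (n - i)))"
      by (simp add: g_nth fls_times_nth(2) sum_distrib_left)
    also have "\<dots> = (\<Sum>i=fls_subdegree a..n - fls_subdegree b. g a $$ i * g b $$ (n - i))"
    proof (rule sum.cong[OF refl])
      fix i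
      have "w n = w i * w (n - i)" by (simp flip: w_add)
      then show "w n * (a $$ i * b $$ (n - i)) = g a $$ i * g b $$ (n - i)"
        by (simp add: g_nth algebra_simps)
    qed
    also have "\<dots> = (g a * g b) $$ n"
      by (simp add: fls_times_nth(2) sub)
    finally show "g (a * b) $$ n = (g a * g b) $$ n" .
  qed
  have "g b \<in> punctured {0, 1, lam}" if "b \<in> punctured {0, 1}" for b
  proof -
    let ?S = "insert fls_X {y. \<exists>s\<in>{0, 1, lam}. y * (fls_X - fls_const s) = 1}"
    have lm: "fls_const lam * fls_const mu = 1" using assms by (simp add: fls_const_mult_const)
    have lm2: "fls_const lam * (fls_const mu * z) = z" for z
      using lm by (simp flip: mult.assoc)
    have "b \<in> subalgebra_gen (insert fls_X {y. \<exists>s\<in>{0, 1}. y * (fls_X - fls_const s) = 1})"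
      using that by (simp add: punctured_def)
    then have "g b \<in> subalgebra_gen ?S"
    proof induction
      case (const c)
      show ?case by (simp add: g_const subalgebra_gen.const)
    next
      case (gen y)
      then consider "y = fls_X" | "y * fls_X = 1" | "y * (fls_X - 1) = 1" by auto
      then show ?case
      proof cases
        case 1
        then show ?thesis
          by (simp add: g_X) (blast intro: subalgebra_gen.intros)
      next
        case 2
        have "g y * (fls_const mu * fls_X) = 1"
          using g_mult[of y fls_X] 2 by (simp add: g_X g_const[of 1, simplified])
        then have "(fls_const mu * g y) * (fls_X - fls_const 0) = 1" by (simp add: ac_simps)
        then have "fls_const mu * g y \<in> subalgebra_gen ?S" by (blast intro: subalgebra_gen.gen)
        then have "fls_const lam * (fls_const mu * g y) \<in> subalgebra_gen ?S"
          by (blast intro: subalgebra_gen.intros)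
        then show ?thesis by (simp add: lm2)
      next
        case 3
        have "g (fls_X - 1) = fls_const mu * fls_X - 1"
          using g_add[of "fls_X - 1" 1] by (simp add: g_X g_const[of 1, simplified])
        then have "g y * (fls_const mu * fls_X - 1) = 1"
          using g_mult[of y "fls_X - 1"] 3 by (simp add: g_const[of 1, simplified])
        then have "(fls_const mu * g y) * (fls_X - fls_const lam) = 1"
          using lm2[of "g y"] by (simp add: algebra_simps)
        then have "fls_const mu * g y \<in> subalgebra_gen ?S" by (blast intro: subalgebra_gen.gen)
        then have "fls_const lam * (fls_const mu * g y) \<in> subalgebra_gen ?S"
          by (blast intro: subalgebra_gen.intros)
        then show ?thesis by (simp add: lm2)
      qed
    next
      case (add a b)
      then show ?case by (simp add: g_add subalgebra_gen.add)
    next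
      case (mult a b)
      then show ?case by (simp add: g_mult subalgebra_gen.mult)
    qed
    then show ?thesis by (simp add: punctured_def)
  qed
  then have "algebra_hom (punctured {0, 1}) (punctured {0, 1, lam}) g"
    by (simp add: algebra_hom_def g_const g_add g_mult)
  then show ?thesis using g_X by blast
qed

end

theory Submission
  imports Defs
begin

text \<open>
  The algebras are localisations of \<open>k[x]\<close>, so their second Hochschild cohomology vanishes: a
  primitive of a 2-cocycle is built on \<open>k[x]\<close> by recursion on the powers of \<open>x\<close> and then forced on
  fractions. Hence every 2-cocycle of the diagram is cohomologous to a pair of derivations, and
  comparing values at \<open>x\<close> identifies \<open>H\<^sup>2\<close> with the quotient of \<open>A\<close> by the twists
  \<open>b - lam * g b\<close> with \<open>b \<in> B\<close>. The twist of \<open>x\<close> is \<open>0\<close>, the twist of \<open>x^n\<close> is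
  \<open>(1 - lam^(1-n)) * x^n\<close>, and the twist of \<open>1/(x-1)^N\<close> trades a pole at \<open>1\<close> for one at \<open>lam\<close>.
  When \<open>1 - lam\<close> is a unit, partial fractions describe the quotient. When it is not, partial
  fractions are unavailable, but all twists vanish modulo \<open>1 - lam\<close>, and this suffices to
  separate the classes in question.
\<close>

section \<open>Subalgebras of Laurent series and their homomorphisms\<close>

text \<open>The expression \<open>b - lam * g b\<close> arises from the derivations b d/dx of
  \<open>B\<close> and a d/dx of \<open>A\<close>: at \<open>x\<close> their coboundary takes the
  value \<open>b - a\<close> along \<open>f\<close> and \<open>g b - mu * a\<close> along
  \<open>g\<close>, and \<open>lam * mu = 1\<close> makes \<open>a\<close> cancel from the
  combination. Coboundaries of 0-cochains vanish by commutativity, so nothing else contributes.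
  After division by \<open>x\<close> a twist becomes \<open>b' - g b'\<close> with
  \<open>b' = b/x\<close>, and rescaling preserves the constant coefficient at 0; this is why the
  class of \<open>x\<close> survives over every \<open>k\<close>. The obstacle is that
  \<open>k\<close> may have zero divisors, so orders of poles do not behave additively. Poles are
  therefore detected by clearing denominators and evaluating the numerator at the point. The same
  device settles the unconditional assertions on \<open>1/(x-1)^N\<close>: a relation modulo twists
  would make \<open>1 - lam\<close> divide a numerator with unit value at 1, hence make
  \<open>1 - lam\<close> itself a unit, and then partial fractions apply.\<close>

interpretation fls_mod: module "\<lambda>c (a :: 'k::comm_ring_1 fls). fls_const c * a"
  by unfold_locales (simp_all add: algebra_simps flip: fls_plus_const fls_const_mult_const)

lemma fls_const_diff: "fls_const (a - b) = fls_const a - fls_const (b :: 'k::comm_ring_1)"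
  by (rule fls_eqI) simp

lemma subspace_subalgebra_gen: "fls_mod.subspace (subalgebra_gen S)"
  using subalgebra_gen.const[of 0 S]
  by (intro fls_mod.subspaceI) (auto intro: subalgebra_gen.intros)

lemma subspace_punctured: "fls_mod.subspace (punctured P)"
  by (simp add: punctured_def subspace_subalgebra_gen)

lemma subalgebra_gen_power: "a \<in> subalgebra_gen S \<Longrightarrow> a ^ n \<in> subalgebra_gen S"
  using subalgebra_gen.const[of 1 S] by (induction n) (auto intro: subalgebra_gen.mult)

lemma subalgebra_gen_mono: "S \<subseteq> T \<Longrightarrow> subalgebra_gen S \<subseteq> subalgebra_gen T"
proof
  fix a assume "S \<subseteq> T" "a \<in> subalgebra_gen S"
  then show "a \<in> subalgebra_gen T" by (induction rule: subalgebra_gen.induct[OF \<open>a \<in> _\<close>])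
      (auto intro: subalgebra_gen.intros)
qed

lemma punctured_intros:
  "fls_const c \<in> punctured P" "0 \<in> punctured P" "1 \<in> punctured P" "fls_X \<in> punctured P"
  "s \<in> P \<Longrightarrow> y * (fls_X - fls_const s) = 1 \<Longrightarrow> y \<in> punctured P"
  "a \<in> punctured P \<Longrightarrow> b \<in> punctured P \<Longrightarrow> a + b \<in> punctured P"
  "a \<in> punctured P \<Longrightarrow> b \<in> punctured P \<Longrightarrow> a - b \<in> punctured P"
  "a \<in> punctured P \<Longrightarrow> - a \<in> punctured P"
  "a \<in> punctured P \<Longrightarrow> b \<in> punctured P \<Longrightarrow> a * b \<in> punctured P"
  "a \<in> punctured P \<Longrightarrow> a ^ n \<in> punctured P"
proof -
  show "0 \<in> punctured P" "a \<in> punctured P \<Longrightarrow> b \<in> punctured P \<Longrightarrow> a - b \<in> punctured P"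
    "a \<in> punctured P \<Longrightarrow> - a \<in> punctured P"
    using subspace_punctured fls_mod.subspace_0 fls_mod.subspace_diff fls_mod.subspace_neg by blast+
  show "1 \<in> punctured P" using subalgebra_gen.const[of 1] by (simp add: punctured_def)
qed (auto simp: punctured_def intro: subalgebra_gen.intros subalgebra_gen_power)

lemma punctured_mono: "P \<subseteq> Q \<Longrightarrow> punctured P \<subseteq> punctured Q"
  unfolding punctured_def by (rule subalgebra_gen_mono) auto

text \<open>Homomorphisms and derivations are only assumed additive and multiplicative on the
  algebra itself, so the induction steps must carry membership of the parts.\<close>

lemma punctured_induct [consumes 1, case_names const X inv add mult]:
  assumes "a \<in> punctured P"
    and "\<And>c. Q (fls_const c)" and "Q fls_X"
    and "\<And>s y. s \<in> P \<Longrightarrow> y * (fls_X - fls_const s) = 1 \<Longrightarrow> y \<in> punctured P \<Longrightarrow> Q y"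
    and "\<And>a b. a \<in> punctured P \<Longrightarrow> b \<in> punctured P \<Longrightarrow> Q a \<Longrightarrow> Q b \<Longrightarrow> Q (a + b)"
    and "\<And>a b. a \<in> punctured P \<Longrightarrow> b \<in> punctured P \<Longrightarrow> Q a \<Longrightarrow> Q b \<Longrightarrow> Q (a * b)"
  shows "Q a"
  using assms(1) unfolding punctured_def
proof (induction rule: subalgebra_gen.induct)
  case (gen s)
  then show ?case using assms(3,4) punctured_intros(5) by blast
qed (use assms in \<open>auto simp: punctured_def\<close>)

lemma fls_deriv_punctured: "a \<in> punctured P \<Longrightarrow> fls_deriv a \<in> punctured P"
proof (induction rule: punctured_induct)
  case (inv s y)
  define u where "u = fls_X - fls_const s"
  have yu: "y * u = 1" using inv(2) by (simp add: u_def)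
  \<comment> \<open>Differentiating \<open>y * u = 1\<close> and multiplying by \<open>y\<close>
    gives \<open>y' = - y^2\<close> without any division.\<close>
  then have "fls_deriv (y * u) = 0" by simp
  then have "y * (y + fls_deriv y * u) = 0" by (simp add: u_def)
  then have "y * y + fls_deriv y * (y * u) = 0" by (simp only: distrib_left mult.left_commute)
  then have "fls_deriv y = - (y * y)" by (simp add: yu eq_neg_iff_add_eq_0 add.commute)
  then show ?case using inv(3) by (simp add: punctured_intros)
qed (auto simp: punctured_intros)

section \<open>Homomorphisms and derivations determined by their value at \<open>x\<close>\<close>

lemma
  assumes "algebra_hom B A \<phi>"
  shows algebra_hom_closed: "b \<in> B \<Longrightarrow> \<phi> b \<in> A"
    and algebra_hom_const: "\<phi> (fls_const c) = fls_const c"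
    and algebra_hom_add: "a \<in> B \<Longrightarrow> b \<in> B \<Longrightarrow> \<phi> (a + b) = \<phi> a + \<phi> b"
    and algebra_hom_mult: "a \<in> B \<Longrightarrow> b \<in> B \<Longrightarrow> \<phi> (a * b) = \<phi> a * \<phi> b"
    and algebra_hom_zero: "\<phi> 0 = 0"
    and algebra_hom_one: "\<phi> 1 = 1"
  using assms unfolding algebra_hom_def by (blast, blast, blast, blast, (metis fls_const_0 fls_const_1)+)

lemma
  assumes "algebra_hom (punctured P) A \<phi>"
  shows algebra_hom_linear: "a \<in> punctured P \<Longrightarrow> b \<in> punctured P \<Longrightarrow>
      \<phi> (fls_const c * a + b) = fls_const c * \<phi> a + \<phi> b"
    and algebra_hom_scale: "a \<in> punctured P \<Longrightarrow> \<phi> (fls_const c * a) = fls_const c * \<phi> a"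
    and algebra_hom_diff: "a \<in> punctured P \<Longrightarrow> b \<in> punctured P \<Longrightarrow> \<phi> (a - b) = \<phi> a - \<phi> b"
    and algebra_hom_power: "a \<in> punctured P \<Longrightarrow> \<phi> (a ^ n) = \<phi> a ^ n"
proof -
  note h = algebra_hom_const[OF assms] algebra_hom_add[OF assms] algebra_hom_mult[OF assms]
    algebra_hom_one[OF assms]
  show l: "\<phi> (fls_const c * a + b) = fls_const c * \<phi> a + \<phi> b"
    if "a \<in> punctured P" "b \<in> punctured P" for a b c
    using that by (simp add: h punctured_intros)
  show "a \<in> punctured P \<Longrightarrow> \<phi> (fls_const c * a) = fls_const c * \<phi> a"
    by (simp add: h punctured_intros)
  show "a \<in> punctured P \<Longrightarrow> b \<in> punctured P \<Longrightarrow> \<phi> (a - b) = \<phi> a - \<phi> b"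
    using l[of b a "- 1"] by simp
  show "a \<in> punctured P \<Longrightarrow> \<phi> (a ^ n) = \<phi> a ^ n"
    by (induction n) (simp_all add: h punctured_intros)
qed

lemma algebra_hom_inverse:
  assumes "algebra_hom (punctured P) A \<phi>" "y \<in> punctured P" "y * (fls_X - fls_const s) = 1"
  shows "\<phi> y * (\<phi> fls_X - fls_const s) = 1"
proof -
  have "\<phi> y * \<phi> (fls_X - fls_const s) = 1"
    using assms algebra_hom_mult[OF assms(1), of y "fls_X - fls_const s"] algebra_hom_one[OF assms(1)]
    by (simp add: punctured_intros)
  then show ?thesis
    by (simp add: algebra_hom_diff[OF assms(1)] algebra_hom_const[OF assms(1)] punctured_intros)
qed

lemma inverse_unique_comm: "y * u = 1 \<Longrightarrow> z * u = 1 \<Longrightarrow> y = (z :: 'a::comm_monoid_mult)"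
  by (metis mult.assoc mult.commute mult_1)

text \<open>A homomorphism respects inverses and inverses are unique, so fixing \<open>x\<close>
  fixes every generator. This turns \<open>f\<close> into the inclusion of \<open>B\<close> in
  \<open>A\<close>.\<close>

lemma algebra_hom_inclusion:
  assumes h: "algebra_hom (punctured P) A \<phi>" and X: "\<phi> fls_X = fls_X" and b: "b \<in> punctured P"
  shows "\<phi> b = b"
  using b
proof (induction rule: punctured_induct)
  case (inv s y)
  then show ?case using algebra_hom_inverse[OF h, of y s] X inverse_unique_comm by metis
qed (simp_all add: X algebra_hom_const[OF h] algebra_hom_add[OF h] algebra_hom_mult[OF h])

text \<open>Derivations as plain maps, detached from the list encoding of cochains. Linearity over
  \<open>k\<close> is expressed by vanishing on constants: the product rule then yields it whenever
  \<open>\<phi>\<close> fixes constants.\<close>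

definition derivation_along ::
    "'k::comm_ring_1 fls set \<Rightarrow> ('k fls \<Rightarrow> 'k fls) \<Rightarrow> ('k fls \<Rightarrow> 'k fls) \<Rightarrow> bool" where
  "derivation_along B \<phi> D \<longleftrightarrow> (\<forall>c. D (fls_const c) = 0) \<and>
     (\<forall>a\<in>B. \<forall>b\<in>B. D (a + b) = D a + D b \<and> D (a * b) = \<phi> a * D b + D a * \<phi> b)"

text \<open>The only generators besides constants and \<open>x\<close> are inverses, and there the
  product rule applied to \<open>y * (x - s) = 1\<close> forces the value
  \<open>- (\<phi> y)^2 * D x\<close>.\<close>

lemma derivation_along_unique:
  assumes h: "algebra_hom (punctured P) A \<phi>"
    and D: "derivation_along (punctured P) \<phi> D" and E: "derivation_along (punctured P) \<phi> E"
    and X: "D fls_X = E fls_X" and b: "b \<in> punctured P"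
  shows "D b = E b"
  using b
proof (induction rule: punctured_induct)
  case (inv s y)
  have *: "C y = - (\<phi> y * \<phi> y * C fls_X)" if C: "derivation_along (punctured P) \<phi> C" for C
  proof -
    let ?u = "\<phi> fls_X - fls_const s"
    have c: "C (fls_const t) = 0" for t using C by (simp add: derivation_along_def)
    have add: "C (a + b) = C a + C b" and mult: "C (a * b) = \<phi> a * C b + C a * \<phi> b"
      if "a \<in> punctured P" "b \<in> punctured P" for a b
      using C that by (simp_all add: derivation_along_def)
    have Cx: "C (fls_X - fls_const s) = C fls_X"
      using add[of fls_X "fls_const (- s)"] c[of "- s"]
      by (simp add: punctured_intros del: fls_const_uminus) simp
    have u: "\<phi> (fls_X - fls_const s) = ?u"
      by (simp add: algebra_hom_diff[OF h] algebra_hom_const[OF h] punctured_intros)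
    have y: "\<phi> y * ?u = 1" using algebra_hom_inverse[OF h inv(3,2)] .
    have "C (y * (fls_X - fls_const s)) = 0"
      using c[of 1] inv(2) by simp
    then have "\<phi> y * C fls_X + C y * ?u = 0"
      using mult[OF inv(3), of "fls_X - fls_const s"] by (simp add: punctured_intros Cx u)
    then have "\<phi> y * (\<phi> y * C fls_X + C y * ?u) = 0" by simp
    then have "\<phi> y * \<phi> y * C fls_X + C y * (\<phi> y * ?u) = 0"
      by (simp only: distrib_left mult.left_commute mult.assoc)
    then have "C y * (\<phi> y * ?u) = - (\<phi> y * \<phi> y * C fls_X)"
      by (simp only: eq_neg_iff_add_eq_0 add.commute)
    then show ?thesis using y by simp
  qed
  show ?case using *[OF D] *[OF E] X by simp
qed (use D E X in \<open>simp_all add: derivation_along_def\<close>)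

lemma derivation_along_deriv:
  assumes h: "algebra_hom (punctured P) A \<phi>"
  shows "derivation_along (punctured P) \<phi> (\<lambda>b. m * \<phi> (fls_deriv b))"
  unfolding derivation_along_def
  by (auto simp: algebra_hom_add[OF h] algebra_hom_mult[OF h] algebra_hom_zero[OF h]
      fls_deriv_punctured punctured_intros algebra_simps)

text \<open>Companion of the preceding derivation: differentiation after \<open>\<phi>\<close>
  rather than before. Comparing the two at \<open>x\<close> gives the chain rule for
  \<open>g\<close>.\<close>

lemma derivation_along_deriv_comp:
  assumes h: "algebra_hom (punctured P) A \<phi>"
  shows "derivation_along (punctured P) \<phi> (\<lambda>b. m * fls_deriv (\<phi> b))"
  unfolding derivation_along_def
  by (auto simp: algebra_hom_add[OF h] algebra_hom_mult[OF h] algebra_hom_const[OF h] algebra_simps)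

section \<open>Vanishing of the second Hochschild cohomology\<close>

lemma laurent_of_poly_0: "laurent_of_poly 0 = 0"
  by (simp add: laurent_of_poly_def)

lemma laurent_of_poly_diff:
  "laurent_of_poly (p - q) = laurent_of_poly p - laurent_of_poly q"
  using laurent_of_poly_simps(1)[of "p - q" q] by simp

lemma laurent_of_poly_sum: "laurent_of_poly (\<Sum>i\<in>I. h i) = (\<Sum>i\<in>I. laurent_of_poly (h i))"
  by (induction I rule: infinite_finite_induct)
    (simp_all add: laurent_of_poly_simps laurent_of_poly_0)

lemma laurent_of_poly_smult: "laurent_of_poly (smult c p) = fls_const c * laurent_of_poly p"
  using laurent_of_poly_simps(2)[of "[:c:]" p] by (simp add: laurent_of_poly_simps(3))

lemma laurent_of_poly_pCons:
  "laurent_of_poly (pCons a p) = fls_const a + fls_X * laurent_of_poly p"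
proof -
  have "pCons a p = [:a:] + [:0, 1:] * p" by simp
  then show ?thesis by (simp only: laurent_of_poly_simps)
qed

lemma laurent_of_poly_altdef:
  "laurent_of_poly p = (\<Sum>i\<le>degree p. fls_const (coeff p i) * fls_X ^ i)"
proof -
  have "laurent_of_poly (monom c i) = fls_const c * fls_X ^ i" for c :: 'a and i
    by (simp add: monom_altdef laurent_of_poly_smult laurent_of_poly_simps)
  then show ?thesis
    using laurent_of_poly_sum[of "\<lambda>i. monom (coeff p i) i" "{..degree p}"]
    by (simp only: poly_as_sum_of_monoms)
qed

text \<open>\<open>F\<close> may be unnormalised and unsymmetric. The first is why
  \<open>F 1 1\<close> keeps appearing; symmetry comes out at the end, since a primitive over a
  commutative algebra makes \<open>F\<close> symmetric.\<close>

locale hochschild_2_cocycle =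
  fixes P :: "'k::comm_ring_1 set" and F :: "'k fls \<Rightarrow> 'k fls \<Rightarrow> 'k fls"
  assumes fin: "finite P" and units: "\<And>s. s \<in> P \<Longrightarrow> s = 0 \<or> s dvd 1"
    and closed: "\<And>a b. a \<in> punctured P \<Longrightarrow> b \<in> punctured P \<Longrightarrow> F a b \<in> punctured P"
    and linear_left: "\<And>c a b e. a \<in> punctured P \<Longrightarrow> b \<in> punctured P \<Longrightarrow> e \<in> punctured P \<Longrightarrow>
      F (fls_const c * a + b) e = fls_const c * F a e + F b e"
    and linear_right: "\<And>c a b e. a \<in> punctured P \<Longrightarrow> b \<in> punctured P \<Longrightarrow> e \<in> punctured P \<Longrightarrow>
      F e (fls_const c * a + b) = fls_const c * F e a + F e b"
    and cocycle: "\<And>a b e. a \<in> punctured P \<Longrightarrow> b \<in> punctured P \<Longrightarrow> e \<in> punctured P \<Longrightarrow>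
      a * F b e - F (a * b) e + F a (b * e) - F a b * e = 0"
begin

abbreviation "\<A> \<equiv> punctured P"
abbreviation "\<pi> \<equiv> laurent_of_poly :: 'k poly \<Rightarrow> 'k fls"

lemma poly_mem [simp]: "\<pi> p \<in> \<A>"
  unfolding punctured_def by (rule laurent_of_poly_in_gen) simp

lemma const_left: "b \<in> \<A> \<Longrightarrow> F (fls_const c) b = fls_const c * F 1 b"
  and zero_left: "b \<in> \<A> \<Longrightarrow> F 0 b = 0" and zero_right: "b \<in> \<A> \<Longrightarrow> F b 0 = 0"
proof -
  show z: "F 0 b = 0" if "b \<in> \<A>" for b
    using linear_left[of 0 0 b "-1"] that by (simp add: punctured_intros)
  show "F b 0 = 0" if "b \<in> \<A>" for b
    using linear_right[of 0 0 b "-1"] that by (simp add: punctured_intros)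
  show "F (fls_const c) b = fls_const c * F 1 b" if "b \<in> \<A>"
    using linear_left[of 1 0 b c] that by (simp add: punctured_intros z)
qed

text \<open>The cocycle identity at \<open>(1, 1, b)\<close>; together with its mirror image it
  stands in for normalisation.\<close>

lemma one_left: "b \<in> \<A> \<Longrightarrow> F 1 b = F 1 1 * b"
  using cocycle[of 1 1 b] by (simp add: punctured_intros)

lemma one_right: "b \<in> \<A> \<Longrightarrow> F b 1 = b * F 1 1"
  using cocycle[of b 1 1] by (simp add: punctured_intros)

lemma sum_right:
  assumes "a \<in> \<A>" "\<And>i. i \<in> I \<Longrightarrow> u i \<in> \<A>"
  shows "F a (\<Sum>i\<in>I. fls_const (c i) * u i) = (\<Sum>i\<in>I. fls_const (c i) * F a (u i))"
proof -
  have "(\<Sum>i\<in>I. fls_const (c i) * u i) \<in> \<A> \<and> ?thesis"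
    using assms
    by (induction I rule: infinite_finite_induct)
      (auto simp: linear_right zero_right punctured_intros)
  then show ?thesis ..
qed

text \<open>The primitive on \<open>k[x]\<close> is pinned down by prescribing the value \<open>0\<close> at \<open>x\<close>.\<close>

primrec power_primitive :: "nat \<Rightarrow> 'k fls" where
  "power_primitive 0 = F 1 1"
| "power_primitive (Suc n) = fls_X * power_primitive n - F fls_X (fls_X ^ n)"

definition poly_primitive :: "'k poly \<Rightarrow> 'k fls" where
  "poly_primitive p = (\<Sum>i\<le>degree p. fls_const (coeff p i) * power_primitive i)"

lemma poly_primitive_eq:
  assumes "degree p \<le> n"
  shows "poly_primitive p = (\<Sum>i\<le>n. fls_const (coeff p i) * power_primitive i)"
  unfolding poly_primitive_def
  by (rule sum.mono_neutral_left) (use assms in \<open>auto simp: coeff_eq_0\<close>)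

lemma poly_primitive_add: "poly_primitive (p + q) = poly_primitive p + poly_primitive q"
  using poly_primitive_eq[of "p + q" "max (degree p) (degree q)"]
    poly_primitive_eq[of p "max (degree p) (degree q)"]
    poly_primitive_eq[of q "max (degree p) (degree q)"]
  by (simp add: degree_add_le_max sum.distrib distrib_right flip: fls_plus_const)

lemma poly_primitive_smult: "poly_primitive (smult c p) = fls_const c * poly_primitive p"
  unfolding poly_primitive_eq[OF degree_smult_le] poly_primitive_def[of p] sum_distrib_left
  by (intro sum.cong refl) (simp only: coeff_smult fls_const_mult_const[symmetric] mult.assoc)

text \<open>A primitive \<open>h\<close> must satisfy \<open>h 1 = 2 * h 1 - F 1 1\<close>, hence
  \<open>h 1 = F 1 1\<close>; and with \<open>h x = 0\<close> the pair \<open>(x, p)\<close> forces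
  \<open>h (x * p) = x * h p - F x p\<close>. The formula combines the two.\<close>

lemma poly_primitive_pCons:
  "poly_primitive (pCons a p) = fls_const a * F 1 1 + fls_X * poly_primitive p - F fls_X (\<pi> p)"
proof -
  have "poly_primitive (pCons a p) =
      (\<Sum>i\<le>Suc (degree p). fls_const (coeff (pCons a p) i) * power_primitive i)"
    by (rule poly_primitive_eq) (simp add: degree_pCons_le)
  also have "\<dots> = fls_const a * F 1 1 +
      (\<Sum>i\<le>degree p. fls_const (coeff p i) * (fls_X * power_primitive i - F fls_X (fls_X ^ i)))"
    by (simp only: sum.atMost_Suc_shift) simp
  also have "\<dots> = fls_const a * F 1 1 + fls_X * poly_primitive p -
      (\<Sum>i\<le>degree p. fls_const (coeff p i) * F fls_X (fls_X ^ i))"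
    by (simp add: poly_primitive_def sum_distrib_left right_diff_distrib sum_subtractf
        mult.left_commute)
  also have "(\<Sum>i\<le>degree p. fls_const (coeff p i) * F fls_X (fls_X ^ i)) = F fls_X (\<pi> p)"
    unfolding laurent_of_poly_altdef by (rule sum_right[symmetric]) (simp_all add: punctured_intros)
  finally show ?thesis .
qed

lemma poly_primitive_0 [simp]: "poly_primitive 0 = 0"
  by (simp add: poly_primitive_def)

lemma poly_primitive_1: "poly_primitive 1 = F 1 1"
  by (simp add: poly_primitive_def)

lemma poly_primitive_mem: "poly_primitive p \<in> \<A>"
proof (induction p)
  case 0
  then show ?case by (simp add: punctured_intros)
next
  case (pCons a p)
  then show ?case by (simp add: poly_primitive_pCons punctured_intros closed)
qed

text \<open>The recursion imposes the identity only for the left factor \<open>x\<close>; the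
  cocycle identity at \<open>(x, p, q)\<close> carries it over to arbitrary left factors.\<close>

lemma poly_primitive_mult:
  "poly_primitive (p * q) = \<pi> p * poly_primitive q + poly_primitive p * \<pi> q - F (\<pi> p) (\<pi> q)"
proof (induction p)
  case 0
  then show ?case by (simp add: laurent_of_poly_0 zero_left)
next
  case (pCons a p)
  have P: "\<pi> (pCons a p) = fls_const a + fls_X * \<pi> p"
    by (simp add: laurent_of_poly_pCons)
  have F: "F (fls_const a + fls_X * \<pi> p) (\<pi> q) = fls_const a * (F 1 1 * \<pi> q) + F (fls_X * \<pi> p) (\<pi> q)"
    using linear_left[of 1 "fls_X * \<pi> p" "\<pi> q" a]
    by (simp add: punctured_intros one_left[of "\<pi> q"])
  have "F fls_X (\<pi> (p * q)) = F fls_X (\<pi> p) * \<pi> q + F (fls_X * \<pi> p) (\<pi> q) - fls_X * F (\<pi> p) (\<pi> q)"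
    using cocycle[of fls_X "\<pi> p" "\<pi> q"]
    by (simp add: punctured_intros laurent_of_poly_simps algebra_simps)
  then show ?case
    unfolding mult_pCons_left P F poly_primitive_add poly_primitive_smult
      poly_primitive_pCons[of 0] poly_primitive_pCons[of a p] pCons.IH
    by (simp add: algebra_simps)
qed

section \<open>Extension of the primitive from polynomials to fractions\<close>

definition "den = (\<Prod>s\<in>P. [:- s, 1:])"
definition "den_inv = (SOME y. y * \<pi> den = 1)"

lemma den_inv: "den_inv * \<pi> den = 1"
proof -
  obtain y where y: "\<And>s. s \<in> P \<Longrightarrow> y s * (fls_X - fls_const s) = 1"
    using linear_invertible units by metis
  have "prod y P * \<pi> den = 1"
    using y by (simp add: den_def laurent_of_poly_prod laurent_of_poly_simps flip: prod.distrib)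
  then show ?thesis unfolding den_inv_def by (rule someI)
qed

lemma punctured_iff_den: "a \<in> \<A> \<longleftrightarrow> (\<exists>p n. a * \<pi> (den ^ n) = \<pi> p)"
  using punctured_iff[OF fin units, of a]
  by (simp add: den_def laurent_of_poly_prod laurent_of_poly_simps)

lemma den_inv_mem: "den_inv \<in> \<A>"
  unfolding punctured_iff_den using den_inv
  by (metis laurent_of_poly_simps(5) power_one_right)

lemma den_cancel: "\<pi> (den ^ n) * a = \<pi> (den ^ n) * b \<Longrightarrow> a = b"
proof -
  have "den_inv ^ n * \<pi> (den ^ n) = 1"
    by (simp add: laurent_of_poly_simps den_inv flip: power_mult_distrib)
  then show "\<pi> (den ^ n) * a = \<pi> (den ^ n) * b \<Longrightarrow> a = b"
    by (metis mult.assoc mult_1)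
qed

text \<open>
  The primitive \<open>h\<close> extends to fractions because \<open>h (a d) = a h(d) + h(a) d - F(a, d)\<close>
  determines \<open>h(a)\<close> from polynomial values.
\<close>

definition numerator_value :: "'k fls \<Rightarrow> nat \<Rightarrow> 'k fls" where
  "numerator_value a n =
     poly_primitive (THE p. a * \<pi> (den ^ n) = \<pi> p) - a * poly_primitive (den ^ n) + F a (\<pi> (den ^ n))"

text \<open>The exponent is an arbitrary one that clears the denominator; independence of the choice
  is the content of \<open>numerator_value_shift\<close> and \<open>primitive_eq\<close>.\<close>

definition primitive :: "'k fls \<Rightarrow> 'k fls" where
  "primitive a = (let n = (SOME n. \<exists>p. a * \<pi> (den ^ n) = \<pi> p) in den_inv ^ n * numerator_value a n)"

lemma numerator_value_eq:
  "a * \<pi> (den ^ n) = \<pi> p \<Longrightarrow>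
    numerator_value a n = poly_primitive p - a * poly_primitive (den ^ n) + F a (\<pi> (den ^ n))"
  by (simp add: numerator_value_def laurent_of_poly_inj)

text \<open>Consistency of the extension. The error terms cancel by the cocycle identity at
  \<open>(a, den^n, den^m)\<close> and the product formula for polynomials.\<close>

lemma numerator_value_shift:
  assumes a: "a \<in> \<A>" and p: "a * \<pi> (den ^ n) = \<pi> p"
  shows "numerator_value a (n + m) = \<pi> (den ^ m) * numerator_value a n"
proof -
  let ?d = "den ^ n" and ?e = "den ^ m"
  have "a * \<pi> (den ^ (n + m)) = \<pi> (p * ?e)"
    using p by (simp add: laurent_of_poly_simps power_add flip: mult.assoc)
  from numerator_value_eq[OF this] have "numerator_value a (n + m) =
      poly_primitive (p * ?e) - a * poly_primitive (?d * ?e) + F a (\<pi> ?d * \<pi> ?e)"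
    by (simp only: power_add laurent_of_poly_simps(2))
  moreover have "a * F (\<pi> ?d) (\<pi> ?e) - F (\<pi> p) (\<pi> ?e) + F a (\<pi> ?d * \<pi> ?e) - F a (\<pi> ?d) * \<pi> ?e = 0"
    using cocycle[OF a, of "\<pi> ?d" "\<pi> ?e"] p by simp
  moreover have "poly_primitive (p * ?e) =
      a * (\<pi> ?d * poly_primitive ?e) + poly_primitive p * \<pi> ?e - F (\<pi> p) (\<pi> ?e)"
    unfolding poly_primitive_mult[of p] by (simp flip: p add: mult.assoc)
  ultimately show ?thesis
    unfolding numerator_value_eq[OF p] poly_primitive_mult[of ?d]
    by (simp add: algebra_simps)
qed

lemma primitive_eq:
  assumes a: "a \<in> \<A>" and p: "a * \<pi> (den ^ n) = \<pi> p"
  shows "\<pi> (den ^ n) * primitive a =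
    poly_primitive p - a * poly_primitive (den ^ n) + F a (\<pi> (den ^ n))"
proof -
  define m where "m = (SOME n. \<exists>p. a * \<pi> (den ^ n) = \<pi> p)"
  have "\<exists>q. a * \<pi> (den ^ m) = \<pi> q" unfolding m_def by (rule someI_ex) (use p in blast)
  then obtain q where q: "a * \<pi> (den ^ m) = \<pi> q" ..
  have "den_inv ^ m * \<pi> (den ^ m) = 1"
    by (simp add: laurent_of_poly_simps den_inv flip: power_mult_distrib)
  then have "\<pi> (den ^ m) * primitive a = numerator_value a m"
    by (simp add: primitive_def Let_def m_def[symmetric] mult.assoc[symmetric] mult.commute)
  \<comment> \<open>The exponents \<open>n\<close> and \<open>m\<close> are compared through their
    sum, reached once from each side.\<close>
  then have "\<pi> (den ^ m) * (\<pi> (den ^ n) * primitive a) = \<pi> (den ^ m) * numerator_value a n"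
    using numerator_value_shift[OF a p, of m] numerator_value_shift[OF a q, of n]
    by (metis mult.left_commute add.commute)
  then show ?thesis using den_cancel numerator_value_eq[OF p] by metis
qed

lemma common_denominator:
  assumes "a \<in> \<A>" "b \<in> \<A>"
  obtains n p q where "a * \<pi> (den ^ n) = \<pi> p" "b * \<pi> (den ^ n) = \<pi> q"
proof -
  obtain n m p q where "a * \<pi> (den ^ n) = \<pi> p" "b * \<pi> (den ^ m) = \<pi> q"
    using assms unfolding punctured_iff_den by blast
  then have "a * \<pi> (den ^ (n + m)) = \<pi> (p * den ^ m)"
    and "b * \<pi> (den ^ (n + m)) = \<pi> (q * den ^ n)"
    unfolding power_add laurent_of_poly_simps(2) by (metis mult.assoc, metis mult.assoc mult.commute)
  then show ?thesis using that by blast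
qed

lemma primitive_mem: "primitive a \<in> \<A>" if a: "a \<in> \<A>"
proof -
  obtain n p where p: "a * \<pi> (den ^ n) = \<pi> p" using a unfolding punctured_iff_den by blast
  have "\<pi> (den ^ n) * primitive a \<in> \<A>"
    unfolding primitive_eq[OF a p] by (simp add: a punctured_intros poly_primitive_mem closed)
  then have "den_inv ^ n * (\<pi> (den ^ n) * primitive a) \<in> \<A>"
    by (simp only: den_inv_mem punctured_intros)
  moreover have "den_inv ^ n * \<pi> (den ^ n) = 1"
    by (simp add: laurent_of_poly_simps den_inv flip: power_mult_distrib)
  ultimately show ?thesis by (simp flip: mult.assoc)
qed

lemma primitive_linear:
  assumes a: "a \<in> \<A>" and b: "b \<in> \<A>"
  shows "primitive (fls_const c * a + b) = fls_const c * primitive a + primitive b"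
proof -
  obtain n p q where p: "a * \<pi> (den ^ n) = \<pi> p" and q: "b * \<pi> (den ^ n) = \<pi> q"
    using common_denominator[OF a b] .
  have pq: "(fls_const c * a + b) * \<pi> (den ^ n) = \<pi> ([:c:] * p + q)"
    by (simp only: distrib_right mult.assoc p q laurent_of_poly_simps(1-3))
  have ab: "fls_const c * a + b \<in> \<A>" using a b by (simp add: punctured_intros)
  have "\<pi> (den ^ n) * primitive (fls_const c * a + b) =
      \<pi> (den ^ n) * (fls_const c * primitive a + primitive b)"
    unfolding distrib_left mult.left_commute[of _ "fls_const c"] primitive_eq[OF a p]
      primitive_eq[OF b q] primitive_eq[OF ab pq] linear_left[OF a b poly_mem]
    by (simp add: poly_primitive_add poly_primitive_smult algebra_simps)
  then show ?thesis by (rule den_cancel)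
qed

lemma primitive_poly: "primitive (\<pi> p) = poly_primitive p"
proof -
  have "1 * primitive (\<pi> p) = poly_primitive p - \<pi> p * F 1 1 + F (\<pi> p) 1"
    using primitive_eq[OF poly_mem[of p], of 0 p]
    by (simp only: power_0 laurent_of_poly_simps(5) poly_primitive_1 mult_1_right simp_thms)
  then show ?thesis using one_right[OF poly_mem[of p]] by simp
qed

text \<open>Multiplying by a denominator \<open>D\<close> of \<open>b\<close> reduces the claim to
  the polynomial formula for \<open>p\<close> and \<open>q = b * D\<close>; the cocycle identity at
  \<open>(p, b, D)\<close> accounts for the remaining terms.\<close>

lemma primitive_poly_mult:
  assumes b: "b \<in> \<A>"
  shows "primitive (\<pi> p * b) = \<pi> p * primitive b + primitive (\<pi> p) * b - F (\<pi> p) b"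
proof -
  obtain n q where q: "b * \<pi> (den ^ n) = \<pi> q" using b unfolding punctured_iff_den by blast
  let ?D = "\<pi> (den ^ n)"
  have pq: "(\<pi> p * b) * ?D = \<pi> (p * q)" by (simp add: laurent_of_poly_simps mult.assoc flip: q)
  have pb: "\<pi> p * b \<in> \<A>" using b by (simp add: punctured_intros)
  have c: "\<pi> p * F b ?D - F (\<pi> p * b) ?D + F (\<pi> p) (\<pi> q) - F (\<pi> p) b * ?D = 0"
    using cocycle[of "\<pi> p" b ?D] b q by simp
  have "?D * primitive (\<pi> p * b) = \<pi> p * (?D * primitive b) + ?D * (poly_primitive p * b - F (\<pi> p) b)"
    unfolding primitive_eq[OF b q] primitive_eq[OF pb pq] poly_primitive_mult[of p]
    using c by (simp add: algebra_simps flip: q)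
  then have "?D * primitive (\<pi> p * b) =
      ?D * (\<pi> p * primitive b + primitive (\<pi> p) * b - F (\<pi> p) b)"
    unfolding primitive_poly by (simp add: algebra_simps)
  then show ?thesis by (rule den_cancel)
qed

text \<open>The left factors for which the identity holds against all right factors are closed under
  sums, products and the relevant inverses. This is why the right factor stays quantified during the
  induction.\<close>

lemma primitive_mult:
  assumes "a \<in> \<A>"
  shows "\<forall>b\<in>\<A>. primitive (a * b) = a * primitive b + primitive a * b - F a b"
  using assms
proof (induction rule: punctured_induct)
  case (const c)
  show ?case using primitive_poly_mult[of _ "[:c:]"] unfolding laurent_of_poly_simps(3) by blast
next
  case X
  show ?case using primitive_poly_mult[of _ "[:0, 1:]"] unfolding laurent_of_poly_simps(4) by blast
next
  case (add a b)
  have F: "F (a + b) e = F a e + F b e" if "e \<in> \<A>" for e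
    using linear_left[of a b e 1] add.hyps that by simp
  have pr: "primitive (a' + b') = primitive a' + primitive b'" if "a' \<in> \<A>" "b' \<in> \<A>" for a' b'
    using primitive_linear[of a' b' 1] that by simp
  show ?case
  proof
    fix e assume e: "e \<in> \<A>"
    have "primitive ((a + b) * e) = primitive (a * e) + primitive (b * e)"
      using pr[of "a * e" "b * e"] add.hyps e by (simp add: distrib_right punctured_intros)
    also have "\<dots> = a * primitive e + primitive a * e - F a e + (b * primitive e + primitive b * e - F b e)"
      using add.IH e by simp
    finally show "primitive ((a + b) * e) = (a + b) * primitive e + primitive (a + b) * e - F (a + b) e"
      unfolding F[OF e] pr[OF add.hyps] by (simp add: algebra_simps)
  qed
next
  case (mult a b)
  show ?case
  proof
    fix e assume e: "e \<in> \<A>"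
    have "primitive (a * b * e) = a * primitive (b * e) + primitive a * (b * e) - F a (b * e)"
      using mult.IH(1) mult.hyps(2) e by (simp add: mult.assoc punctured_intros)
    moreover have "primitive (b * e) = b * primitive e + primitive b * e - F b e"
      using mult.IH(2) e by simp
    moreover have ab: "primitive (a * b) = a * primitive b + primitive a * b - F a b"
      using mult.IH(1) mult.hyps(2) by simp
    moreover have "F a (b * e) = F a b * e + F (a * b) e - a * F b e"
      using cocycle[OF mult.hyps e] by (simp add: algebra_simps)
    ultimately have "primitive (a * b * e) =
        a * (b * primitive e + primitive b * e - F b e) + primitive a * (b * e)
          - (F a b * e + F (a * b) e - a * F b e)"
      by simp
    also have "\<dots> = a * b * primitive e + (a * primitive b + primitive a * b - F a b) * e - F (a * b) e"
      by (simp add: algebra_simps)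
    finally show "primitive (a * b * e) = a * b * primitive e + primitive (a * b) * e - F (a * b) e"
      using ab by simp
  qed
next
  case (inv s y)
  define u where "u = fls_X - fls_const s"
  have yu: "y * u = 1" using inv by (simp add: u_def)
  have u: "u \<in> \<A>" by (simp add: u_def punctured_intros)
  have U: "primitive (u * b) = u * primitive b + primitive u * b - F u b" if "b \<in> \<A>" for b
    using primitive_poly_mult[OF that, of "[:- s, 1:]"] by (simp add: laurent_of_poly_simps u_def)
  have y: "y \<in> \<A>" by fact
  \<comment> \<open>The identity is known for the left factor \<open>u\<close>. Applying it to the
    right factors \<open>y * b\<close> and \<open>y\<close>, and the cocycle identity to
    \<open>(u, y, b)\<close>, expresses \<open>u\<close> times each unknown value; multiplication by
    \<open>y\<close> then removes \<open>u\<close>.\<close>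
  have uyb: "u * (y * b) = b" for b using yu by (metis mult.assoc mult.commute mult_1)
  show ?case
  proof
    fix b assume b: "b \<in> \<A>"
    have yb: "y * b \<in> \<A>" using y b by (rule punctured_intros)
    have p1: "primitive 1 = F 1 1"
      using primitive_poly[of 1] by (simp add: laurent_of_poly_simps poly_primitive_1)
    have e1: "u * primitive (y * b) = primitive b - primitive u * (y * b) + F u (y * b)"
    proof -
      have "primitive b = u * primitive (y * b) + primitive u * (y * b) - F u (y * b)"
        using U[OF yb] by (simp only: uyb)
      then show ?thesis by (simp add: algebra_simps)
    qed
    have e2: "u * primitive y = F 1 1 - primitive u * y + F u y"
    proof -
      have "F 1 1 = u * primitive y + primitive u * y - F u y"
        using U[OF y] uyb[of 1] p1 by simp
      then show ?thesis by (simp add: algebra_simps)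
    qed
    have e3: "u * F y b = F 1 1 * b - F u (y * b) + F u y * b"
    proof -
      have "u * F y b - F 1 1 * b + F u (y * b) - F u y * b = 0"
        using cocycle[OF u y b] uyb[of 1] one_left[OF b] by simp
      then show ?thesis by (simp add: algebra_simps)
    qed
    have "u * (y * primitive b + primitive y * b - F y b) =
        u * (y * primitive b) + (u * primitive y) * b - u * F y b"
      by (simp only: distrib_left right_diff_distrib mult.assoc)
    also have "\<dots> = primitive b - primitive u * (y * b) + F u (y * b)"
      unfolding e2 e3 uyb by (simp add: algebra_simps)
    finally have "u * primitive (y * b) = u * (y * primitive b + primitive y * b - F y b)"
      using e1 by simp
    then have "y * u * primitive (y * b) = y * u * (y * primitive b + primitive y * b - F y b)"
      by (simp only: mult.assoc)
    then show "primitive (y * b) = y * primitive b + primitive y * b - F y b"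
      by (simp add: yu)
  qed
qed

end

section \<open>Cochains of low degree\<close>

lemma hochschild_d_Nil [simp]: "hochschild_d B \<phi> h [] = 0"
  by (simp add: hochschild_d_def)

lemma hochschild_d_1 [simp]: "hochschild_d B \<phi> h [a] = 0"
  by (simp add: hochschild_d_def mult.commute)

lemma hochschild_d_2:
  "a \<in> B \<Longrightarrow> b \<in> B \<Longrightarrow> hochschild_d B \<phi> h [a, b] = \<phi> a * h [b] - h [a * b] + h [a] * \<phi> b"
  by (simp add: hochschild_d_def)

lemma hochschild_d_3:
  "a \<in> B \<Longrightarrow> b \<in> B \<Longrightarrow> e \<in> B \<Longrightarrow>
    hochschild_d B \<phi> h [a, b, e] = \<phi> a * h [b, e] - h [a * b, e] + h [a, b * e] - h [a, b] * \<phi> e"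
  by (simp add: hochschild_d_def numeral_2_eq_2 lessThan_Suc)

lemma hochschild_d_outside: "bs \<notin> lists B \<Longrightarrow> hochschild_d B \<phi> h bs = 0"
  by (simp add: hochschild_d_def)

lemma hochschild_d_length:
  assumes "\<And>bs. length bs \<noteq> n \<Longrightarrow> h bs = 0" and "length bs \<noteq> Suc n"
  shows "hochschild_d B \<phi> h bs = 0"
proof (cases bs)
  case (Cons b cs)
  then have "h (tl bs) = 0" "h (butlast bs) = 0" using assms by auto
  moreover have "h (take i bs @ [bs ! i * bs ! Suc i] @ drop (Suc (Suc i)) bs) = 0"
    if "i < length bs - 1" for i
    using that assms by auto
  ultimately show ?thesis by (simp add: hochschild_d_def)
qed simp

lemma hochschild_d_zero [simp]: "hochschild_d B \<phi> 0 = 0"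
  by (simp add: hochschild_d_def fun_eq_iff)

lemma hochschild_d_linear:
  "hochschild_d B \<phi> ((\<lambda>bs. fls_const c * h bs) + h') =
    (\<lambda>bs. fls_const c * hochschild_d B \<phi> h bs) + hochschild_d B \<phi> h'"
proof
  fix bs
  show "hochschild_d B \<phi> ((\<lambda>bs. fls_const c * h bs) + h') bs =
    ((\<lambda>bs. fls_const c * hochschild_d B \<phi> h bs) + hochschild_d B \<phi> h') bs"
  proof (cases "bs \<in> lists B \<and> bs \<noteq> []")
    case True
    have [simp]: "(\<Sum>i\<in>I. (-1) ^ Suc i * (fls_const c * h (u i) + h' (u i))) =
        fls_const c * (\<Sum>i\<in>I. (-1) ^ Suc i * h (u i)) + (\<Sum>i\<in>I. (-1) ^ Suc i * h' (u i))"
      for I :: "nat set" and u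
      by (simp only: distrib_left sum.distrib sum_distrib_left mult.left_commute)
    then show ?thesis
      using True unfolding hochschild_d_def plus_fun_apply
      by (simp del: power_Suc) (simp add: algebra_simps)
  qed (auto simp: hochschild_d_def)
qed

lemma hochschild_cochains_zero: "0 \<in> hochschild_cochains B (punctured Q) n"
  by (auto simp: hochschild_cochains_def punctured_intros)

lemma hochschild_cochains_linear:
  assumes "h \<in> hochschild_cochains B (punctured Q) n" "h' \<in> hochschild_cochains B (punctured Q) n"
  shows "(\<lambda>bs. fls_const c * h bs) + h' \<in> hochschild_cochains B (punctured Q) n"
  using assms unfolding hochschild_cochains_def
  by (auto simp: punctured_intros) (simp add: algebra_simps)

section \<open>Cochains of degree one and two as functions of one and two arguments\<close>

definition cochain1 :: "'k::comm_ring_1 fls set \<Rightarrow> ('k fls \<Rightarrow> 'k fls) \<Rightarrow> 'k cochain" where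
  "cochain1 B D bs = (if bs \<in> lists B \<and> length bs = 1 then D (hd bs) else 0)"

lemma cochain1_apply [simp]: "b \<in> B \<Longrightarrow> cochain1 B D [b] = D b"
  by (simp add: cochain1_def)

lemma cochain1_mem:
  assumes "\<And>b. b \<in> punctured P \<Longrightarrow> D b \<in> A"
    and "\<And>c a b. a \<in> punctured P \<Longrightarrow> b \<in> punctured P \<Longrightarrow>
      D (fls_const c * a + b) = fls_const c * D a + D b"
  shows "cochain1 (punctured P) D \<in> hochschild_cochains (punctured P) A 1"
  unfolding hochschild_cochains_def mem_Collect_eq
proof (intro conjI allI ballI impI)
  fix bs i c a b
  assume "bs \<in> lists (punctured P)" "length bs = 1" "i < (1 :: nat)"
    and ab: "a \<in> punctured P" "b \<in> punctured P"
  then obtain e where "bs = [e]" "i = 0" by (auto simp: length_Suc_conv)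
  then show "cochain1 (punctured P) D (bs[i := fls_const c * a + b]) =
      fls_const c * cochain1 (punctured P) D (bs[i := a]) + cochain1 (punctured P) D (bs[i := b])"
    using assms(2) ab by (simp add: punctured_intros)
next
  fix bs assume "bs \<in> lists (punctured P) \<and> length bs = 1"
  then show "cochain1 (punctured P) D bs \<in> A" using assms(1) by (auto simp: length_Suc_conv)
qed (auto simp: cochain1_def)

lemma
  assumes h: "h \<in> hochschild_cochains B A 1"
  shows hochschild_cochains_1_mem: "b \<in> B \<Longrightarrow> h [b] \<in> A"
    and hochschild_cochains_1_linear:
      "a \<in> B \<Longrightarrow> b \<in> B \<Longrightarrow> h [fls_const c * a + b] = fls_const c * h [a] + h [b]"
    and hochschild_cochains_1_eq: "h = cochain1 B (\<lambda>b. h [b])"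
proof -
  show "b \<in> B \<Longrightarrow> h [b] \<in> A" using h by (auto simp: hochschild_cochains_def)
  have "\<forall>bs\<in>lists B. length bs = 1 \<longrightarrow> (\<forall>i<1. \<forall>c. \<forall>a\<in>B. \<forall>b\<in>B.
      h (bs[i := fls_const c * a + b]) = fls_const c * h (bs[i := a]) + h (bs[i := b]))"
    using h unfolding hochschild_cochains_def by blast
  from this[rule_format, of "[a]" 0 a b c]
  show "a \<in> B \<Longrightarrow> b \<in> B \<Longrightarrow> h [fls_const c * a + b] = fls_const c * h [a] + h [b]" by simp
  have "bs \<notin> lists B \<or> length bs \<noteq> 1 \<Longrightarrow> h bs = 0" for bs
    using h by (auto simp: hochschild_cochains_def)
  then show "h = cochain1 B (\<lambda>b. h [b])"
    by (auto simp: cochain1_def fun_eq_iff length_Suc_conv)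
qed

lemma
  assumes h: "h \<in> hochschild_cochains B A 2"
  shows hochschild_cochains_2_mem: "a \<in> B \<Longrightarrow> b \<in> B \<Longrightarrow> h [a, b] \<in> A"
    and hochschild_cochains_2_left:
      "a \<in> B \<Longrightarrow> b \<in> B \<Longrightarrow> e \<in> B \<Longrightarrow> h [fls_const c * a + b, e] = fls_const c * h [a, e] + h [b, e]"
    and hochschild_cochains_2_right:
      "a \<in> B \<Longrightarrow> b \<in> B \<Longrightarrow> e \<in> B \<Longrightarrow> h [e, fls_const c * a + b] = fls_const c * h [e, a] + h [e, b]"
    and hochschild_cochains_2_outside: "bs \<notin> lists B \<or> length bs \<noteq> 2 \<Longrightarrow> h bs = 0"
proof -
  show "a \<in> B \<Longrightarrow> b \<in> B \<Longrightarrow> h [a, b] \<in> A" using h by (auto simp: hochschild_cochains_def)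
  have *: "\<forall>bs\<in>lists B. length bs = 2 \<longrightarrow> (\<forall>i<2. \<forall>c. \<forall>a\<in>B. \<forall>b\<in>B.
      h (bs[i := fls_const c * a + b]) = fls_const c * h (bs[i := a]) + h (bs[i := b]))"
    using h unfolding hochschild_cochains_def by blast
  from *[rule_format, of "[a, e]" 0 a b c] *[rule_format, of "[e, a]" 1 a b c]
  show "a \<in> B \<Longrightarrow> b \<in> B \<Longrightarrow> e \<in> B \<Longrightarrow> h [fls_const c * a + b, e] = fls_const c * h [a, e] + h [b, e]"
    and "a \<in> B \<Longrightarrow> b \<in> B \<Longrightarrow> e \<in> B \<Longrightarrow> h [e, fls_const c * a + b] = fls_const c * h [e, a] + h [e, b]"
    by simp_all
  show "bs \<notin> lists B \<or> length bs \<noteq> 2 \<Longrightarrow> h bs = 0" using h by (auto simp: hochschild_cochains_def)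
qed

lemma hochschild_d_cochain1_eq:
  assumes "h \<in> hochschild_cochains B A 1"
    and "\<And>bs. bs \<notin> lists B \<or> length bs \<noteq> 2 \<Longrightarrow> k bs = 0"
    and "\<And>a b. a \<in> B \<Longrightarrow> b \<in> B \<Longrightarrow> k [a, b] = \<phi> a * h [b] - h [a * b] + h [a] * \<phi> b"
  shows "hochschild_d B \<phi> h = k"
proof
  fix bs
  show "hochschild_d B \<phi> h bs = k bs"
  proof (cases "bs \<in> lists B \<and> length bs = 2")
    case True
    then obtain a b where "bs = [a, b]" "a \<in> B" "b \<in> B"
      by (auto simp: numeral_2_eq_2 length_Suc_conv)
    then show ?thesis using assms(3) by (simp add: hochschild_d_2)
  next
    case False
    have "length bs \<noteq> 2 \<Longrightarrow> hochschild_d B \<phi> h bs = 0"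
      using hochschild_d_length[of 1 h bs B \<phi>] assms(1) by (auto simp: hochschild_cochains_def)
    then show ?thesis using False assms(2) hochschild_d_outside[of bs B \<phi> h] by auto
  qed
qed

text \<open>Applied to \<open>B\<close> and to \<open>A\<close> with coefficients in themselves: in
  a 2-cochain of the diagram the two components from \<open>B\<close> to \<open>A\<close> already
  have degree one.\<close>

lemma hochschild_cohomology_2_trivial:
  assumes P: "finite P" "\<And>s. s \<in> P \<Longrightarrow> s = 0 \<or> s dvd 1"
    and h: "h \<in> hochschild_cochains (punctured P) (punctured P) 2"
    and d: "hochschild_d (punctured P) id h = 0"
  obtains u where "u \<in> hochschild_cochains (punctured P) (punctured P) 1"
    and "hochschild_d (punctured P) id u = h"
proof -
  interpret hochschild_2_cocycle P "\<lambda>a b. h [a, b]"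
  proof
    fix a b e assume abe: "a \<in> punctured P" "b \<in> punctured P" "e \<in> punctured P"
    have "hochschild_d (punctured P) id h [a, b, e] = 0" using d by simp
    then show "a * h [b, e] - h [a * b, e] + h [a, b * e] - h [a, b] * e = 0"
      using abe by (simp add: hochschild_d_3)
  qed (use P hochschild_cochains_2_mem[OF h] hochschild_cochains_2_left[OF h]
      hochschild_cochains_2_right[OF h] in simp_all)
  have u: "cochain1 \<A> primitive \<in> hochschild_cochains \<A> \<A> 1"
    by (rule cochain1_mem) (simp_all add: primitive_mem primitive_linear)
  moreover have "hochschild_d \<A> id (cochain1 \<A> primitive) = h"
    by (rule hochschild_d_cochain1_eq[OF u hochschild_cochains_2_outside[OF h]])
      (simp_all add: primitive_mult punctured_intros)
  ultimately show ?thesis using that by blast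
qed

lemma derivation_derivation_along:
  assumes "derivation (punctured P) A \<phi> D" and "\<phi> 1 = 1"
  shows "derivation_along (punctured P) \<phi> (\<lambda>b. D [b])"
proof -
  have D: "D \<in> hochschild_cochains (punctured P) A 1"
    and m: "\<And>a b. a \<in> punctured P \<Longrightarrow> b \<in> punctured P \<Longrightarrow> D [a * b] = \<phi> a * D [b] + D [a] * \<phi> b"
    using assms by (auto simp: derivation_def)
  note l = hochschild_cochains_1_linear[OF D]
  have "D [1] = 0" using m[of 1 1] assms(2) by (simp add: punctured_intros)
  moreover have "D [0] = 0" using l[of 0 0 1] by (simp add: punctured_intros)
  ultimately have "D [fls_const c] = 0" for c using l[of 1 0 c] by (simp add: punctured_intros)
  moreover have "a \<in> punctured P \<Longrightarrow> b \<in> punctured P \<Longrightarrow> D [a + b] = D [a] + D [b]" for a b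
    using l[of a b 1] by simp
  ultimately show ?thesis using m by (simp add: derivation_along_def)
qed

lemma derivation_cochain1:
  assumes h: "algebra_hom (punctured P) A \<phi>" and D: "derivation_along (punctured P) \<phi> D"
    and mem: "\<And>b. b \<in> punctured P \<Longrightarrow> D b \<in> A"
  shows "derivation (punctured P) A \<phi> (cochain1 (punctured P) D)"
proof -
  have "cochain1 (punctured P) D \<in> hochschild_cochains (punctured P) A 1"
  proof (rule cochain1_mem)
    fix c a b assume "a \<in> punctured P" "b \<in> punctured P"
    then show "D (fls_const c * a + b) = fls_const c * D a + D b"
      using D by (simp add: derivation_along_def punctured_intros algebra_hom_const[OF h])
  qed (fact mem)
  then show ?thesis using D by (simp add: derivation_def derivation_along_def punctured_intros)
qed

lemma derivation_d_zero:
  assumes "derivation B A \<phi> D"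
  shows "hochschild_d B \<phi> D = 0"
proof -
  have D: "D \<in> hochschild_cochains B A 1" using assms by (simp add: derivation_def)
  show ?thesis
    by (rule hochschild_d_cochain1_eq[OF D]) (use assms in \<open>auto simp: derivation_def\<close>)
qed

lemma derivation_diff:
  assumes "derivation B (punctured Q) \<phi> D" "derivation B (punctured Q) \<phi> E"
  shows "derivation B (punctured Q) \<phi> (D - E)"
proof -
  have "(\<lambda>bs. fls_const (- 1) * E bs) + D \<in> hochschild_cochains B (punctured Q) 1"
    using assms by (intro hochschild_cochains_linear) (auto simp: derivation_def)
  moreover have "(\<lambda>bs. fls_const (- 1) * E bs) + D = D - E" by (auto simp: fun_eq_iff)
  ultimately have "D - E \<in> hochschild_cochains B (punctured Q) 1" by (simp only:)
  then show ?thesis using assms by (simp add: derivation_def algebra_simps)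
qed

section \<open>The second cohomology of the diagram\<close>

lemma fls_const_sum: "fls_const (\<Sum>i\<in>I. c i) = (\<Sum>i\<in>I. fls_const (c i))"
  by (induction I rule: infinite_finite_induct) (simp_all flip: fls_plus_const)

lemma quad_scale_simp:
  "quad_scale c (GB, GA, Gf, Gg) + (GB', GA', Gf', Gg') =
    ((\<lambda>bs. fls_const c * GB bs) + GB', (\<lambda>bs. fls_const c * GA bs) + GA',
     (\<lambda>bs. fls_const c * Gf bs) + Gf', (\<lambda>bs. fls_const c * Gg bs) + Gg')"
  by (simp add: quad_scale_def)

lemma quad_scale_add: "quad_scale c (G + G') = quad_scale c G + quad_scale c G'"
  by (cases G; cases G') (simp add: quad_scale_def fun_eq_iff distrib_left)

lemma quad_scale_one: "quad_scale 1 G = G"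
  by (cases G) (simp add: quad_scale_def)

lemma quad_scale_uminus: "quad_scale (- 1) G = - G"
  by (cases G) (simp add: quad_scale_def fun_eq_iff)

locale parallel_maps =
  fixes lam mu :: "'k::comm_ring_1" and B A :: "'k fls set" and f g :: "'k fls \<Rightarrow> 'k fls"
  assumes lam_mu: "lam * mu = 1" and lam_neq: "lam \<noteq> 0" "lam \<noteq> 1"
    and B_def: "B = punctured {0, 1}" and A_def: "A = punctured {0, 1, lam}"
    and f_hom: "algebra_hom B A f" and f_X: "f fls_X = fls_X"
    and g_hom: "algebra_hom B A g" and g_X: "g fls_X = fls_const mu * fls_X"
begin

lemma const_lam_mu: "fls_const lam * fls_const mu = 1" "fls_const lam * (fls_const mu * a) = a"
    "fls_const mu * (fls_const lam * a) = a"
proof -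
  show *: "fls_const lam * fls_const mu = 1" using lam_mu by simp
  then show "fls_const lam * (fls_const mu * a) = a"
    by (metis mult.assoc mult_1)
  then show "fls_const mu * (fls_const lam * a) = a"
    by (metis mult.left_commute)
qed

lemma B_subset_A: "b \<in> B \<Longrightarrow> b \<in> A"
  using punctured_mono[of "{0, 1}" "{0, 1, lam}"] by (auto simp: A_def B_def)

lemma units_B: "s \<in> {0, 1} \<Longrightarrow> s = 0 \<or> s dvd (1 :: 'k)"
  and units_A: "s \<in> {0, 1, lam} \<Longrightarrow> s = 0 \<or> s dvd 1"
  using lam_mu by (auto intro: dvdI[of 1 lam mu])

lemmas B_intros = punctured_intros[where P = "{0, 1} :: 'k set", folded B_def]
lemmas A_intros = punctured_intros[where P = "{0, 1, lam}", folded A_def]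
lemmas deriv_B = fls_deriv_punctured[where P = "{0, 1} :: 'k set", folded B_def]
lemmas f_eq = algebra_hom_inclusion[OF f_hom[unfolded B_def] f_X, folded B_def]
lemmas g_closed = algebra_hom_closed[OF g_hom]
lemmas g_const = algebra_hom_const[OF g_hom]
lemmas g_one = algebra_hom_one[OF g_hom]
lemmas g_zero = algebra_hom_zero[OF g_hom]
lemmas g_add = algebra_hom_add[OF g_hom]
lemmas g_mult = algebra_hom_mult[OF g_hom]
lemmas g_linear = algebra_hom_linear[OF g_hom[unfolded B_def], folded B_def]
lemmas g_scale = algebra_hom_scale[OF g_hom[unfolded B_def], folded B_def]
lemmas g_diff = algebra_hom_diff[OF g_hom[unfolded B_def], folded B_def]
lemmas g_power = algebra_hom_power[OF g_hom[unfolded B_def], folded B_def]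

text \<open>Chain rule for the rescaling. Both sides are derivations along \<open>g\<close> with
  value \<open>mu\<close> at \<open>x\<close>, so uniqueness settles it although \<open>g\<close> is
  given only by its value at \<open>x\<close>.\<close>

lemma g_deriv:
  assumes "b \<in> B"
  shows "fls_deriv (g b) = fls_const mu * g (fls_deriv b)"
proof -
  have h: "algebra_hom (punctured {0, 1}) A g" using g_hom by (simp add: B_def)
  have "1 * fls_deriv (g b) = fls_const mu * g (fls_deriv b)"
    by (rule derivation_along_unique[OF h derivation_along_deriv_comp[OF h] derivation_along_deriv[OF h]])
      (use assms in \<open>simp_all add: B_def g_X g_one fls_deriv_mult_const_left\<close>)
  then show ?thesis by simp
qed

abbreviation "W \<equiv> diag_coboundaries B A f g 2"
abbreviation "H \<equiv> diag_cohomology B A f g 2"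

definition twist :: "'k fls \<Rightarrow> 'k fls" where
  "twist b = b - fls_const lam * g b"

definition twists :: "'k fls set" where
  "twists = twist ` B"

text \<open>Normal form with trivial component along \<open>g\<close>: since the value along
  \<open>f\<close> at \<open>x\<close> may be any element of \<open>A\<close>, every value of the
  invariant combination is already realised.\<close>

definition deriv_quad :: "'k fls \<Rightarrow> 'k quad" where
  "deriv_quad a = (0, 0, cochain1 B (\<lambda>b. a * fls_deriv b), 0)"

definition kappa :: "'k fls \<Rightarrow> 'k quad set" where
  "kappa a = diag_class B A f g 2 (deriv_quad a)"

lemma subspace_twists: "fls_mod.subspace twists"
proof (rule fls_mod.subspaceI)
  show "0 \<in> twists" unfolding twists_def
    by (rule image_eqI[of _ _ 0]) (simp_all add: twist_def g_zero B_intros)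
  fix x y c assume "x \<in> twists"
  then obtain a where a: "x = twist a" "a \<in> B" by (auto simp: twists_def)
  have "twist (fls_const c * a) = fls_const c * x"
    unfolding a(1) twist_def g_scale[OF a(2)] by (simp only: right_diff_distrib mult.left_commute)
  then show "fls_const c * x \<in> twists"
    using a(2) unfolding twists_def by (metis B_intros(1) imageI B_intros(9))
  assume "y \<in> twists"
  then obtain b where b: "y = twist b" "b \<in> B" by (auto simp: twists_def)
  have "twist (a + b) = x + y" unfolding a(1) b(1) twist_def g_add[OF a(2) b(2)] by (simp add: distrib_left)
  then show "x + y \<in> twists" using a b unfolding twists_def by (metis imageI B_intros(6))
qed

subsection \<open>Coboundaries\<close>

lemma diag_d_linear:
  assumes "G \<in> diag_cochains B A 1" "G' \<in> diag_cochains B A 1"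
  shows "quad_scale c G + G' \<in> diag_cochains B A 1"
    and "diag_d B A f g (quad_scale c G + G') = quad_scale c (diag_d B A f g G) + diag_d B A f g G'"
proof -
  obtain GB GA Gf Gg GB' GA' Gf' Gg' where G: "G = (GB, GA, Gf, Gg)" "G' = (GB', GA', Gf', Gg')"
    by (cases G; cases G')
  have mem: "GB \<in> hochschild_cochains B B 1" "GB' \<in> hochschild_cochains B B 1"
    "GA \<in> hochschild_cochains A A 1" "GA' \<in> hochschild_cochains A A 1"
    "Gf \<in> hochschild_cochains B A 0" "Gf' \<in> hochschild_cochains B A 0"
    "Gg \<in> hochschild_cochains B A 0" "Gg' \<in> hochschild_cochains B A 0"
    using assms by (auto simp: G diag_cochains_def)
  show "quad_scale c G + G' \<in> diag_cochains B A 1"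
    using mem unfolding G quad_scale_simp diag_cochains_def
    by (simp add: A_def B_def hochschild_cochains_linear)
  \<comment> \<open>\<open>f\<close> and \<open>g\<close> are linear only on \<open>B\<close>, so
    all values of \<open>GB\<close> and \<open>GB'\<close> must be known to lie there, including the
    default value \<open>0\<close> on lists of the wrong shape.\<close>
  have GB: "GB bs \<in> B" "GB' bs \<in> B" for bs
  proof -
    have "h bs \<in> B" if h: "h \<in> hochschild_cochains B B 1" for h
    proof (cases "bs \<in> lists B \<and> length bs = 1")
      case False
      then have "h bs = 0" using h unfolding hochschild_cochains_def by blast
      then show ?thesis by (simp add: B_intros)
    qed (use h in \<open>auto simp: hochschild_cochains_def\<close>)
    then show "GB bs \<in> B" "GB' bs \<in> B" using mem(1,2) by blast+
  qed
  have F: "f b = b" if "b \<in> B" for b using f_eq that .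
  have lin: "fls_const c * GB bs + GB' bs \<in> B" for bs using GB by (simp add: B_intros)
  show "diag_d B A f g (quad_scale c G + G') = quad_scale c (diag_d B A f g G) + diag_d B A f g G'"
    unfolding G quad_scale_simp diag_d_def prod.case hochschild_d_linear
    by (simp add: fun_eq_iff pushforward_def pullback_def F GB lin g_linear right_diff_distrib)
qed

lemma W_eq: "W = diag_d B A f g ` diag_cochains B A 1"
  by (simp add: diag_coboundaries_def)

lemma W_linear:
  assumes "w \<in> W" "w' \<in> W"
  shows "quad_scale c w + w' \<in> W"
proof -
  obtain G G' where G: "G \<in> diag_cochains B A 1" "G' \<in> diag_cochains B A 1"
    and w: "w = diag_d B A f g G" "w' = diag_d B A f g G'"
    using assms unfolding W_eq by blast
  show ?thesis unfolding w W_eq using diag_d_linear[OF G, of c] by (metis imageI)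
qed

lemma zero_cochains: "0 \<in> diag_cochains B A 1" "diag_d B A f g 0 = 0"
proof -
  show "0 \<in> diag_cochains B A 1"
    by (simp add: diag_cochains_def zero_prod_def A_def B_def hochschild_cochains_zero)
  have "pushforward f 0 = 0" "pushforward g 0 = 0" "pullback B f 0 = 0" "pullback B g 0 = 0"
    by (simp_all add: fun_eq_iff pushforward_def pullback_def algebra_hom_zero[OF f_hom] g_zero)
  then show "diag_d B A f g 0 = 0"
    unfolding zero_prod_def diag_d_def prod.case by simp
qed

lemma W_zero: "0 \<in> W"
  unfolding W_eq using zero_cochains by (metis imageI)

lemma W_add: "w \<in> W \<Longrightarrow> w' \<in> W \<Longrightarrow> w + w' \<in> W"
  using W_linear[of w w' 1] by (simp add: quad_scale_one)

lemma W_scale: "w \<in> W \<Longrightarrow> quad_scale c w \<in> W"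
  using W_linear[of w 0 c] W_zero by simp

lemma W_uminus: "w \<in> W \<Longrightarrow> - w \<in> W"
  using W_scale[of w "- 1"] by (simp add: quad_scale_uminus)

lemma diag_class_eq_iff:
  "diag_class B A f g 2 G = diag_class B A f g 2 G' \<longleftrightarrow> G - G' \<in> W"
proof
  assume *: "diag_class B A f g 2 G = diag_class B A f g 2 G'"
  have "G \<in> diag_class B A f g 2 G"
    unfolding diag_class_def using W_zero by (metis add.right_neutral set_plus_intro2)
  then show "G - G' \<in> W"
    unfolding * by (auto simp: diag_class_def elt_set_plus_def)
next
  have sub: "diag_class B A f g 2 G \<subseteq> diag_class B A f g 2 G'" if "G - G' \<in> W" for G G'
  proof
    fix v assume "v \<in> diag_class B A f g 2 G"
    then obtain w where w: "v = G + w" "w \<in> W" by (auto simp: diag_class_def elt_set_plus_def)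
    then have "v = G' + ((G - G') + w)" by (simp add: algebra_simps)
    then show "v \<in> diag_class B A f g 2 G'"
      unfolding diag_class_def using W_add[OF that w(2)] by (metis set_plus_intro2)
  qed
  assume "G - G' \<in> W"
  moreover from W_uminus[OF this] have "G' - G \<in> W" by simp
  ultimately show "diag_class B A f g 2 G = diag_class B A f g 2 G'" using sub by blast
qed

section \<open>Pairs of derivations and their classes\<close>

lemma derivation_eq_cochain1:
  assumes h: "algebra_hom B A \<phi>" and D: "derivation B A \<phi> D"
    and E: "derivation_along B \<phi> E" and X: "D [fls_X] = E fls_X"
  shows "D = cochain1 B E"
proof -
  have "D [b] = E b" if "b \<in> B" for b
    using derivation_along_unique[OF h[unfolded B_def]
        derivation_derivation_along[OF D[unfolded B_def] algebra_hom_one[OF h]] E[unfolded B_def]] X that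
    by (simp add: B_def)
  then have "cochain1 B (\<lambda>b. D [b]) = cochain1 B E"
    by (auto simp: cochain1_def fun_eq_iff length_Suc_conv)
  moreover have "D \<in> hochschild_cochains B A 1" using D by (simp add: derivation_def)
  ultimately show ?thesis using hochschild_cochains_1_eq by metis
qed

lemma derivation_f: "derivation B A f (cochain1 B (\<lambda>b. a * fls_deriv b))" if "a \<in> A"
proof -
  have "derivation_along B f (\<lambda>b. a * fls_deriv b)"
    by (auto simp: derivation_along_def f_eq algebra_simps)
  then show ?thesis
    using derivation_cochain1[OF f_hom[unfolded B_def], folded B_def] that
    by (simp add: A_intros deriv_B B_subset_A)
qed

lemma derivation_zero: "algebra_hom B A \<phi> \<Longrightarrow> derivation B A \<phi> 0"
  unfolding derivation_def by (simp add: A_def hochschild_cochains_zero)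

lemma derivation_X_mem: "derivation B A \<phi> D \<Longrightarrow> D [fls_X] \<in> A"
  by (rule hochschild_cochains_1_mem[of _ B]) (simp_all add: derivation_def B_intros)

text \<open>In one direction only values at \<open>x\<close> and the linearity of \<open>UA\<close>
  enter, and \<open>UA [fls_X]\<close> cancels. In the other, derivations b d/dx and a d/dx with a
  suitable \<open>a\<close> reproduce both values at \<open>x\<close>, which determine the
  pair.\<close>

lemma derivation_pair_in_W_iff:
  assumes Gf: "derivation B A f Gf" and Gg: "derivation B A g Gg"
  shows "(0, 0, Gf, Gg) \<in> W \<longleftrightarrow> Gf [fls_X] - fls_const lam * Gg [fls_X] \<in> twists"
proof
  assume "(0, 0, Gf, Gg) \<in> W"
  then obtain UB UA Uf Ug where U: "(UB, UA, Uf, Ug) \<in> diag_cochains B A 1"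
    and d: "(0, 0, Gf, Gg) = diag_d B A f g (UB, UA, Uf, Ug)"
    unfolding W_eq by (metis (no_types, lifting) imageE prod_cases4)
  have UB: "UB \<in> hochschild_cochains B B 1" and UA: "UA \<in> hochschild_cochains A A 1"
    using U by (auto simp: diag_cochains_def)
  have "Gf [fls_X] = f (UB [fls_X]) - UA [f fls_X]" "Gg [fls_X] = g (UB [fls_X]) - UA [g fls_X]"
    using d by (simp_all add: diag_d_def pushforward_def pullback_def B_intros)
  moreover have b: "UB [fls_X] \<in> B" using hochschild_cochains_1_mem[OF UB] by (simp add: B_intros)
  moreover have "UA [fls_const mu * fls_X] = fls_const mu * UA [fls_X]"
    using hochschild_cochains_1_linear[OF UA, of fls_X 0 mu] hochschild_cochains_1_linear[OF UA, of 0 0 1]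
    by (simp add: A_intros)
  ultimately have "Gf [fls_X] - fls_const lam * Gg [fls_X] = twist (UB [fls_X])"
    by (simp add: f_X g_X f_eq twist_def right_diff_distrib const_lam_mu lam_mu)
  then show "Gf [fls_X] - fls_const lam * Gg [fls_X] \<in> twists"
    using b by (auto simp: twists_def)
next
  assume "Gf [fls_X] - fls_const lam * Gg [fls_X] \<in> twists"
  then obtain b where b: "b \<in> B" and eq: "Gf [fls_X] - fls_const lam * Gg [fls_X] = twist b"
    by (auto simp: twists_def)
  have GgX: "Gg [fls_X] \<in> A" using Gg by (rule derivation_X_mem)
  \<comment> \<open>Solves \<open>g b - mu * a = Gg [fls_X]\<close>; the hypothesis on the
    combination then gives \<open>b - a = Gf [fls_X]\<close>.\<close>
  define a where "a = fls_const lam * (g b - Gg [fls_X])"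
  have a: "a \<in> A" using b GgX by (simp add: a_def A_intros g_closed)
  define UB where "UB = cochain1 B (\<lambda>e. b * fls_deriv e)"
  define UA where "UA = cochain1 A (\<lambda>e. a * fls_deriv e)"
  have UB: "derivation B B id UB" unfolding UB_def B_def
    by (rule derivation_cochain1)
      (use b in \<open>auto simp: algebra_hom_def derivation_along_def punctured_intros fls_deriv_punctured
        B_def algebra_simps\<close>)
  have UA: "derivation A A id UA" unfolding UA_def A_def
    by (rule derivation_cochain1)
      (use a in \<open>auto simp: algebra_hom_def derivation_along_def punctured_intros fls_deriv_punctured
        A_def algebra_simps\<close>)
  have Gf': "Gf = cochain1 B (\<lambda>e. (b - a) * fls_deriv e)"
    by (rule derivation_eq_cochain1[OF f_hom Gf])
      (use eq in \<open>auto simp: derivation_along_def f_eq algebra_simps a_def twist_def\<close>)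
  have Gg': "Gg = cochain1 B (\<lambda>e. (g b - fls_const mu * a) * g (fls_deriv e))"
    by (rule derivation_eq_cochain1[OF g_hom Gg]) (simp_all add: B_def g_one a_def const_lam_mu lam_mu mult.commute[of mu]
        derivation_along_deriv[OF g_hom[unfolded B_def]])
  have F: "pushforward f UB - pullback B f UA = Gf"
  proof
    fix bs
    show "(pushforward f UB - pullback B f UA) bs = Gf bs"
    proof (cases "bs \<in> lists B \<and> length bs = 1")
      case True
      then obtain e where "bs = [e]" "e \<in> B" by (auto simp: length_Suc_conv)
      then show ?thesis using b
        by (simp add: pushforward_def pullback_def UB_def UA_def Gf' f_eq B_subset_A B_intros deriv_B
            left_diff_distrib)
    qed (auto simp: pushforward_def pullback_def UB_def UA_def Gf' cochain1_def
        algebra_hom_zero[OF f_hom])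
  qed
  have G: "pushforward g UB - pullback B g UA = Gg"
  proof
    fix bs
    show "(pushforward g UB - pullback B g UA) bs = Gg bs"
    proof (cases "bs \<in> lists B \<and> length bs = 1")
      case True
      then obtain e where "bs = [e]" "e \<in> B" by (auto simp: length_Suc_conv)
      then show ?thesis using b
        by (simp add: pushforward_def pullback_def UB_def UA_def Gg' g_closed g_mult g_deriv deriv_B)
          (simp add: algebra_simps)
    qed (auto simp: pushforward_def pullback_def UB_def UA_def Gg' cochain1_def g_zero)
  qed
  have "(UB, UA, 0, 0) \<in> diag_cochains B A 1"
    using UB UA by (simp add: diag_cochains_def derivation_def A_def hochschild_cochains_zero)
  moreover have "diag_d B A f g (UB, UA, 0, 0) = (0, 0, Gf, Gg)"
    by (simp add: diag_d_def derivation_d_zero[OF UB] derivation_d_zero[OF UA] F G)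
  ultimately show "(0, 0, Gf, Gg) \<in> W" unfolding W_eq by (metis imageI)
qed

lemma derivation_pair_class_eq_iff:
  assumes "derivation B A f Gf" "derivation B A g Gg" "derivation B A f Gf'" "derivation B A g Gg'"
  shows "diag_class B A f g 2 (0, 0, Gf, Gg) = diag_class B A f g 2 (0, 0, Gf', Gg') \<longleftrightarrow>
    (Gf [fls_X] - fls_const lam * Gg [fls_X]) - (Gf' [fls_X] - fls_const lam * Gg' [fls_X]) \<in> twists"
proof -
  have "derivation B A f (Gf - Gf')" "derivation B A g (Gg - Gg')"
    using assms derivation_diff by (auto simp: A_def)
  from derivation_pair_in_W_iff[OF this] show ?thesis
    by (simp add: diag_class_eq_iff algebra_simps)
qed

lemma kappa_derivation_pair:
  assumes "derivation B A f Gf" "derivation B A g Gg"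
  shows "diag_class B A f g 2 (0, 0, Gf, Gg) = kappa (Gf [fls_X] - fls_const lam * Gg [fls_X])"
proof -
  have "Gf [fls_X] \<in> A" "Gg [fls_X] \<in> A"
    using assms derivation_X_mem by blast+
  then have a: "Gf [fls_X] - fls_const lam * Gg [fls_X] \<in> A" by (simp add: A_intros)
  show ?thesis
    unfolding kappa_def deriv_quad_def
    by (subst derivation_pair_class_eq_iff[OF assms derivation_f[OF a] derivation_zero[OF g_hom]])
      (simp add: B_intros fls_mod.subspace_0[OF subspace_twists])
qed

lemma kappa_eq_iff:
  assumes "a \<in> A" "b \<in> A"
  shows "kappa a = kappa b \<longleftrightarrow> a - b \<in> twists"
  unfolding kappa_def deriv_quad_def
  by (subst derivation_pair_class_eq_iff)
    (simp_all add: assms derivation_f derivation_zero[OF g_hom] B_intros)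

lemma derivation_pair_cocycle:
  assumes "derivation B A f Gf" "derivation B A g Gg"
  shows "(0, 0, Gf, Gg) \<in> diag_cocycles B A f g 2"
proof -
  have "(0, 0, Gf, Gg) \<in> diag_cochains B A 2"
    using assms by (simp add: diag_cochains_def derivation_def A_def B_def hochschild_cochains_zero)
  moreover have "diag_d B A f g (0, 0, Gf, Gg) = 0"
    by (simp add: diag_d_def zero_prod_def derivation_d_zero[OF assms(1)] derivation_d_zero[OF assms(2)])
      (simp add: fun_eq_iff pushforward_def pullback_def algebra_hom_zero[OF f_hom] g_zero)
  ultimately show ?thesis by (simp add: diag_cocycles_def)
qed

text \<open>Push-forward and pull-back commute with the Hochschild coboundary, so the hypothesis
  says that the corrected component is a 1-cocycle, that is, a derivation.\<close>

lemma cocycle_correction: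
  assumes h: "algebra_hom B A \<phi>"
    and u: "u \<in> hochschild_cochains B B 1" and v: "v \<in> hochschild_cochains A A 1"
    and Gp: "Gp \<in> hochschild_cochains B A 1"
    and eq: "pushforward \<phi> (hochschild_d B id u) - pullback B \<phi> (hochschild_d A id v)
      - hochschild_d B \<phi> Gp = 0"
  shows "derivation B A \<phi> (Gp - (pushforward \<phi> u - pullback B \<phi> v))"
proof -
  let ?E = "\<lambda>b. Gp [b] - (\<phi> (u [b]) - v [\<phi> b])"
  note u1 = hochschild_cochains_1_mem[OF u] and v1 = hochschild_cochains_1_mem[OF v]
    and G1 = hochschild_cochains_1_mem[OF Gp]
  note phi = algebra_hom_closed[OF h] algebra_hom_linear[OF h[unfolded B_def], folded B_def]
    algebra_hom_mult[OF h] algebra_hom_add[OF h] algebra_hom_diff[OF h[unfolded B_def], folded B_def]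
  have "Gp - (pushforward \<phi> u - pullback B \<phi> v) = cochain1 B ?E"
  proof
    fix bs
    show "(Gp - (pushforward \<phi> u - pullback B \<phi> v)) bs = cochain1 B ?E bs"
    proof (cases "bs \<in> lists B \<and> length bs = 1")
      case True
      then show ?thesis by (auto simp: length_Suc_conv pushforward_def pullback_def)
    next
      case False
      then have "Gp bs = 0" "u bs = 0" "bs \<in> lists B \<Longrightarrow> v (map \<phi> bs) = 0"
        using Gp u v by (auto simp: hochschild_cochains_def)
      then show ?thesis
        using False by (simp add: pushforward_def pullback_def cochain1_def algebra_hom_zero[OF h])
    qed
  qed
  moreover have "cochain1 B ?E \<in> hochschild_cochains B A 1"
    unfolding B_def
  proof (rule cochain1_mem, unfold B_def[symmetric])
    fix b assume "b \<in> B"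
    then show "?E b \<in> A" by (simp add: A_intros G1 u1 v1 phi)
  next
    fix c a b assume ab: "a \<in> B" "b \<in> B"
    then show "?E (fls_const c * a + b) = fls_const c * ?E a + ?E b"
      by (simp add: hochschild_cochains_1_linear[OF Gp] hochschild_cochains_1_linear[OF u]
          hochschild_cochains_1_linear[OF v] phi u1) (simp add: algebra_simps)
  qed
  moreover have "?E (a * b) = \<phi> a * ?E b + ?E a * \<phi> b" if ab: "a \<in> B" "b \<in> B" for a b
  proof -
    have "(pushforward \<phi> (hochschild_d B id u) - pullback B \<phi> (hochschild_d A id v)
        - hochschild_d B \<phi> Gp) [a, b] = 0" using eq by simp
    then have *: "\<phi> (a * u [b] - u [a * b] + u [a] * b) -
        (\<phi> a * v [\<phi> b] - v [\<phi> a * \<phi> b] + v [\<phi> a] * \<phi> b) -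
        (\<phi> a * Gp [b] - Gp [a * b] + Gp [a] * \<phi> b) = 0"
      using ab by (simp add: pushforward_def pullback_def hochschild_d_2 phi)
    have "\<phi> (a * u [b] - u [a * b] + u [a] * b) = \<phi> a * \<phi> (u [b]) - \<phi> (u [a * b]) + \<phi> (u [a]) * \<phi> b"
      using ab by (simp add: phi u1 B_intros)
    from *[unfolded this] show ?thesis using ab by (simp add: phi algebra_simps)
  qed
  ultimately show ?thesis by (simp add: derivation_def B_intros)
qed

lemma cohomology_eq: "H = kappa ` A"
proof
  show "kappa ` A \<subseteq> H"
    unfolding diag_cohomology_def kappa_def deriv_quad_def
    using derivation_pair_cocycle[OF derivation_f derivation_zero[OF g_hom]] by blast
  show "H \<subseteq> kappa ` A"
  proof
    fix U assume "U \<in> H"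
    then obtain GB GA Gf Gg where U: "U = diag_class B A f g 2 (GB, GA, Gf, Gg)"
      and c: "(GB, GA, Gf, Gg) \<in> diag_cochains B A 2" and d: "diag_d B A f g (GB, GA, Gf, Gg) = 0"
      by (auto simp: diag_cohomology_def diag_cocycles_def)
    have GB: "GB \<in> hochschild_cochains B B 2" "hochschild_d B id GB = 0"
      and GA: "GA \<in> hochschild_cochains A A 2" "hochschild_d A id GA = 0"
      and Gf: "Gf \<in> hochschild_cochains B A 1" and Gg: "Gg \<in> hochschild_cochains B A 1"
      using c d by (simp_all add: diag_cochains_def diag_d_def zero_prod_def)
    obtain u where u: "u \<in> hochschild_cochains B B 1" "hochschild_d B id u = GB"
      using hochschild_cohomology_2_trivial[of "{0, 1}" GB] units_B GB by (auto simp: B_def)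
    obtain v where v: "v \<in> hochschild_cochains A A 1" "hochschild_d A id v = GA"
      using hochschild_cohomology_2_trivial[of "{0, 1, lam}" GA] units_A GA by (auto simp: A_def)
    define Df where "Df = Gf - (pushforward f u - pullback B f v)"
    define Dg where "Dg = Gg - (pushforward g u - pullback B g v)"
    have Df: "derivation B A f Df" unfolding Df_def
      by (rule cocycle_correction[OF f_hom u(1) v(1) Gf]) (use d u(2) v(2) in \<open>simp add: diag_d_def zero_prod_def\<close>)
    have Dg: "derivation B A g Dg" unfolding Dg_def
      by (rule cocycle_correction[OF g_hom u(1) v(1) Gg]) (use d u(2) v(2) in \<open>simp add: diag_d_def zero_prod_def\<close>)
    \<comment> \<open>Only the two algebra components need primitives; a 0-cochain could not change
      the quadruple, as its coboundary is zero.\<close>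
    have "(u, v, 0, 0) \<in> diag_cochains B A 1"
      using u v by (simp add: diag_cochains_def A_def hochschild_cochains_zero)
    moreover have "(GB, GA, Gf, Gg) - (0, 0, Df, Dg) = diag_d B A f g (u, v, 0, 0)"
      by (simp add: diag_d_def u v Df_def Dg_def)
    ultimately have "(GB, GA, Gf, Gg) - (0, 0, Df, Dg) \<in> W" unfolding W_eq by (metis imageI)
    then have "U = kappa (Df [fls_X] - fls_const lam * Dg [fls_X])"
      unfolding U using diag_class_eq_iff kappa_derivation_pair[OF Df Dg] by metis
    moreover have "Df [fls_X] \<in> A" "Dg [fls_X] \<in> A"
      using Df Dg derivation_X_mem by blast+
    ultimately show "U \<in> kappa ` A" by (simp add: A_intros)
  qed
qed

lemma classes_of_eq:
  assumes "a \<in> A"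
  shows "classes_of B A f g lam a = {kappa a}"
proof -
  have "kappa a \<in> classes_of B A f g lam a"
    unfolding classes_of_def kappa_def deriv_quad_def
    using derivation_f[OF assms] derivation_zero[OF g_hom] by (auto intro!: exI simp: B_intros)
  moreover have "U = kappa a" if "U \<in> classes_of B A f g lam a" for U
    using that kappa_derivation_pair by (auto simp: classes_of_def)
  ultimately show ?thesis by blast
qed

subsection \<open>Linear algebra of classes\<close>

lemma deriv_quad_linear: "quad_scale c (deriv_quad a) + deriv_quad b = deriv_quad (fls_const c * a + b)"
  unfolding deriv_quad_def quad_scale_simp
  by (auto simp: fun_eq_iff cochain1_def algebra_simps)

lemma kappa_coset: "kappa a = deriv_quad a +o W"
  by (simp add: kappa_def diag_class_def)

lemma kappa_zero: "kappa 0 = W"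
proof -
  have "deriv_quad 0 = 0" by (simp add: deriv_quad_def zero_prod_def fun_eq_iff cochain1_def)
  then show ?thesis by (simp add: kappa_coset elt_set_plus_def)
qed

lemma kappa_linear: "quad_scale c ` kappa a + kappa b = kappa (fls_const c * a + b)"
proof (rule set_eqI)
  fix v
  show "v \<in> quad_scale c ` kappa a + kappa b \<longleftrightarrow> v \<in> kappa (fls_const c * a + b)"
  proof
    assume "v \<in> quad_scale c ` kappa a + kappa b"
    then obtain w w' where w: "w \<in> W" "w' \<in> W"
      and v: "v = quad_scale c (deriv_quad a + w) + (deriv_quad b + w')"
      by (auto simp: kappa_coset elt_set_plus_def set_plus_def)
    have "v = deriv_quad (fls_const c * a + b) + (quad_scale c w + w')"
      unfolding v quad_scale_add deriv_quad_linear[symmetric] by (simp add: algebra_simps)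
    then show "v \<in> kappa (fls_const c * a + b)"
      using W_linear[OF w] by (auto simp: kappa_coset)
  next
    assume "v \<in> kappa (fls_const c * a + b)"
    then obtain w where w: "w \<in> W" and v: "v = deriv_quad (fls_const c * a + b) + w"
      by (auto simp: kappa_coset elt_set_plus_def)
    \<comment> \<open>The scaled copy of \<open>W\<close> may be smaller than \<open>W\<close> when
      \<open>c\<close> is not a unit, so the whole correction \<open>w\<close> goes into the
      unscaled coset.\<close>
    have "v = quad_scale c (deriv_quad a + 0) + (deriv_quad b + w)"
      unfolding v deriv_quad_linear[symmetric] by (simp add: algebra_simps)
    then show "v \<in> quad_scale c ` kappa a + kappa b"
      using W_zero w unfolding kappa_coset by (metis imageI set_plus_intro set_plus_intro2)
  qed
qed

lemma coset_comb_kappa: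
  assumes "finite S" "\<And>U. U \<in> S \<Longrightarrow> U = kappa (r U)"
  shows "coset_comb W S c = kappa (\<Sum>U\<in>S. fls_const (c U) * r U)"
  using assms
proof (induction S rule: finite_induct)
  case empty
  then show ?case by (simp add: coset_comb_def kappa_zero)
next
  case (insert U S)
  have U: "kappa (r U) = U" using insert.prems by blast
  have "coset_comb W (insert U S) c = quad_scale (c U) ` U + coset_comb W S c"
    using insert.hyps by (simp add: coset_comb_def add.left_commute)
  also have "coset_comb W S c = kappa (\<Sum>U\<in>S. fls_const (c U) * r U)"
    using insert.prems by (intro insert.IH) blast
  finally show ?case
    using insert.hyps kappa_linear[of "c U" "r U"] by (simp add: U)
qed

lemma coset_span_kappa:
  assumes X: "X \<subseteq> A"
  shows "coset_span W (kappa ` X) = kappa ` fls_mod.span X"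
proof
  let ?r = "inv_into X kappa"
  have r: "?r U \<in> X" "kappa (?r U) = U" if "U \<in> kappa ` X" for U
    using that by (rule inv_into_into, rule f_inv_into_f)
  show "coset_span W (kappa ` X) \<subseteq> kappa ` fls_mod.span X"
  proof
    fix V assume "V \<in> coset_span W (kappa ` X)"
    then obtain S c where S: "finite S" "S \<subseteq> kappa ` X" and V: "V = coset_comb W S c"
      by (auto simp: coset_span_def)
    have "V = kappa (\<Sum>U\<in>S. fls_const (c U) * ?r U)"
      unfolding V using r(2)[symmetric] S(2) by (intro coset_comb_kappa S(1)) blast
    moreover have "(\<Sum>U\<in>S. fls_const (c U) * ?r U) \<in> fls_mod.span X"
      using r(1) S(2) by (intro fls_mod.span_sum fls_mod.span_scale fls_mod.span_base) blast
    ultimately show "V \<in> kappa ` fls_mod.span X" by blast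
  qed
  show "kappa ` fls_mod.span X \<subseteq> coset_span W (kappa ` X)"
  proof
    fix V assume "V \<in> kappa ` fls_mod.span X"
    then obtain t c where t: "finite t" "t \<subseteq> X" and V: "V = kappa (\<Sum>a\<in>t. fls_const (c a) * a)"
      unfolding fls_mod.span_explicit by blast
    \<comment> \<open>Several elements of \<open>t\<close> may lie in one class, but a combination
      of cosets uses each coset once; so coefficients are summed over the fibres of
      \<open>kappa\<close>, and one representative per class remains.\<close>
    define C where "C U = (\<Sum>a | a \<in> t \<and> kappa a = U. c a)" for U
    have S: "kappa ` t \<subseteq> kappa ` X" using t by blast
    have "(\<Sum>a\<in>t. fls_const (c a) * a) - (\<Sum>U\<in>kappa ` t. fls_const (C U) * ?r U) \<in> twists"
    proof -
      have "(\<Sum>a\<in>t. fls_const (c a) * a) = (\<Sum>U\<in>kappa ` t. \<Sum>a | a \<in> t \<and> kappa a = U. fls_const (c a) * a)"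
        using sum.image_gen[OF t(1)] .
      moreover have "fls_const (C U) = (\<Sum>a | a \<in> t \<and> kappa a = U. fls_const (c a))" for U
        unfolding C_def by (rule fls_const_sum)
      ultimately have "(\<Sum>a\<in>t. fls_const (c a) * a) - (\<Sum>U\<in>kappa ` t. fls_const (C U) * ?r U) =
          (\<Sum>U\<in>kappa ` t. \<Sum>a | a \<in> t \<and> kappa a = U. fls_const (c a) * (a - ?r U))"
        by (simp add: sum_distrib_right right_diff_distrib sum_subtractf)
      moreover have "a - ?r (kappa a) \<in> twists" if "a \<in> t" for a
      proof -
        have "a \<in> A" "?r (kappa a) \<in> A" "kappa (?r (kappa a)) = kappa a"
          using that t(2) X r[of "kappa a"] by blast+
        then show ?thesis using kappa_eq_iff by metis
      qed
      ultimately show ?thesis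
        by (simp only:, intro fls_mod.subspace_sum fls_mod.subspace_scale subspace_twists) auto
    qed
    moreover have "(\<Sum>a\<in>t. fls_const (c a) * a) \<in> A" "(\<Sum>U\<in>kappa ` t. fls_const (C U) * ?r U) \<in> A"
      using t(2) X r(1) S unfolding A_def
      by (intro fls_mod.subspace_sum fls_mod.subspace_scale subspace_punctured; blast)+
    ultimately have "V = kappa (\<Sum>U\<in>kappa ` t. fls_const (C U) * ?r U)"
      unfolding V using kappa_eq_iff by blast
    also have "\<dots> = coset_comb W (kappa ` t) C"
      using r(2)[symmetric] S t(1) by (intro coset_comb_kappa[symmetric]) blast+
    finally show "V \<in> coset_span W (kappa ` X)"
      unfolding coset_span_def using t(1) S by blast
  qed
qed

text \<open>A relation among cosets lifts to a relation among chosen representatives, one per coset,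
  so the argument also covers an \<open>X\<close> in which some elements have equal classes.\<close>

lemma coset_independent_kappa:
  assumes X: "X \<subseteq> A"
    and ind: "\<And>t c. finite t \<Longrightarrow> t \<subseteq> X \<Longrightarrow> (\<Sum>a\<in>t. fls_const (c a) * a) \<in> twists \<Longrightarrow> \<forall>a\<in>t. c a = 0"
  shows "coset_independent W (kappa ` X)"
  unfolding coset_independent_def
proof (intro allI impI)
  fix S c assume *: "finite S \<and> S \<subseteq> kappa ` X \<and> coset_comb W S c = W"
  let ?r = "inv_into X kappa"
  have r: "?r U \<in> X" "kappa (?r U) = U" if "U \<in> S" for U
  proof -
    have "U \<in> kappa ` X" using * that by blast
    then show "?r U \<in> X" "kappa (?r U) = U" by (rule inv_into_into, rule f_inv_into_f)
  qed
  have inj: "inj_on ?r S" by (rule inj_on_inverseI[where g = kappa]) (rule r(2))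
  let ?s = "\<Sum>U\<in>S. fls_const (c U) * ?r U"
  have "coset_comb W S c = kappa ?s"
    using * r(2)[symmetric] by (intro coset_comb_kappa) blast+
  then have "kappa ?s = kappa 0" using * kappa_zero by argo
  moreover have "?s \<in> A"
    using X r(1) unfolding A_def
    by (intro fls_mod.subspace_sum fls_mod.subspace_scale subspace_punctured) blast
  ultimately have "?s \<in> twists" using kappa_eq_iff[of ?s 0] by (simp add: A_intros)
  also have "?s = (\<Sum>a\<in>?r ` S. fls_const (c (kappa a)) * a)"
    unfolding sum.reindex[OF inj] by (rule sum.cong) (simp_all add: r(2))
  finally have "\<forall>a\<in>?r ` S. c (kappa a) = 0"
    using * r(1) by (intro ind) blast+
  then show "\<forall>U\<in>S. c U = 0" by (simp add: r(2))
qed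

end

section \<open>Partial fractions and regularity\<close>

text \<open>Meant for \<open>u\<close> a unit multiple of \<open>1/(x - s)\<close>: then
  \<open>p\<close> encodes a principal part at \<open>s\<close> together with a constant, and the
  order of the pole is measured by the degree of \<open>p\<close>.\<close>

definition poly_at :: "'k::comm_ring_1 poly \<Rightarrow> 'k fls \<Rightarrow> 'k fls" where
  "poly_at p u = poly (map_poly fls_const p) u"

lemma poly_at_pCons: "poly_at (pCons a p) u = fls_const a + u * poly_at p u"
  by (simp add: poly_at_def map_poly_pCons)

lemma poly_at_0 [simp]: "poly_at 0 u = 0"
  by (simp add: poly_at_def)

lemma poly_at_smult: "poly_at (smult c p) u = fls_const c * poly_at p u"
  by (induction p) (simp_all add: poly_at_pCons distrib_left mult.left_commute)

lemma poly_at_add: "poly_at (p + q) u = poly_at p u + poly_at q u"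
  by (induction p q rule: poly_induct2) (simp_all add: poly_at_pCons algebra_simps flip: fls_plus_const)

lemma poly_at_diff: "poly_at (p - q) u = poly_at p u - poly_at q u"
  using poly_at_add[of p "smult (- 1) q" u] unfolding poly_at_smult by simp

lemma poly_at_sum: "poly_at (\<Sum>i\<in>I. p i) u = (\<Sum>i\<in>I. poly_at (p i) u)"
  by (induction I rule: infinite_finite_induct) (simp_all add: poly_at_add)

lemma poly_at_monom: "poly_at (monom c n) u = fls_const c * u ^ n"
  by (induction n) (simp_all add: monom_0 monom_Suc poly_at_pCons mult.left_commute)

lemma poly_at_altdef: "poly_at p u = (\<Sum>i\<le>degree p. fls_const (coeff p i) * u ^ i)"
  using poly_at_sum[of "\<lambda>i. monom (coeff p i) i" "{..degree p}" u]
  by (simp add: poly_as_sum_of_monoms poly_at_monom)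

lemma poly_at_degree_0: "degree p = 0 \<Longrightarrow> poly_at p u = fls_const (coeff p 0)"
  by (simp add: poly_at_altdef)

lemma poly_at_mem_span: "poly_at p u \<in> fls_mod.span (range (\<lambda>n. u ^ n))"
  unfolding poly_at_altdef by (intro fls_mod.span_sum fls_mod.span_scale fls_mod.span_base) simp

lemma subspace_poly_at: "fls_mod.subspace {v * poly_at p u | p. True}"
proof (rule fls_mod.subspaceI)
  show "0 \<in> {v * poly_at p u |p. True}" by (auto intro: exI[of _ 0])
  show "x + y \<in> {v * poly_at p u |p. True}"
    if "x \<in> {v * poly_at p u |p. True}" "y \<in> {v * poly_at p u |p. True}" for x y
    using that by (auto simp flip: poly_at_add distrib_left)
  show "fls_const c * x \<in> {v * poly_at p u |p. True}"
    if "x \<in> {v * poly_at p u |p. True}" for c x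
    using that by (auto simp: mult.left_commute[of _ v] simp flip: poly_at_smult)
qed

lemma span_powers: "fls_mod.span (range (\<lambda>n. u ^ n)) = range (\<lambda>p. poly_at p u)"
proof
  have "fls_mod.subspace (range (\<lambda>p. poly_at p u))"
    using subspace_poly_at[of 1 u] by (simp add: full_SetCompr_eq)
  moreover have "u ^ n \<in> range (\<lambda>p. poly_at p u)" for n
    using poly_at_monom[of 1 n u] by (metis fls_const_1 mult_1 rangeI)
  ultimately show "fls_mod.span (range (\<lambda>n. u ^ n)) \<subseteq> range (\<lambda>p. poly_at p u)"
    by (intro fls_mod.span_minimal) auto
qed (use poly_at_mem_span in auto)

text \<open>
  If the product of two distinct generators is an affine combination of the two (as for
  \<open>1/(x - s)\<close> and \<open>1/(x - t)\<close> when \<open>s - t\<close> is a unit), then partial fraction decomposition works.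
\<close>

definition affine_product :: "'k::comm_ring_1 fls \<Rightarrow> 'k fls \<Rightarrow> bool" where
  "affine_product p q \<longleftrightarrow> (\<exists>a b c. p * q = fls_const a * p + fls_const b * q + fls_const c)"

lemma affine_product_sym: "affine_product p q \<Longrightarrow> affine_product q p"
  unfolding affine_product_def by (metis add.commute mult.commute)

text \<open>The span of the pure powers contains 1 and is stable under multiplication by each
  generator, hence by the whole algebra. Stability is an induction on the exponent, with the affine
  relation rewriting each mixed product.\<close>

lemma subalgebra_gen_partial_fractions:
  assumes S: "p0 \<in> S" and prod: "\<And>p q. p \<in> S \<Longrightarrow> q \<in> S \<Longrightarrow> p \<noteq> q \<Longrightarrow> affine_product p q"
    and a: "a \<in> subalgebra_gen S"
  shows "a \<in> fls_mod.span (\<Union>p\<in>S. range (\<lambda>n. p ^ n))"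
proof -
  let ?V = "fls_mod.span (\<Union>p\<in>S. range (\<lambda>n. p ^ n))"
  have pow: "p ^ n \<in> ?V" if "p \<in> S" for p n
    using that by (intro fls_mod.span_base) blast
  have one: "1 \<in> ?V" using pow[OF S, of 0] by simp
  have gen: "q * p ^ n \<in> ?V" if p: "p \<in> S" and q: "q \<in> S" for p q n
  proof (cases "q = p")
    case True
    then show ?thesis using pow[OF p, of "Suc n"] by simp
  next
    case False
    then obtain a b c where abc: "q * p = fls_const a * q + fls_const b * p + fls_const c"
      using prod[OF q p] by (auto simp: affine_product_def)
    show ?thesis
    proof (induction n)
      case 0
      show ?case using pow[OF q, of 1] by simp
    next
      case (Suc n)
      have "q * p ^ Suc n = (q * p) * p ^ n" by (simp add: mult.assoc)
      also have "\<dots> = fls_const a * (q * p ^ n) + fls_const b * p ^ Suc n + fls_const c * p ^ n"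
        unfolding abc by (simp add: distrib_right mult.assoc)
      also have "\<dots> \<in> ?V"
        using Suc pow[OF p] by (intro fls_mod.span_add fls_mod.span_scale)
      finally show ?case .
    qed
  qed
  have gen_mult: "q * v \<in> ?V" if q: "q \<in> S" and v: "v \<in> ?V" for q v
    using v
  proof (induction rule: fls_mod.span_induct_alt)
    case (step c u w)
    then have "fls_const c * (q * u) + q * w \<in> ?V"
      using gen[OF _ q] by (auto intro: fls_mod.span_add fls_mod.span_scale)
    then show ?case by (simp add: distrib_left mult.left_commute)
  qed (simp add: fls_mod.span_zero)
  have "\<forall>v\<in>?V. a * v \<in> ?V" using a
  proof induction
    case (add a b)
    then show ?case by (simp add: distrib_right fls_mod.span_add)
  qed (auto simp: gen_mult mult.assoc fls_mod.span_scale)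
  then show ?thesis using one by fastforce
qed

section \<open>Regularity at a point, over coefficients with zero divisors\<close>

lemma regular_at_poly: "regular_at c (laurent_of_poly p)"
  unfolding regular_at_def by (rule exI[of _ p], rule exI[of _ 1]) (simp add: laurent_of_poly_simps)

lemma regular_at_add: "regular_at c a \<Longrightarrow> regular_at c b \<Longrightarrow> regular_at c (a + b)"
  and regular_at_mult: "regular_at c a \<Longrightarrow> regular_at c b \<Longrightarrow> regular_at c (a * b)"
proof -
  assume "regular_at c a" "regular_at c b"
  then obtain p q p' q' where q: "poly q c dvd 1" "poly q' c dvd 1"
    and eq: "laurent_of_poly q * a = laurent_of_poly p" "laurent_of_poly q' * b = laurent_of_poly p'"
    unfolding regular_at_def by blast
  have q': "poly (q * q') c dvd 1" using mult_dvd_mono[OF q] by simp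
  have "laurent_of_poly (q * q') * (a + b) =
      laurent_of_poly q' * (laurent_of_poly q * a) + laurent_of_poly q * (laurent_of_poly q' * b)"
    by (simp add: laurent_of_poly_simps algebra_simps)
  then have "laurent_of_poly (q * q') * (a + b) = laurent_of_poly (q' * p + q * p')"
    unfolding eq by (simp add: laurent_of_poly_simps)
  then show "regular_at c (a + b)" unfolding regular_at_def using q' by blast
  have "laurent_of_poly (q * q') * (a * b) = (laurent_of_poly q * a) * (laurent_of_poly q' * b)"
    by (simp add: laurent_of_poly_simps algebra_simps)
  then have "laurent_of_poly (q * q') * (a * b) = laurent_of_poly (p * p')"
    unfolding eq by (simp add: laurent_of_poly_simps)
  then show "regular_at c (a * b)" unfolding regular_at_def using q' by blast
qed

lemma regular_at_const: "regular_at c (fls_const a)"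
  using regular_at_poly[of c "[:a:]"] by (simp add: laurent_of_poly_simps)

lemma regular_at_power: "regular_at c a \<Longrightarrow> regular_at c (a ^ n)"
  using regular_at_const[of c 1] by (induction n) (simp_all add: regular_at_mult)

lemma subspace_regular_at: "fls_mod.subspace {a. regular_at c a}"
  using regular_at_const[of c 0]
  by (intro fls_mod.subspaceI) (simp_all add: regular_at_add regular_at_mult regular_at_const)

lemma regular_at_inverse:
  assumes "y * (fls_X - fls_const s) = 1" "(c - s) dvd 1"
  shows "regular_at c y"
proof -
  have "laurent_of_poly [:- s, 1:] * y = laurent_of_poly 1"
    using assms(1) by (simp add: laurent_of_poly_simps mult.commute)
  moreover have "poly [:- s, 1:] c dvd 1" using assms(2) by simp
  ultimately show ?thesis unfolding regular_at_def by blast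
qed

lemma regular_at_poly_at: "regular_at c u \<Longrightarrow> regular_at c (poly_at p u)"
  by (induction p) (simp_all add: poly_at_pCons regular_at_add regular_at_mult regular_at_const
      regular_at_const[of c 0, simplified])

lemma unit_mult_eq_0: "u dvd 1 \<Longrightarrow> u * x = 0 \<Longrightarrow> x = (0 :: 'a::comm_semiring_1)"
proof -
  assume "u dvd 1" and z: "u * x = 0"
  then obtain v where v: "1 = u * v" by (elim dvdE)
  have "x = (u * v) * x" by (simp flip: v)
  also have "\<dots> = v * (u * x)" by (simp only: ac_simps)
  finally show "x = 0" using z by simp
qed

text \<open>After multiplication by \<open>(x - s)^n\<close>, with \<open>n\<close> the degree, the
  numerator has value \<open>t^n\<close> times the leading coefficient at \<open>s\<close>, while
  regularity makes this value zero. The constant \<open>t\<close> is carried along because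
  \<open>g\<close> sends \<open>1/(x - 1)\<close> to \<open>lam/(x - lam)\<close>.\<close>

lemma poly_at_pole_regular:
  assumes u: "u * (fls_X - fls_const s) = fls_const t" and t: "t dvd 1"
    and reg: "regular_at s (poly_at p u)"
  shows "degree p = 0"
proof (rule ccontr)
  assume "degree p \<noteq> 0"
  obtain r q where q: "poly q s dvd 1" "laurent_of_poly q * poly_at p u = laurent_of_poly r"
    using reg unfolding regular_at_def by blast
  define n where "n = degree p"
  define l where "l = [:- s, 1:]"
  have l: "laurent_of_poly l = fls_X - fls_const s" by (simp add: l_def laurent_of_poly_simps)
  \<comment> \<open>The polynomial homogenised in \<open>t\<close> and \<open>l\<close>: every term
    except the leading one retains a factor \<open>l\<close>.\<close>
  define P where "P = (\<Sum>i\<le>n. smult (coeff p i * t ^ i) (l ^ (n - i)))"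
  have "poly_at p u * laurent_of_poly (l ^ n) = laurent_of_poly P"
  proof -
    have "u ^ i * laurent_of_poly (l ^ n) = laurent_of_poly (smult (t ^ i) (l ^ (n - i)))" if "i \<le> n" for i
    proof -
      have "l ^ n = l ^ i * l ^ (n - i)" using that by (simp flip: power_add)
      then have "u ^ i * laurent_of_poly (l ^ n) = (u * laurent_of_poly l) ^ i * laurent_of_poly (l ^ (n - i))"
        by (simp add: laurent_of_poly_simps power_mult_distrib mult.assoc)
      also have "u * laurent_of_poly l = fls_const t" using u by (simp add: l)
      finally show ?thesis by (simp add: laurent_of_poly_smult fls_const_power)
    qed
    then show ?thesis
      unfolding poly_at_altdef P_def laurent_of_poly_sum sum_distrib_right n_def[symmetric]
      by (intro sum.cong refl)
        (simp only: mult.assoc atMost_iff laurent_of_poly_smult[symmetric] smult_smult)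
  qed
  then have "laurent_of_poly q * laurent_of_poly P = laurent_of_poly r * laurent_of_poly (l ^ n)"
    using q(2) by (metis mult.assoc)
  then have "q * P = r * l ^ n" by (simp flip: laurent_of_poly_simps(2) add: laurent_of_poly_inj)
  then have "poly q s * poly P s = 0"
  proof -
    have "poly q s * poly P s = poly r s * 0 ^ n"
      using arg_cong[OF \<open>q * P = r * l ^ n\<close>, of "\<lambda>p. poly p s"] by (simp add: l_def)
    then show ?thesis using \<open>degree p \<noteq> 0\<close> by (simp add: n_def zero_power)
  qed
  moreover have "poly P s = coeff p n * t ^ n"
  proof -
    have "poly P s = (\<Sum>i\<le>n. coeff p i * t ^ i * 0 ^ (n - i))"
      by (simp add: P_def poly_sum l_def)
    also have "\<dots> = (\<Sum>i\<le>n. if i = n then coeff p n * t ^ n else 0)"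
      by (intro sum.cong) (auto simp: zero_power)
    finally show ?thesis by simp
  qed
  moreover have "t ^ n dvd 1" using dvd_power_same[OF t, of n] by simp
  ultimately have "coeff p n = 0"
    using unit_mult_eq_0[OF q(1)] unit_mult_eq_0[of "t ^ n" "coeff p n"] by (simp add: mult.commute)
  then have "p = 0" by (simp add: n_def)
  then show False using \<open>degree p \<noteq> 0\<close> by simp
qed

text \<open>Cancellation without a domain: \<open>x - s\<close> is invertible among Laurent series,
  into which polynomials embed.\<close>

lemma linear_cancel:
  assumes "s dvd (1 :: 'k::comm_ring_1)" and "[:- s, 1:] * p = [:- s, 1:] * q"
  shows "p = q"
proof -
  obtain y where y: "y * laurent_of_poly [:- s, 1:] = 1"
    using linear_invertible[of s] assms(1) unfolding laurent_of_poly_simps by blast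
  have "y * laurent_of_poly ([:- s, 1:] * p) = y * laurent_of_poly ([:- s, 1:] * q)"
    by (simp only: assms(2))
  then have "laurent_of_poly p = laurent_of_poly q"
    unfolding laurent_of_poly_simps(2) mult.assoc[symmetric] y by simp
  then show ?thesis by (simp add: laurent_of_poly_inj)
qed

lemma linear_power_cancel:
  assumes "s dvd (1 :: 'k::comm_ring_1)" and "[:- s, 1:] ^ n * p = [:- s, 1:] ^ n * q"
  shows "p = q"
  using assms(2)
proof (induction n)
  case (Suc n)
  then have "[:- s, 1:] * ([:- s, 1:] ^ n * p) = [:- s, 1:] * ([:- s, 1:] ^ n * q)"
    by (simp only: power_Suc mult.assoc)
  from linear_cancel[OF assms(1) this] show ?case by (rule Suc.IH)
qed simp

text \<open>A substitute for coprimality of \<open>q\<close> and \<open>x - s\<close>: the unit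
  value of \<open>q\<close> at \<open>s\<close> forces \<open>P\<close> to vanish there, so one
  linear factor after another can be split off.\<close>

lemma linear_power_dvd:
  assumes "s dvd (1 :: 'k::comm_ring_1)" and "poly q s dvd 1" and "q * P = r * [:- s, 1:] ^ n"
  shows "[:- s, 1:] ^ n dvd P"
  using assms(3)
proof (induction n arbitrary: P)
  case (Suc n)
  let ?l = "[:- s, 1:]"
  have "poly q s * poly P s = poly r s * poly ?l s ^ Suc n"
    using arg_cong[OF Suc.prems, of "\<lambda>p. poly p s"] by (simp only: poly_mult poly_power)
  moreover have "poly ?l s = 0" by simp
  ultimately have "poly q s * poly P s = 0" by (simp only: power_0_Suc mult_zero_right)
  then have "poly P s = 0"
    using assms(2) unit_mult_eq_0 by blast
  then obtain P' where P': "P = ?l * P'" by (auto simp: poly_eq_0_iff_dvd elim: dvdE)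
  have "?l * (q * P') = ?l * (r * ?l ^ n)"
    using Suc.prems unfolding P' power_Suc by (simp only: ac_simps)
  then have "q * P' = r * ?l ^ n" by (rule linear_cancel[OF assms(1)])
  from Suc.IH[OF this] show ?case unfolding P' power_Suc by (intro mult_dvd_mono) simp
qed simp

section \<open>Coefficients of Laurent series\<close>

lemma fls_const_dvd_nth:
  assumes "fls_const e dvd a"
  shows "e dvd fls_nth a n"
  using assms by (auto elim!: dvdE simp: fls_mult_const_nth)

lemma laurent_of_poly_nth: "fls_nth (laurent_of_poly p) (int n) = coeff p n"
  by (simp add: laurent_of_poly_def)

text \<open>Divisibility by a constant holds coefficient by coefficient and so passes to values;
  this is how a relation modulo \<open>1 - lam\<close> reaches the point 1.\<close>

lemma fls_const_dvd_laurent_of_poly: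
  assumes "fls_const e dvd laurent_of_poly p"
  shows "e dvd poly p c"
proof -
  have "e dvd coeff p n" for n
    using fls_const_dvd_nth[OF assms, of "int n"] by (simp add: laurent_of_poly_nth)
  then show ?thesis unfolding poly_altdef by (intro dvd_sum dvd_mult2)
qed

text \<open>The value is independent of \<open>m\<close>; hence powers of \<open>1/(x - 1)\<close>
  and of its image under \<open>g\<close> have equal constant coefficients.\<close>

lemma inverse_power_nth_0:
  fixes u :: "'k::comm_ring_1 fls"
  assumes "u * (fls_const m * fls_X - 1) = 1"
  shows "fls_nth (u ^ n) 0 = (- 1) ^ n"
proof -
  \<comment> \<open>Expansion of \<open>1/(m x - 1)\<close> at 0 as a geometric series.\<close>
  define v where "v = Abs_fps (\<lambda>n. - (m ^ n))"
  have "v * (fps_const m * fps_X - 1) = 1"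
  proof (rule fps_ext)
    show "fps_nth (v * (fps_const m * fps_X - 1)) n = fps_nth 1 n" for n
      by (cases n) (simp_all add: v_def right_diff_distrib mult.left_commute[of _ "fps_const m"]
          flip: mult.assoc[of v])
  qed
  then have "fps_to_fls v * (fls_const m * fls_X - 1) = 1"
    by (metis fls_times_fps_to_fls fps_to_fls_minus fps_X_to_fls fps_const_to_fls fps_one_to_fls)
  then have "u = fps_to_fls v" using assms inverse_unique_comm by blast
  then have "u ^ n = fps_to_fls (v ^ n)" by (simp add: fps_to_fls_power)
  moreover have "fps_nth (v ^ n) 0 = (- 1) ^ n" by (simp add: fps_power_zeroth v_def)
  ultimately show ?thesis by simp
qed

section \<open>Functions modulo twists\<close>

context parallel_maps
begin

definition "y1 = (SOME y. y * (fls_X - fls_const (1 :: 'k)) = 1)"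
definition "ylam = (SOME y. y * (fls_X - fls_const lam) = 1)"

lemma lam_unit: "lam dvd 1" and mu_unit: "mu dvd 1"
  using lam_mu by (auto intro: dvdI[of 1 lam mu] dvdI[of 1 mu lam] simp: mult.commute)

lemma y1_inverse: "y1 * (fls_X - fls_const 1) = 1"
  unfolding y1_def by (rule someI_ex, rule linear_invertible) simp

lemma ylam_inverse: "ylam * (fls_X - fls_const lam) = 1"
  unfolding ylam_def by (rule someI_ex, rule linear_invertible) (simp add: lam_unit)

lemma X_inv_inverse: "fls_X_inv * (fls_X - fls_const (0 :: 'k)) = 1"
  by (simp add: fls_X_inv_times_conv_shift)

lemma X_inv_X: "fls_X_inv * fls_X = (1 :: 'k fls)" "fls_X * fls_X_inv = (1 :: 'k fls)"
  using X_inv_inverse by (simp_all add: mult.commute)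

lemma y1_mem: "y1 \<in> B" and X_inv_mem: "fls_X_inv \<in> B" and X_mem: "fls_X \<in> B"
  using B_intros(5)[OF _ y1_inverse] B_intros(5)[OF _ X_inv_inverse] B_intros(4)
  by simp_all

text \<open>Rescaling moves the pole from 1 to \<open>lam\<close>:
  \<open>1/(mu x - 1) = lam/(x - lam)\<close>.\<close>

lemma g_y1: "g y1 = fls_const lam * ylam"
proof -
  have "g y1 * (fls_const mu * fls_X - 1) = 1"
    using algebra_hom_inverse[OF g_hom[unfolded B_def] y1_mem[unfolded B_def] y1_inverse] by (simp add: g_X)
  moreover have "fls_const mu * (fls_X - fls_const lam) = fls_const mu * fls_X - 1"
    using const_lam_mu(1) by (simp only: right_diff_distrib mult.commute[of "fls_const mu" "fls_const lam"])
  ultimately have "g y1 * (fls_const mu * (fls_X - fls_const lam)) = 1" by (simp only:)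
  then have "(fls_const mu * g y1) * (fls_X - fls_const lam) = 1" by (simp only: ac_simps)
  then have "fls_const mu * g y1 = ylam" using ylam_inverse inverse_unique_comm by blast
  then show ?thesis using const_lam_mu(2) by metis
qed

lemma g_X_inv: "g fls_X_inv = fls_const lam * fls_X_inv"
proof -
  have "g fls_X_inv * (fls_const mu * fls_X) = 1"
    using algebra_hom_inverse[OF g_hom[unfolded B_def] X_inv_mem[unfolded B_def] X_inv_inverse]
    by (simp add: g_X)
  then have "(fls_const mu * g fls_X_inv) * fls_X = 1" by (simp only: ac_simps)
  then have "fls_const mu * g fls_X_inv = fls_X_inv" using X_inv_X(1) inverse_unique_comm by blast
  then show ?thesis using const_lam_mu(2) by metis
qed

text \<open>The ring \<open>k[x, 1/x]\<close> of functions with poles only at 0 and infinity, the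
  two points that rescaling fixes. It turns out to consist of the elements of \<open>A\<close> that
  are regular at 1 and \<open>lam\<close>.\<close>

definition laurent_polys :: "'k fls set" where
  "laurent_polys = fls_mod.span (range (\<lambda>n. fls_X ^ n) \<union> range (\<lambda>n. fls_X_inv ^ n))"

lemma subspace_laurent_polys: "fls_mod.subspace laurent_polys"
  by (simp add: laurent_polys_def)

lemma laurent_polys_powers: "fls_X ^ n \<in> laurent_polys" "fls_X_inv ^ n \<in> laurent_polys"
  unfolding laurent_polys_def by (intro fls_mod.span_base; simp)+

lemma laurent_polys_minimal:
  assumes "fls_mod.subspace V" "\<And>n. fls_X ^ n \<in> V" "\<And>n. fls_X_inv ^ n \<in> V" "l \<in> laurent_polys"
  shows "l \<in> V"
proof -
  have "laurent_polys \<subseteq> V"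
    unfolding laurent_polys_def by (intro fls_mod.span_minimal assms(1)) (use assms in auto)
  then show ?thesis using assms(4) by blast
qed

lemma laurent_polys_subset_B: "l \<in> laurent_polys \<Longrightarrow> l \<in> B"
  by (rule laurent_polys_minimal)
    (simp_all add: B_intros(10) X_mem X_inv_mem, simp add: B_def subspace_punctured)

lemma laurent_polys_regular: "l \<in> laurent_polys \<Longrightarrow> c dvd 1 \<Longrightarrow> regular_at c l"
proof -
  assume l: "l \<in> laurent_polys" and c: "c dvd 1"
  have "regular_at c fls_X" using regular_at_poly[of c "[:0, 1:]"] by (simp add: laurent_of_poly_simps)
  moreover have "regular_at c fls_X_inv"
    by (rule regular_at_inverse[OF X_inv_inverse]) (simp add: c)
  ultimately have "l \<in> {a. regular_at c a}"
    by (intro laurent_polys_minimal[OF subspace_regular_at _ _ l] CollectI regular_at_power)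
  then show ?thesis by simp
qed

lemma laurent_polysI:
  assumes "a * fls_X ^ n = laurent_of_poly p"
  shows "a \<in> laurent_polys"
proof -
  have 1: "fls_X ^ n * fls_X_inv ^ n = (1 :: 'k fls)"
    by (simp add: X_inv_X flip: power_mult_distrib)
  have x: "fls_X ^ i * fls_X_inv ^ n \<in> laurent_polys" for i
  proof (cases "i \<le> n")
    case True
    then have "fls_X ^ i * fls_X_inv ^ n = (fls_X * fls_X_inv) ^ i * (fls_X_inv :: 'k fls) ^ (n - i)"
      by (simp add: power_mult_distrib mult.assoc flip: power_add)
    then show ?thesis using laurent_polys_powers(2) by (simp add: X_inv_X)
  next
    case False
    then obtain k where "i = n + k" by (metis le_add_diff_inverse linear)
    then have "fls_X ^ i * fls_X_inv ^ n = fls_X ^ n * fls_X_inv ^ n * (fls_X :: 'k fls) ^ k"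
      by (simp only: power_add ac_simps)
    then show ?thesis using laurent_polys_powers(1) by (simp add: 1)
  qed
  have "a = a * fls_X ^ n * fls_X_inv ^ n" using 1 by (simp add: mult.assoc)
  also have "\<dots> = (\<Sum>i\<le>degree p. fls_const (coeff p i) * (fls_X ^ i * fls_X_inv ^ n))"
    by (simp only: assms laurent_of_poly_altdef sum_distrib_right mult.assoc)
  also have "\<dots> \<in> laurent_polys"
    by (intro fls_mod.subspace_sum fls_mod.subspace_scale subspace_laurent_polys x)
  finally show ?thesis .
qed

text \<open>Partial fractions may fail here, so the common denominator is stripped instead:
  regularity at 1 makes \<open>(x-1)^n\<close> divide the numerator, and after cancellation
  regularity at \<open>lam\<close> does the same for \<open>(x-lam)^n\<close>. Only a power of
  \<open>x\<close> remains in the denominator.\<close>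

lemma regular_imp_laurent_poly:
  assumes a: "a \<in> A" and reg: "regular_at 1 a" "regular_at lam a"
  shows "a \<in> laurent_polys"
proof -
  let ?l = "[:- 1, 1:] :: 'k poly" and ?m = "[:- lam, 1:]" and ?x = "[:0, 1:] :: 'k poly"
  have "(\<Prod>s\<in>{0, 1, lam}. fls_X - fls_const s) = laurent_of_poly (?x * ?l * ?m)"
    using lam_neq unfolding laurent_of_poly_simps by (simp add: mult.assoc)
  then obtain P n where "a * laurent_of_poly (?x * ?l * ?m) ^ n = laurent_of_poly P"
    using a punctured_iff[of "{0, 1, lam}" a] units_A by (auto simp: A_def)
  then have P: "a * laurent_of_poly (?x ^ n * ?l ^ n * ?m ^ n) = laurent_of_poly P"
    unfolding laurent_of_poly_simps(7)[symmetric] by (simp only: power_mult_distrib)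
  obtain q p where q: "poly q 1 dvd 1" "laurent_of_poly q * a = laurent_of_poly p"
    using reg(1) unfolding regular_at_def by blast
  obtain q' p' where q': "poly q' lam dvd 1" "laurent_of_poly q' * a = laurent_of_poly p'"
    using reg(2) unfolding regular_at_def by blast
  have eq: "r * P = s * (?x ^ n * ?l ^ n * ?m ^ n)" if "laurent_of_poly r * a = laurent_of_poly s" for r s
  proof -
    have "laurent_of_poly (r * P) = laurent_of_poly r * a * laurent_of_poly (?x ^ n * ?l ^ n * ?m ^ n)"
      by (simp only: laurent_of_poly_simps(2)[of r] mult.assoc flip: P)
    then have "laurent_of_poly (r * P) = laurent_of_poly (s * (?x ^ n * ?l ^ n * ?m ^ n))"
      by (simp only: that laurent_of_poly_simps(2)[of s])
    then show ?thesis by (simp only: laurent_of_poly_inj)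
  qed
  have "q * P = (p * (?x ^ n * ?m ^ n)) * ?l ^ n"
    using eq[OF q(2)] by (simp only: ac_simps)
  from linear_power_dvd[OF _ q(1) this] obtain P' where P': "P = ?l ^ n * P'"
    by (auto elim: dvdE)
  have "?l ^ n * (q' * P') = ?l ^ n * (p' * ?x ^ n * ?m ^ n)"
    using eq[OF q'(2)] unfolding P' by (simp only: ac_simps)
  then have "q' * P' = (p' * ?x ^ n) * ?m ^ n" by (rule linear_power_cancel[rotated]) simp
  from linear_power_dvd[OF lam_unit q'(1) this] obtain P'' where P'': "P' = ?m ^ n * P''"
    by (auto elim: dvdE)
  define v where "v = y1 ^ n * ylam ^ n"
  have v: "laurent_of_poly (?l ^ n * ?m ^ n) * v = 1"
  proof -
    have "laurent_of_poly (?l ^ n * ?m ^ n) * v =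
        (y1 * (fls_X - fls_const 1)) ^ n * (ylam * (fls_X - fls_const lam)) ^ n"
      unfolding v_def laurent_of_poly_simps power_mult_distrib by (simp only: ac_simps)
    then show ?thesis by (simp only: y1_inverse ylam_inverse power_one mult_1)
  qed
  have "a * fls_X ^ n = laurent_of_poly (?l ^ n * ?m ^ n) * v * (a * fls_X ^ n)" using v by simp
  also have "\<dots> = (a * laurent_of_poly (?x ^ n * ?l ^ n * ?m ^ n)) * v"
    unfolding laurent_of_poly_simps by (simp only: ac_simps)
  also have "\<dots> = laurent_of_poly (?l ^ n * ?m ^ n) * v * laurent_of_poly P''"
    unfolding P unfolding P' P'' by (simp only: laurent_of_poly_simps(2) ac_simps)
  finally show ?thesis using v laurent_polysI by simp
qed

lemma twist_linear: "a \<in> B \<Longrightarrow> b \<in> B \<Longrightarrow> twist (fls_const c * a + b) = fls_const c * twist a + twist b"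
  unfolding twist_def by (simp add: g_linear) (simp add: algebra_simps)

lemma twist_mem: "b \<in> B \<Longrightarrow> twist b \<in> twists"
  by (simp add: twists_def)

lemma twist_X_power: "twist (fls_X ^ n) = fls_const (1 - lam * mu ^ n) * fls_X ^ n"
proof -
  have "twist (fls_X ^ n) = fls_X ^ n - fls_const lam * (fls_const (mu ^ n) * fls_X ^ n)"
    by (simp add: twist_def g_power X_mem g_X power_mult_distrib fls_const_power)
  also have "\<dots> = fls_const (1 - lam * mu ^ n) * fls_X ^ n"
    by (simp only: fls_const_diff left_diff_distrib fls_const_mult_const[symmetric] fls_const_1 mult_1 mult.assoc)
  finally show ?thesis .
qed

lemma twist_X_inv_power: "twist (fls_X_inv ^ n) = fls_const (1 - lam ^ Suc n) * fls_X_inv ^ n"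
proof -
  have "twist (fls_X_inv ^ n) = fls_X_inv ^ n - fls_const lam * (fls_const (lam ^ n) * fls_X_inv ^ n)"
    by (simp add: twist_def g_power X_inv_mem g_X_inv power_mult_distrib fls_const_power)
  also have "\<dots> = fls_const (1 - lam ^ Suc n) * fls_X_inv ^ n"
    by (simp only: fls_const_diff left_diff_distrib fls_const_mult_const[symmetric] fls_const_1 mult_1 mult.assoc
        power_Suc)
  finally show ?thesis .
qed

text \<open>The powers of \<open>x\<close> are eigenvectors of the twist.\<close>

lemma twist_laurent_poly:
  assumes "l \<in> laurent_polys"
  shows "twist l \<in> laurent_polys"
proof -
  let ?V = "{l \<in> B. twist l \<in> laurent_polys}"
  note sub = subspace_laurent_polys
  have V: "fls_mod.subspace ?V"
  proof (rule fls_mod.subspaceI)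
    show "0 \<in> ?V" using fls_mod.subspace_0[OF sub] by (simp add: twist_def g_zero B_intros)
    fix x y c assume x: "x \<in> ?V"
    have "twist (fls_const c * x) = fls_const c * twist x"
      using x twist_linear[of x 0 c] by (simp add: twist_def g_zero B_intros)
    then show "fls_const c * x \<in> ?V"
      using x fls_mod.subspace_scale[OF sub] by (simp add: B_intros)
    assume "y \<in> ?V"
    then show "x + y \<in> ?V"
      using x twist_linear[of x y 1] fls_mod.subspace_add[OF sub] by (simp add: B_intros)
  qed
  have "l \<in> ?V"
    by (rule laurent_polys_minimal[OF V _ _ assms])
      (simp_all add: B_intros(10) X_mem X_inv_mem twist_X_power twist_X_inv_power
        fls_mod.subspace_scale[OF sub] laurent_polys_powers)
  then show ?thesis by simp
qed

lemma X_in_laurent_polys: "fls_X \<in> laurent_polys"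
  using laurent_polys_powers(1)[of 1] by simp

lemma poly_at_y1_mem: "poly_at p y1 \<in> B"
  by (induction p) (simp_all add: poly_at_pCons B_intros(1,2,6,9) y1_mem)

lemma twist_poly_at_y1:
  "twist (poly_at p y1) = poly_at p y1 - fls_const lam * poly_at p (fls_const lam * ylam)"
proof -
  have "g (poly_at p y1) = poly_at p (g y1)"
    by (induction p) (simp_all add: poly_at_pCons g_zero g_add g_mult g_const B_intros(1,9) y1_mem poly_at_y1_mem)
  then show ?thesis by (simp add: twist_def g_y1)
qed

text \<open>Apart from the product of \<open>x\<close> and its inverse, each relation is
  \<open>x/(x - s) = 1 + s/(x - s)\<close> or its consequence after division by \<open>x\<close>.
  The differences of 1 and \<open>lam\<close> from 0 are units, which is why these pairs cause no
  trouble.\<close>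

lemma affine_products:
  "affine_product fls_X (fls_X_inv :: 'k fls)" "affine_product fls_X y1" "affine_product fls_X ylam"
  "affine_product y1 fls_X_inv" "affine_product ylam fls_X_inv"
proof -
  show "affine_product fls_X (fls_X_inv :: 'k fls)"
    unfolding affine_product_def by (intro exI[of _ 0] exI[of _ 1]) (simp add: X_inv_X)
  have y: "y1 * fls_X = 1 + y1" using y1_inverse by (simp add: algebra_simps)
  have z: "ylam * fls_X = 1 + fls_const lam * ylam" using ylam_inverse by (simp add: algebra_simps)
  show "affine_product fls_X y1"
    unfolding affine_product_def
    by (intro exI[of _ 0] exI[of _ 1]) (simp add: y mult.commute[of fls_X] add.commute)
  show "affine_product fls_X ylam"
    unfolding affine_product_def
    by (intro exI[of _ 0] exI[of _ lam] exI[of _ 1]) (simp add: z mult.commute[of fls_X])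
  have "y1 * fls_X * fls_X_inv = (1 + y1) * fls_X_inv" by (simp only: y)
  then have "y1 = fls_X_inv + y1 * fls_X_inv" by (simp add: mult.assoc X_inv_X distrib_right)
  then have "y1 * fls_X_inv = fls_const 1 * y1 + fls_const (- 1) * fls_X_inv + fls_const 0"
    by (simp add: algebra_simps)
  then show "affine_product y1 fls_X_inv" unfolding affine_product_def by blast
  have "ylam * fls_X * fls_X_inv = (1 + fls_const lam * ylam) * fls_X_inv" by (simp only: z)
  then have "ylam = fls_X_inv + fls_const lam * (ylam * fls_X_inv)"
    by (simp add: mult.assoc X_inv_X distrib_right)
  then have "fls_const mu * ylam = fls_const mu * fls_X_inv + ylam * fls_X_inv"
    using const_lam_mu(3) by (metis distrib_left)
  then have "ylam * fls_X_inv = fls_const mu * ylam + fls_const (- mu) * fls_X_inv + fls_const 0"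
    by (simp add: algebra_simps)
  then show "affine_product ylam fls_X_inv" unfolding affine_product_def by blast
qed

text \<open>Subtracting the two fractions gives \<open>1 - lam\<close> times their product. This is
  the one pair of generators whose relation depends on \<open>1 - lam\<close>.\<close>

lemma affine_product_y1_ylam:
  assumes "(1 - lam) dvd 1"
  shows "affine_product y1 ylam"
proof -
  obtain e where e: "1 = (1 - lam) * e" using assms by (elim dvdE)
  have "y1 - ylam = y1 * (ylam * (fls_X - fls_const lam)) - ylam * (y1 * (fls_X - fls_const 1))"
    by (simp only: y1_inverse ylam_inverse mult_1_right)
  also have "\<dots> = fls_const (1 - lam) * (y1 * ylam)"
    by (simp add: fls_const_diff algebra_simps)
  finally have d: "y1 - ylam = fls_const (1 - lam) * (y1 * ylam)" .
  have e': "e * (1 - lam) = 1" using e by (simp only: mult.commute)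
  have "fls_const e * (y1 - ylam) = y1 * ylam"
    unfolding d by (simp only: mult.assoc[symmetric] fls_const_mult_const e' fls_const_1 mult_1)
  then have "y1 * ylam = fls_const e * y1 + fls_const (- e) * ylam + fls_const 0"
    by (simp add: right_diff_distrib)
  then show ?thesis unfolding affine_product_def by blast
qed

lemma inverse_set:
  "z * (fls_X - fls_const s) = 1 \<Longrightarrow> {y. y * (fls_X - fls_const s) = 1} = {z}" for s :: 'k
  using inverse_unique_comm by blast

lemma B_decomposition:
  assumes "b \<in> B"
  obtains l p where "l \<in> laurent_polys" "b = l + poly_at p y1"
proof -
  have "{y. \<exists>s\<in>{0, 1}. y * (fls_X - fls_const s) = 1} = {fls_X_inv, y1}"
    using inverse_set[OF X_inv_inverse] inverse_set[OF y1_inverse] by blast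
  then have "b \<in> subalgebra_gen {fls_X, fls_X_inv, y1}"
    using assms unfolding B_def punctured_def by simp
  then have "b \<in> fls_mod.span (\<Union>p\<in>{fls_X, fls_X_inv, y1}. range (\<lambda>n. p ^ n))"
    by (rule subalgebra_gen_partial_fractions[rotated 2]) (auto intro: affine_products affine_product_sym)
  then have "b \<in> fls_mod.span ((range (\<lambda>n. fls_X ^ n) \<union> range (\<lambda>n. fls_X_inv ^ n)) \<union> range (\<lambda>n. y1 ^ n))"
    by (simp add: Un_assoc)
  then show ?thesis
    unfolding fls_mod.span_Un[of "range _ \<union> range _"] span_powers laurent_polys_def[symmetric]
    using that by blast
qed

lemma A_decomposition:
  assumes eps: "(1 - lam) dvd 1" and "a \<in> A"
  obtains l p q where "l \<in> laurent_polys" "a = l + poly_at p y1 + poly_at q ylam"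
proof -
  have "{y. \<exists>s\<in>{0, 1, lam}. y * (fls_X - fls_const s) = 1} = {fls_X_inv, y1, ylam}"
    using inverse_set[OF X_inv_inverse] inverse_set[OF y1_inverse] inverse_set[OF ylam_inverse] by blast
  then have "a \<in> subalgebra_gen {fls_X, fls_X_inv, y1, ylam}"
    using assms unfolding A_def punctured_def by simp
  then have "a \<in> fls_mod.span (\<Union>p\<in>{fls_X, fls_X_inv, y1, ylam}. range (\<lambda>n. p ^ n))"
    by (rule subalgebra_gen_partial_fractions[rotated 2])
      (auto intro: affine_products affine_product_sym affine_product_y1_ylam[OF eps])
  then have "a \<in> fls_mod.span (((range (\<lambda>n. fls_X ^ n) \<union> range (\<lambda>n. fls_X_inv ^ n)) \<union> range (\<lambda>n. y1 ^ n))
      \<union> range (\<lambda>n. ylam ^ n))"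
    by (simp add: Un_assoc)
  then obtain u v where uv: "a = u + v" "v \<in> range (\<lambda>p. poly_at p ylam)"
    and u: "u \<in> fls_mod.span ((range (\<lambda>n. fls_X ^ n) \<union> range (\<lambda>n. fls_X_inv ^ n)) \<union> range (\<lambda>n. y1 ^ n))"
    unfolding fls_mod.span_Un[of "(range _ \<union> range _) \<union> range _"] span_powers by blast
  from u obtain l p where "l \<in> laurent_polys" "u = l + poly_at p y1"
    unfolding fls_mod.span_Un[of "range _ \<union> range _"] span_powers laurent_polys_def[symmetric] by blast
  then show ?thesis using that uv by blast
qed

subsection \<open>Non-membership\<close>

text \<open>Modulo \<open>1 - lam\<close> both \<open>lam\<close> and \<open>mu\<close> are 1, so
  \<open>g\<close> agrees with the inclusion at \<open>x\<close> and hence on all of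
  \<open>B\<close>. Divisibility is meant among all Laurent series.\<close>

lemma dvd_twist:
  assumes "b \<in> B"
  shows "fls_const (1 - lam) dvd twist b"
proof -
  let ?e = "fls_const (1 - lam)"
  have "?e dvd b - g b"
    using assms unfolding B_def
  proof (induction rule: punctured_induct)
    case (const c)
    then show ?case by (simp add: g_const)
  next
    case X
    have "fls_X - g fls_X = fls_const (1 - mu) * fls_X"
      by (simp add: g_X fls_const_diff algebra_simps)
    also have "1 - mu = (1 - lam) * - mu" using lam_mu by (simp add: algebra_simps)
    finally show ?case by (simp flip: fls_const_mult_const)
  next
    case (add a b)
    have "a + b - g (a + b) = (a - g a) + (b - g b)"
      using add.hyps by (simp add: g_add B_def)
    then show ?case using dvd_add[OF add.IH] by (simp only:)
  next
    case (mult a b)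
    have "a * b - g (a * b) = a * (b - g b) + (a - g a) * g b"
      using mult.hyps by (simp add: g_mult B_def algebra_simps)
    then show ?case using dvd_add[OF dvd_mult[OF mult.IH(2)] dvd_mult2[OF mult.IH(1)]] by (simp only:)
  next
    case (inv s y)
    let ?u = "fls_X - fls_const s"
    have X: "?e dvd g ?u - ?u"
    proof -
      have "g ?u - ?u = fls_const (mu - 1) * fls_X"
        by (simp add: g_diff B_intros g_X g_const fls_const_diff algebra_simps)
      also have "mu - 1 = (1 - lam) * mu" using lam_mu by (simp add: algebra_simps)
      finally show ?thesis by (simp flip: fls_const_mult_const)
    qed
    have gy: "g y * g ?u = 1"
      using g_mult[of y ?u] inv by (simp add: B_def punctured_intros g_one)
    \<comment> \<open>The difference of two inverses: \<open>1/u - 1/v = (v - u)/(u v)\<close> with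
      \<open>v = g u\<close>.\<close>
    have "y - g y = y * g y * (g ?u - ?u)"
    proof -
      have "y * g y * (g ?u - ?u) = y * (g y * g ?u) - g y * (y * ?u)"
        by (simp only: right_diff_distrib ac_simps)
      then show ?thesis by (simp only: gy inv mult_1_right)
    qed
    then show ?case using X by simp
  qed
  moreover have "twist b = (b - g b) + ?e * g b"
    by (simp add: twist_def fls_const_diff algebra_simps)
  ultimately show ?thesis by simp
qed

text \<open>The numerator inherits the divisor \<open>1 - lam\<close>, and so does its unit value at
  1.\<close>

lemma dvd_pole:
  assumes "fls_const (1 - lam) dvd a" and "a * (fls_X - fls_const 1) ^ N = laurent_of_poly r"
    and "poly r 1 dvd 1"
  shows "(1 - lam) dvd 1"
proof -
  have "fls_const (1 - lam) dvd laurent_of_poly r"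
    using assms(1) by (simp flip: assms(2))
  then show ?thesis using fls_const_dvd_laurent_of_poly assms(3) dvd_trans by blast
qed

lemma y1_power: "y1 ^ N * (fls_X - fls_const 1) ^ N = 1"
  using y1_inverse by (simp flip: power_mult_distrib)

text \<open>Write \<open>b\<close> as a Laurent polynomial plus a polynomial \<open>d\<close> in
  \<open>1/(x-1)\<close>. Its twist has polar part \<open>d\<close> at 1 and a rescaled copy of
  \<open>d\<close> at \<open>lam\<close>. Comparison at 1 makes \<open>p - d\<close> constant, and
  then the absence of a pole at \<open>lam\<close> makes \<open>d\<close> constant. A constant may
  survive in \<open>p\<close>, as constants are Laurent polynomials.\<close>

lemma principal_part_twists:
  assumes eps: "(1 - lam) dvd 1" and l: "l \<in> laurent_polys" and tw: "poly_at p y1 + l \<in> twists"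
  shows "degree p = 0"
proof -
  obtain b where b: "b \<in> B" and tb: "poly_at p y1 + l = twist b" using tw by (auto simp: twists_def)
  obtain l' d where l': "l' \<in> laurent_polys" and bd: "b = l' + poly_at d y1"
    using B_decomposition[OF b] .
  define m where "m = twist l' - l"
  have m: "m \<in> laurent_polys"
    unfolding m_def by (intro fls_mod.subspace_diff subspace_laurent_polys twist_laurent_poly l l')
  let ?z = "fls_const lam * ylam"
  have eq: "poly_at (p - d) y1 = m + fls_const (- lam) * poly_at d ?z"
  proof -
    have "twist b = twist l' + (poly_at d y1 - fls_const lam * poly_at d ?z)"
      using twist_linear[of l' "poly_at d y1" 1] l' laurent_polys_subset_B poly_at_y1_mem
      by (simp add: bd twist_poly_at_y1)
    moreover have "poly_at p y1 = twist b - l" using tb by (simp add: eq_diff_eq)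
    ultimately show ?thesis by (simp add: m_def poly_at_diff)
  qed
  have r1: "regular_at 1 ylam" by (rule regular_at_inverse[OF ylam_inverse eps])
  have "regular_at 1 (poly_at (p - d) y1)"
    unfolding eq
    by (intro regular_at_add regular_at_mult regular_at_poly_at regular_at_const r1
        laurent_polys_regular[OF m dvd_refl])
  then have pd: "degree (p - d) = 0"
    using poly_at_pole_regular[of y1 1 1] y1_inverse by simp
  have "poly_at d ?z = fls_const mu * (m + fls_const (- 1) * poly_at (p - d) y1)"
    unfolding eq using const_lam_mu(3) by simp
  then have "poly_at d ?z = fls_const mu * (m + fls_const (- 1) * fls_const (coeff (p - d) 0))"
    by (simp only: poly_at_degree_0[OF pd])
  then have "regular_at lam (poly_at d ?z)"
    using lam_unit m by (simp only: regular_at_add regular_at_mult regular_at_const laurent_polys_regular)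
  moreover have "?z * (fls_X - fls_const lam) = fls_const lam"
    using ylam_inverse by (simp add: mult.assoc)
  ultimately have "degree d = 0" using poly_at_pole_regular lam_unit by blast
  then have "degree (p - d + d) \<le> 0"
    using pd by (intro degree_add_le) simp_all
  then show ?thesis by simp
qed

lemma y1_power_not_regular:
  assumes N: "N > 0" and l: "l \<in> laurent_polys"
  shows "y1 ^ N - l \<notin> twists"
proof
  assume tw: "y1 ^ N - l \<in> twists"
  have eps: "(1 - lam) dvd 1"
  proof -
    obtain p q where q: "poly q 1 dvd 1" "laurent_of_poly q * l = laurent_of_poly p"
      using laurent_polys_regular[OF l, of 1] by (auto simp: regular_at_def)
    have "fls_const (1 - lam) dvd laurent_of_poly q * (y1 ^ N - l)"
      using tw dvd_twist by (auto simp: twists_def)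
    \<comment> \<open>Clearing the denominator \<open>q\<close> of \<open>l\<close> and the pole at
      1 leaves a numerator whose value at 1 is the unit \<open>poly q 1\<close>; the other summand
      vanishes there because \<open>N > 0\<close>.\<close>
    moreover have "laurent_of_poly q * (y1 ^ N - l) * (fls_X - fls_const 1) ^ N =
        laurent_of_poly (q - p * [:- 1, 1:] ^ N)"
    proof -
      have "laurent_of_poly q * (y1 ^ N - l) * (fls_X - fls_const 1) ^ N =
          laurent_of_poly q * (y1 ^ N * (fls_X - fls_const 1) ^ N)
            - (laurent_of_poly q * l) * (fls_X - fls_const 1) ^ N"
        by (simp only: right_diff_distrib left_diff_distrib mult.assoc)
      also have "\<dots> = laurent_of_poly q - laurent_of_poly (p * [:- 1, 1:] ^ N)"
        unfolding q(2) y1_power laurent_of_poly_simps by simp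
      finally show ?thesis
        by (simp only: laurent_of_poly_diff)
    qed
    moreover have "poly (q - p * [:- 1, 1:] ^ N) 1 dvd 1" using q(1) N by (simp add: zero_power)
    ultimately show ?thesis by (rule dvd_pole)
  qed
  have "poly_at (monom 1 N) y1 + (- l) \<in> twists" using tw by (simp add: poly_at_monom)
  then have "degree (monom (1 :: 'k) N) = 0"
    by (rule principal_part_twists[OF eps fls_mod.subspace_neg[OF subspace_laurent_polys l]])
  then show False using N lam_neq by (simp add: degree_monom_eq)
qed

lemma y1_powers_distinct:
  assumes "0 < M" "M < N"
  shows "y1 ^ N - y1 ^ M \<notin> twists"
proof
  assume tw: "y1 ^ N - y1 ^ M \<in> twists"
  have eps: "(1 - lam) dvd 1"
  proof (rule dvd_pole)
    show "fls_const (1 - lam) dvd y1 ^ N - y1 ^ M" using tw dvd_twist by (auto simp: twists_def)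
    have "y1 ^ M * (fls_X - fls_const 1) ^ N = (fls_X - fls_const 1) ^ (N - M)"
    proof -
      have "(fls_X - fls_const 1) ^ N = (fls_X - fls_const 1) ^ M * (fls_X - fls_const (1 :: 'k)) ^ (N - M)"
        by (simp only: power_add[symmetric] le_add_diff_inverse[OF less_imp_le[OF assms(2)]])
      then show ?thesis by (simp only: mult.assoc[symmetric] y1_power mult_1)
    qed
    then have "(y1 ^ N - y1 ^ M) * (fls_X - fls_const 1) ^ N = 1 - (fls_X - fls_const 1) ^ (N - M)"
      by (simp only: left_diff_distrib y1_power)
    moreover have "laurent_of_poly (1 - [:- 1, 1:] ^ (N - M)) = 1 - (fls_X - fls_const (1 :: 'k)) ^ (N - M)"
      by (simp only: laurent_of_poly_diff laurent_of_poly_simps)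
    ultimately show "(y1 ^ N - y1 ^ M) * (fls_X - fls_const 1) ^ N = laurent_of_poly (1 - [:- 1, 1:] ^ (N - M))"
      by (simp only:)
    \<comment> \<open>\<open>N - M > 0\<close>, so the power vanishes at 1 and the value is
      1.\<close>
    show "poly (1 - [:- 1, 1:] ^ (N - M)) (1 :: 'k) dvd 1" using assms by (simp add: zero_power)
  qed
  have "poly_at (monom 1 N - monom 1 M) y1 + 0 \<in> twists"
    using tw by (simp add: poly_at_diff poly_at_monom)
  then have "degree (monom (1 :: 'k) N - monom 1 M) = 0"
    by (rule principal_part_twists[OF eps fls_mod.subspace_0[OF subspace_laurent_polys]])
  moreover have "coeff (monom (1 :: 'k) N - monom 1 M) N \<noteq> 0" using assms lam_neq by simp
  ultimately show False using assms le_degree[of "monom (1 :: 'k) N - monom 1 M" N] by simp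
qed

lemma X_multiple_twist:
  assumes "fls_const c * fls_X \<in> twists"
  shows "c = 0"
proof -
  obtain b where b: "b \<in> B" and c: "fls_const c * fls_X = b - fls_const lam * g b"
    using assms by (auto simp: twists_def twist_def)
  \<comment> \<open>\<open>g\<close> maps \<open>1/x\<close> to \<open>lam/x\<close>, so division by
    \<open>x\<close> absorbs the factor \<open>lam\<close> of the twist.\<close>
  have "fls_X_inv * (fls_const c * fls_X) = fls_X_inv * b - g (fls_X_inv * b)"
    unfolding c by (simp add: g_mult X_inv_mem b g_X_inv right_diff_distrib mult.assoc mult.left_commute)
  moreover have "fls_X_inv * (fls_const c * fls_X) = fls_const c * (fls_X_inv * fls_X)"
    by (simp only: ac_simps)
  ultimately have eq: "fls_const c = fls_X_inv * b - g (fls_X_inv * b)" by (simp add: X_inv_X)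
  \<comment> \<open>Invariance of the constant coefficient is checked on spanning functions of
    \<open>B\<close>, because \<open>g\<close> is given as a homomorphism on \<open>B\<close> and
    not as an operation on coefficients.\<close>
  let ?V = "{a \<in> B. fls_nth a 0 = fls_nth (g a) 0}"
  have V: "fls_mod.subspace ?V"
    by (rule fls_mod.subspaceI) (simp_all add: g_zero g_add g_scale B_intros)
  have xb: "fls_X_inv * b \<in> B" using X_inv_mem b by (rule B_intros(9))
  obtain l p where l: "l \<in> laurent_polys" and lp: "fls_X_inv * b = l + poly_at p y1"
    using B_decomposition[OF xb] .
  have "l \<in> ?V"
    by (rule laurent_polys_minimal[OF V _ _ l])
      (auto simp: B_intros(10) X_mem X_inv_mem g_power g_X g_X_inv power_mult_distrib
        simp flip: fls_const_power)
  moreover have "poly_at p y1 \<in> ?V"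
  proof -
    have 1: "y1 * (fls_const 1 * fls_X - 1) = 1" using y1_inverse by simp
    have 2: "g y1 * (fls_const mu * fls_X - 1) = 1"
      using algebra_hom_inverse[OF g_hom[unfolded B_def] y1_mem[unfolded B_def] y1_inverse] by (simp add: g_X)
    have "y1 ^ n \<in> ?V" for n
      using inverse_power_nth_0[OF 1, of n] inverse_power_nth_0[OF 2, of n]
      by (simp add: B_intros(10) y1_mem g_power)
    then have "fls_mod.span (range (\<lambda>n. y1 ^ n)) \<subseteq> ?V"
      by (intro fls_mod.span_minimal V) blast
    then show ?thesis using poly_at_mem_span by blast
  qed
  ultimately have "fls_X_inv * b \<in> ?V" unfolding lp by (rule fls_mod.subspace_add[OF V])
  then have "fls_nth (fls_const c) 0 = 0" unfolding eq by simp
  then show "c = 0" by simp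
qed

section \<open>The two classes of generators\<close>

definition y1_powers :: "'k fls set" where
  "y1_powers = {y1 ^ N | N. N > 0}"

lemma laurent_polys_subset_A: "laurent_polys \<subseteq> A"
  using laurent_polys_subset_B B_subset_A by blast

lemma y1_powers_subset_A: "y1_powers \<subseteq> A"
  using B_intros(10)[OF y1_mem] B_subset_A by (auto simp: y1_powers_def)

lemma subspace_A: "fls_mod.subspace A"
  by (simp add: A_def subspace_punctured)

lemma first_class_eq: "first_class B A f g lam = {kappa fls_X}"
  unfolding first_class_def by (rule classes_of_eq) (rule A_intros(4))

lemma second_class_eq: "second_class B A f g lam = kappa ` y1_powers"
proof -
  have "{a. \<exists>N>0. a * (fls_X - 1) ^ N = 1} = y1_powers"
  proof -
    have "a * (fls_X - 1) ^ N = 1 \<longleftrightarrow> a = y1 ^ N" for a N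
      using y1_power[of N] inverse_unique_comm[of a "(fls_X - 1) ^ N" "y1 ^ N"] by auto
    then show ?thesis by (auto simp: y1_powers_def)
  qed
  moreover have "classes_of B A f g lam a = {kappa a}" if "a \<in> y1_powers" for a
    using y1_powers_subset_A that by (intro classes_of_eq) blast
  ultimately show ?thesis unfolding second_class_def by auto
qed

text \<open>Both values at \<open>x\<close> of a regular pair are Laurent polynomials, and so is
  their combination; conversely a pair with zero component along \<open>g\<close> realises any of
  them.\<close>

lemma regular_classes_eq: "regular_classes B A f g lam = kappa ` laurent_polys"
proof
  show "regular_classes B A f g lam \<subseteq> kappa ` laurent_polys"
  proof
    fix U assume "U \<in> regular_classes B A f g lam"
    then obtain Gf Gg where U: "U = diag_class B A f g 2 (0, 0, Gf, Gg)"
      and D: "derivation B A f Gf" "derivation B A g Gg"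
      and reg: "\<forall>c\<in>{1, lam}. regular_at c (Gf [fls_X]) \<and> regular_at c (Gg [fls_X])"
      unfolding regular_classes_def by blast
    have "Gf [fls_X] \<in> laurent_polys" "Gg [fls_X] \<in> laurent_polys"
      using reg derivation_X_mem[OF D(1)] derivation_X_mem[OF D(2)]
      by (simp_all add: regular_imp_laurent_poly)
    then have "Gf [fls_X] - fls_const lam * Gg [fls_X] \<in> laurent_polys"
      by (intro fls_mod.subspace_diff fls_mod.subspace_scale subspace_laurent_polys)
    then show "U \<in> kappa ` laurent_polys"
      unfolding U kappa_derivation_pair[OF D] by (rule imageI)
  qed
  show "kappa ` laurent_polys \<subseteq> regular_classes B A f g lam"
  proof
    fix U assume "U \<in> kappa ` laurent_polys"
    then obtain l where l: "l \<in> laurent_polys" and U: "U = kappa l" by blast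
    let ?D = "cochain1 B (\<lambda>b. l * fls_deriv b)"
    have D: "derivation B A f ?D" by (rule derivation_f) (use l laurent_polys_subset_A in blast)
    have "\<forall>c\<in>{1, lam}. regular_at c (?D [fls_X]) \<and> regular_at c ((0 :: 'k cochain) [fls_X])"
      using laurent_polys_regular[OF l] lam_unit regular_at_const[of _ "0 :: 'k"] by (simp add: X_mem)
    then show "U \<in> regular_classes B A f g lam"
      unfolding U kappa_def deriv_quad_def regular_classes_def
      using D derivation_zero[OF g_hom] by blast
  qed
qed

text \<open>Spanning \<open>V\<close> up to twists is enough, since \<open>kappa\<close> identifies
  elements of \<open>A\<close> that differ by a twist.\<close>

lemma kappa_span_eq:
  assumes "X \<subseteq> V" "fls_mod.subspace V" "V \<subseteq> A" "V \<subseteq> fls_mod.span (X \<union> twists)"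
  shows "kappa ` fls_mod.span X = kappa ` V"
proof
  have XV: "fls_mod.span X \<subseteq> V" using assms by (intro fls_mod.span_minimal)
  then show "kappa ` fls_mod.span X \<subseteq> kappa ` V" by blast
  show "kappa ` V \<subseteq> kappa ` fls_mod.span X"
  proof
    fix U assume "U \<in> kappa ` V"
    then obtain v where v: "v \<in> V" "U = kappa v" by blast
    then obtain a t where a: "a \<in> fls_mod.span X" and t: "t \<in> fls_mod.span twists" and "v = a + t"
      using assms(4) unfolding fls_mod.span_Un by blast
    moreover have "fls_mod.span twists = twists" using subspace_twists by simp
    ultimately have "v - a \<in> twists" by simp
    moreover have "v \<in> A" "a \<in> A" using v(1) a XV assms(3) by blast+
    ultimately have "kappa v = kappa a" using kappa_eq_iff by blast
    then show "U \<in> kappa ` fls_mod.span X" using v(2) a by blast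
  qed
qed

lemma kappa_injective_y1_powers:
  assumes "0 < M" "0 < N" "kappa (y1 ^ M) = kappa (y1 ^ N)"
  shows "M = N"
proof -
  have mem: "y1 ^ n \<in> A" for n using B_intros(10)[OF y1_mem] B_subset_A by blast
  have "y1 ^ M - y1 ^ N \<in> twists" "y1 ^ N - y1 ^ M \<in> twists"
    using assms(3) kappa_eq_iff[OF mem mem] by metis+
  then show ?thesis using y1_powers_distinct assms(1,2) by (metis linorder_neqE_nat)
qed

lemma infinite_second_class: "infinite (kappa ` y1_powers)"
proof -
  have "inj_on (\<lambda>N. kappa (y1 ^ N)) {0<..}"
    by (rule inj_onI) (simp add: kappa_injective_y1_powers)
  then have "infinite ((\<lambda>N. kappa (y1 ^ N)) ` {0<..})"
    using finite_imageD infinite_Ioi by blast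
  moreover have "(\<lambda>N. kappa (y1 ^ N)) ` {0<..} = kappa ` y1_powers"
    by (auto simp: y1_powers_def)
  ultimately show ?thesis by simp
qed

lemma second_class_not_regular: "kappa ` y1_powers \<inter> kappa ` laurent_polys = {}"
proof -
  have "kappa (y1 ^ N) \<noteq> kappa l" if "N > 0" "l \<in> laurent_polys" for N l
  proof -
    have "y1 ^ N \<in> A" "l \<in> A"
      using B_intros(10)[OF y1_mem] B_subset_A laurent_polys_subset_A that by blast+
    then show ?thesis using y1_power_not_regular[OF that] kappa_eq_iff by blast
  qed
  then show ?thesis by (auto simp: y1_powers_def)
qed

section \<open>Independence and generation\<close>

lemma first_class_independent: "coset_independent W {kappa fls_X}"
proof -
  have "coset_independent W (kappa ` {fls_X})"
  proof (rule coset_independent_kappa)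
    fix t c assume "finite t" "t \<subseteq> {fls_X}" and tw: "(\<Sum>a\<in>t. fls_const (c a) * a) \<in> twists"
    then have "t = {} \<or> t = {fls_X}" by blast
    then show "\<forall>a\<in>t. c a = 0" using tw X_multiple_twist by auto
  qed (simp add: A_intros)
  then show ?thesis by simp
qed

text \<open>Repackages a combination as a polynomial in \<open>1/(x-1)\<close>. The coefficients can
  be read back because distinct exponents give distinct powers, indeed distinct classes.\<close>

lemma y1_combination:
  assumes "finite t" "t \<subseteq> y1_powers"
  obtains p where "(\<Sum>a\<in>t. fls_const (c a) * a) = poly_at p y1" "coeff p 0 = 0"
    "\<And>N. N > 0 \<Longrightarrow> y1 ^ N \<in> t \<Longrightarrow> coeff p N = c (y1 ^ N)"
proof -
  define I where "I = {N. N > 0 \<and> y1 ^ N \<in> t}"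
  have inj: "inj_on (\<lambda>N. y1 ^ N) I"
    by (rule inj_onI) (use kappa_injective_y1_powers in \<open>auto simp: I_def\<close>)
  have t: "t = (\<lambda>N. y1 ^ N) ` I" using assms(2) by (auto simp: I_def y1_powers_def)
  then have fin: "finite I" using assms(1) inj finite_imageD by blast
  define p where "p = (\<Sum>N\<in>I. monom (c (y1 ^ N)) N)"
  have coeff: "coeff p N = (if N \<in> I then c (y1 ^ N) else 0)" for N
    using fin by (simp add: p_def coeff_sum)
  have "(\<Sum>a\<in>t. fls_const (c a) * a) = poly_at p y1"
    unfolding t sum.reindex[OF inj] p_def poly_at_sum poly_at_monom by simp
  then show ?thesis using that coeff by (auto simp: I_def)
qed

text \<open>The \<open>x\<close>-term belongs to the Laurent polynomial part, so the principal part
  at 1 vanishes on its own; what remains is a multiple of \<open>x\<close> that is a twist.\<close>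

lemma generators_independent:
  assumes eps: "(1 - lam) dvd 1"
  shows "coset_independent W (kappa ` ({fls_X} \<union> y1_powers))"
proof (rule coset_independent_kappa)
  show "{fls_X} \<union> y1_powers \<subseteq> A" using y1_powers_subset_A by (simp add: A_intros)
  fix t c assume t: "finite t" "t \<subseteq> {fls_X} \<union> y1_powers" and tw: "(\<Sum>a\<in>t. fls_const (c a) * a) \<in> twists"
  let ?t = "t - {fls_X}"
  define x where "x = (if fls_X \<in> t then fls_const (c fls_X) * fls_X else 0)"
  have "finite ?t" "?t \<subseteq> y1_powers" using t by auto
  from y1_combination[OF this, of c] obtain p where p: "(\<Sum>a\<in>?t. fls_const (c a) * a) = poly_at p y1"
    and p0: "coeff p 0 = 0" and pN: "\<And>N. N > 0 \<Longrightarrow> y1 ^ N \<in> ?t \<Longrightarrow> coeff p N = c (y1 ^ N)"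
    by blast
  have sum: "(\<Sum>a\<in>t. fls_const (c a) * a) = poly_at p y1 + x"
    using t(1) unfolding p[symmetric] x_def
    by (cases "fls_X \<in> t") (simp_all add: sum.remove add.commute)
  have "x \<in> laurent_polys"
    by (simp add: x_def fls_mod.subspace_scale[OF subspace_laurent_polys] X_in_laurent_polys
        fls_mod.subspace_0[OF subspace_laurent_polys])
  then have "degree p = 0" using principal_part_twists[OF eps] tw unfolding sum by blast
  \<comment> \<open>The missing constant term upgrades degree zero to the zero polynomial.\<close>
  then have "p = 0" using p0 by (metis degree_0_id pCons_0_0)
  then have "x \<in> twists" using tw sum by simp
  then have "fls_X \<in> t \<Longrightarrow> c fls_X = 0" using X_multiple_twist by (simp add: x_def)
  moreover have "c a = 0" if "a \<in> ?t" for a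
  proof -
    have "a \<in> y1_powers" using that t(2) by blast
    then obtain N where "N > 0" "a = y1 ^ N" by (auto simp: y1_powers_def)
    then show ?thesis using pN[of N] that \<open>p = 0\<close> by simp
  qed
  ultimately show "\<forall>a\<in>t. c a = 0" by blast
qed

lemma poly_at_y1_span:
  "poly_at p y1 \<in> fls_mod.span (laurent_polys \<union> y1_powers)"
proof -
  have "y1 ^ N \<in> laurent_polys \<union> y1_powers" for N
    using laurent_polys_powers(1)[of 0] by (cases "N = 0") (auto simp: y1_powers_def)
  then have "fls_mod.span (range (\<lambda>n. y1 ^ n)) \<subseteq> fls_mod.span (laurent_polys \<union> y1_powers)"
    by (intro fls_mod.span_mono) blast
  then show ?thesis using poly_at_mem_span by blast
qed

text \<open>Modulo twists, a pole at \<open>lam\<close> can be moved to \<open>1\<close>.\<close>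

lemma A_span:
  assumes eps: "(1 - lam) dvd 1"
  shows "A \<subseteq> fls_mod.span ((laurent_polys \<union> y1_powers) \<union> twists)" (is "_ \<subseteq> ?V")
proof
  fix a assume "a \<in> A"
  from A_decomposition[OF eps this] obtain l p q
    where l: "l \<in> laurent_polys" and a: "a = l + poly_at p y1 + poly_at q ylam" .
  have p: "poly_at r y1 \<in> ?V" for r
    using poly_at_y1_span fls_mod.span_mono[of "laurent_polys \<union> y1_powers"] by blast
  have "ylam ^ n \<in> ?V" for n
  proof -
    have "twist (poly_at (monom 1 n) y1) = y1 ^ n - fls_const lam * (fls_const lam * ylam) ^ n"
      unfolding twist_poly_at_y1 by (simp add: poly_at_monom)
    then have "fls_const (lam ^ Suc n) * ylam ^ n = poly_at (monom 1 n) y1 - twist (poly_at (monom 1 n) y1)"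
      by (simp add: poly_at_monom power_mult_distrib fls_const_power mult.assoc flip: fls_const_mult_const)
    also have "\<dots> \<in> ?V"
      by (intro fls_mod.span_diff p fls_mod.span_base UnI2 twist_mem poly_at_y1_mem)
    finally have "fls_const (mu ^ Suc n) * (fls_const (lam ^ Suc n) * ylam ^ n) \<in> ?V"
      by (rule fls_mod.span_scale)
    moreover have "mu ^ Suc n * lam ^ Suc n = 1"
      using lam_mu by (simp only: power_mult_distrib[symmetric] mult.commute[of mu] power_one)
    ultimately show ?thesis by (simp only: mult.assoc[symmetric] fls_const_mult_const fls_const_1 mult_1)
  qed
  then have "fls_mod.span (range (\<lambda>n. ylam ^ n)) \<subseteq> ?V"
    by (intro fls_mod.span_minimal) auto
  then have "poly_at q ylam \<in> ?V" using poly_at_mem_span by blast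
  moreover have "l \<in> ?V" using l by (intro fls_mod.span_base) blast
  ultimately show "a \<in> ?V" unfolding a by (intro fls_mod.span_add p)
qed

lemma span_generators:
  assumes "(1 - lam) dvd 1"
  shows "coset_span W (kappa ` (laurent_polys \<union> y1_powers)) = H"
  using laurent_polys_subset_A y1_powers_subset_A A_span[OF assms]
  by (simp add: coset_span_kappa kappa_span_eq[where V = A] subspace_A cohomology_eq)

text \<open>A common class equates, modulo twists, a principal part without constant term and a
  Laurent polynomial; such a principal part is constant, hence zero.\<close>

lemma span_second_class_regular:
  assumes eps: "(1 - lam) dvd 1"
  shows "coset_span W (kappa ` y1_powers) \<inter> kappa ` laurent_polys = {W}"
proof
  show "coset_span W (kappa ` y1_powers) \<inter> kappa ` laurent_polys \<subseteq> {W}"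
  proof
    fix U assume "U \<in> coset_span W (kappa ` y1_powers) \<inter> kappa ` laurent_polys"
    then obtain a l where a: "a \<in> fls_mod.span y1_powers" "U = kappa a"
      and l: "l \<in> laurent_polys" "U = kappa l"
      using coset_span_kappa[OF y1_powers_subset_A] by auto
    obtain t c where "finite t" "t \<subseteq> y1_powers" and sum: "a = (\<Sum>a\<in>t. fls_const (c a) * a)"
      using a(1) unfolding fls_mod.span_explicit by blast
    then obtain p where p: "a = poly_at p y1" "coeff p 0 = 0"
      using y1_combination[of t c] by metis
    have "a \<in> A" using p(1) poly_at_y1_mem B_subset_A by blast
    moreover have "l \<in> A" using l laurent_polys_subset_A by blast
    ultimately have "a - l \<in> twists" using kappa_eq_iff a(2) l(2) by blast
    then have "poly_at p y1 + (- l) \<in> twists" by (simp add: p)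
    then have "degree p = 0"
      by (rule principal_part_twists[OF eps fls_mod.subspace_neg[OF subspace_laurent_polys l(1)]])
    then have "a = 0" using p by (simp add: poly_at_degree_0)
    then show "U \<in> {W}" using a(2) kappa_zero by simp
  qed
  have "0 \<in> fls_mod.span y1_powers" "0 \<in> laurent_polys"
    using fls_mod.span_zero fls_mod.subspace_0[OF subspace_laurent_polys] by blast+
  then show "{W} \<subseteq> coset_span W (kappa ` y1_powers) \<inter> kappa ` laurent_polys"
    using coset_span_kappa[OF y1_powers_subset_A] kappa_zero by blast
qed

text \<open>For every integer \<open>n\<close> other than 1 the eigenvalue
  \<open>1 - lam^(1-n)\<close> of the twist on \<open>x^n\<close> is a unit under the hypothesis, so
  \<open>x^n\<close> is itself a twist.\<close>

lemma laurent_polys_span: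
  assumes units: "\<And>m. m > 0 \<Longrightarrow> (1 - lam ^ m) dvd 1"
  shows "laurent_polys \<subseteq> fls_mod.span ({fls_X} \<union> twists)" (is "_ \<subseteq> ?V")
proof
  fix l assume l: "l \<in> laurent_polys"
  have unit: "a \<in> ?V" if "u dvd 1" "fls_const u * a \<in> twists" for u a
  proof -
    obtain v where v: "1 = u * v" using \<open>u dvd 1\<close> by (elim dvdE)
    have "fls_const v * (fls_const u * a) \<in> ?V"
      using that(2) by (intro fls_mod.span_scale fls_mod.span_base) blast
    moreover have "v * u = 1" using v by (simp only: mult.commute)
    ultimately show ?thesis by (simp only: mult.assoc[symmetric] fls_const_mult_const fls_const_1 mult_1)
  qed
  have "fls_X ^ n \<in> ?V" for n
  proof (cases "n = 1")
    case True
    then show ?thesis by (simp add: fls_mod.span_base)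
  next
    case n: False
    have "(1 - lam * mu ^ n) dvd 1"
    proof (cases n)
      case 0
      then show ?thesis using units[of 1] by simp
    next
      case (Suc m)
      then have m: "m > 0" using n by simp
      have "lam * mu ^ n = mu ^ m" unfolding Suc using lam_mu by (simp flip: mult.assoc)
      \<comment> \<open>For \<open>n = m + 1\<close> the eigenvalue is \<open>1 - mu^m\<close>,
        which is \<open>1 - lam^m\<close> up to the unit \<open>- (mu ^ m)\<close>.\<close>
      moreover have "(1 - lam ^ m) * - (mu ^ m) = 1 - mu ^ m"
        using lam_mu by (simp add: algebra_simps flip: power_mult_distrib)
      moreover have "(1 - lam ^ m) * - (mu ^ m) dvd 1 * 1"
        using units[OF m] dvd_power_same[OF mu_unit, of m] by (intro mult_dvd_mono) simp_all
      ultimately show ?thesis by simp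
    qed
    moreover have "fls_const (1 - lam * mu ^ n) * fls_X ^ n \<in> twists"
      using twist_mem[of "fls_X ^ n"] B_intros(10)[OF X_mem] by (simp only: twist_X_power)
    ultimately show ?thesis by (rule unit)
  qed
  moreover have "fls_X_inv ^ n \<in> ?V" for n
    using twist_mem[of "fls_X_inv ^ n"] B_intros(10)[OF X_inv_mem] units[of "Suc n"]
    by (intro unit[of "1 - lam ^ Suc n"]) (simp_all only: twist_X_inv_power zero_less_Suc)
  ultimately show "l \<in> ?V" by (intro laurent_polys_minimal[OF _ _ _ l]) simp_all
qed

lemma span_first_class:
  assumes "\<And>m. m > 0 \<Longrightarrow> (1 - lam ^ m) dvd 1"
  shows "coset_span W (kappa ` {fls_X}) = kappa ` laurent_polys"
  using laurent_polys_span[OF assms] X_in_laurent_polys laurent_polys_subset_A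
  by (simp add: coset_span_kappa[of "{fls_X}", simplified] A_intros
      kappa_span_eq[of "{fls_X}" laurent_polys] subspace_laurent_polys)

lemma span_both_classes:
  assumes units: "\<And>m. m > 0 \<Longrightarrow> (1 - lam ^ m) dvd 1"
  shows "coset_span W (kappa ` ({fls_X} \<union> y1_powers)) = H"
proof -
  let ?X = "{fls_X} \<union> y1_powers"
  have X: "?X \<subseteq> A" using y1_powers_subset_A by (simp add: A_intros)
  have "laurent_polys \<subseteq> fls_mod.span (?X \<union> twists)"
    using laurent_polys_span[OF units] fls_mod.span_mono[of "{fls_X} \<union> twists" "?X \<union> twists"] by blast
  then have "(laurent_polys \<union> y1_powers) \<union> twists \<subseteq> fls_mod.span (?X \<union> twists)"
    using fls_mod.span_superset[of "?X \<union> twists"] by blast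
  then have "fls_mod.span ((laurent_polys \<union> y1_powers) \<union> twists) \<subseteq> fls_mod.span (?X \<union> twists)"
    by (rule fls_mod.span_minimal) simp
  moreover have "A \<subseteq> fls_mod.span ((laurent_polys \<union> y1_powers) \<union> twists)"
    using A_span units[of 1] by simp
  ultimately have "A \<subseteq> fls_mod.span (?X \<union> twists)" by blast
  from kappa_span_eq[OF X subspace_A subset_refl this] show ?thesis
    by (simp only: coset_span_kappa[OF X] cohomology_eq)
qed

text \<open>
  If \<open>1 - lam\<close> is not a unit, then twisting is trivial modulo \<open>1 - lam\<close>, and the coefficients at
  negative powers of \<open>x\<close> separate the classes; otherwise the principal parts at \<open>1\<close> do.
\<close>

lemma infinite_dimensional: "\<not> coset_finite_dim W H"
proof
  assume "coset_finite_dim W H"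
  then obtain G where G: "finite G" "G \<subseteq> kappa ` A" and span: "coset_span W G = H"
    unfolding coset_finite_dim_def cohomology_eq by blast
  obtain X where X: "finite X" "X \<subseteq> A" and GX: "G = kappa ` X"
    using finite_subset_image[OF G] by blast
  have H: "kappa ` fls_mod.span X = kappa ` A"
    using span unfolding GX coset_span_kappa[OF X(2)] cohomology_eq .
  have spanA: "fls_mod.span X \<subseteq> A" using X(2) by (intro fls_mod.span_minimal subspace_A)
  have cover: "\<exists>v\<in>fls_mod.span X. a - v \<in> twists" if a: "a \<in> A" for a
  proof -
    have "kappa a \<in> kappa ` fls_mod.span X" unfolding H using a by (rule imageI)
    then obtain v where "v \<in> fls_mod.span X" "kappa a = kappa v" by blast
    then show ?thesis using kappa_eq_iff[OF a] spanA by blast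
  qed
  show False
  proof (cases "(1 - lam) dvd 1")
    case False
    obtain m where m: "\<And>a. a \<in> X \<Longrightarrow> fls_subdegree a \<ge> m"
    proof (cases "X = {}")
      case False
      then show ?thesis using that[of "Min (fls_subdegree ` X)"] X(1) by simp
    qed (use that in simp)
    \<comment> \<open>Makes \<open>- int N < m\<close>, so \<open>x^(-N)\<close> has a deeper pole
      at 0 than anything in the span of \<open>X\<close>.\<close>
    define N where "N = nat (\<bar>m\<bar> + 1)"
    let ?V = "{a. fls_nth a (- int N) = (0 :: 'k)}"
    have "fls_mod.span X \<subseteq> ?V"
    proof (intro fls_mod.span_minimal)
      show "X \<subseteq> ?V"
      proof
        fix a assume "a \<in> X"
        then have "- int N < fls_subdegree a" using m[of a] by (simp add: N_def)
        then show "a \<in> ?V" by simp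
      qed
      show "fls_mod.subspace ?V" by (rule fls_mod.subspaceI) simp_all
    qed
    moreover have "fls_X_inv ^ N \<in> A" using B_intros(10)[OF X_inv_mem] B_subset_A by blast
    ultimately obtain v where v: "fls_nth v (- int N) = 0" and tw: "fls_X_inv ^ N - v \<in> twists"
      using cover by blast
    have "fls_const (1 - lam) dvd fls_X_inv ^ N - v" using tw dvd_twist by (auto simp: twists_def)
    \<comment> \<open>The coefficient of \<open>x^(-N)\<close> in the difference is 1.\<close>
    from fls_const_dvd_nth[OF this, of "- int N"] v have "(1 - lam) dvd 1" by simp
    then show False using False by blast
  next
    case eps: True
    have "\<exists>p l. l \<in> laurent_polys \<and> a - (poly_at p y1 + l) \<in> twists" if aA: "a \<in> A" for a
    proof -
      obtain u w where u: "u \<in> fls_mod.span laurent_polys" and w: "w \<in> fls_mod.span (y1_powers \<union> twists)"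
        and "a = u + w"
        using A_span[OF eps] aA unfolding Un_assoc fls_mod.span_Un[of laurent_polys] by blast
      moreover obtain v t where v: "v \<in> fls_mod.span y1_powers" and t: "t \<in> fls_mod.span twists"
        and "w = v + t"
        using w unfolding fls_mod.span_Un by blast
      moreover have "u \<in> laurent_polys" "t \<in> twists"
        using u t fls_mod.span_eq_iff subspace_laurent_polys subspace_twists by blast+
      moreover have "fls_mod.span y1_powers \<subseteq> range (\<lambda>p. poly_at p y1)"
        unfolding span_powers[symmetric] by (intro fls_mod.span_mono) (auto simp: y1_powers_def)
      moreover from this v obtain p where "v = poly_at p y1" by blast
      ultimately show ?thesis by (intro exI[of _ p] exI[of _ u]) simp
    qed
    then obtain P L where PL: "\<And>a. a \<in> X \<Longrightarrow> L a \<in> laurent_polys \<and> a - (poly_at (P a) y1 + L a) \<in> twists"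
      using X(2) by (metis subsetD)
    obtain m where m: "\<And>a. a \<in> X \<Longrightarrow> degree (P a) \<le> m"
    proof (cases "X = {}")
      case False
      then show ?thesis using that[of "Max ((\<lambda>a. degree (P a)) ` X)"] X(1) by simp
    qed (use that in simp)
    \<comment> \<open>Everything whose principal part at 1 has order at most \<open>m\<close> up to
      twists. Finitely many generators stay in one such submodule, and the power with exponent
      \<open>Suc m\<close> leaves it.\<close>
    let ?V = "{a. \<exists>p l. degree p \<le> m \<and> l \<in> laurent_polys \<and> a - (poly_at p y1 + l) \<in> twists}"
    have "fls_mod.span X \<subseteq> ?V"
    proof (intro fls_mod.span_minimal)
      show "X \<subseteq> ?V" using PL m by blast
      show "fls_mod.subspace ?V"
      proof (rule fls_mod.subspaceI)
        have "degree (0 :: 'k poly) \<le> m \<and> 0 \<in> laurent_polys \<and> 0 - (poly_at 0 y1 + 0) \<in> twists"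
          using fls_mod.subspace_0[OF subspace_laurent_polys] fls_mod.subspace_0[OF subspace_twists] by simp
        then show "0 \<in> ?V" by blast
        fix x c assume "x \<in> ?V"
        then obtain p l where x: "degree p \<le> m" "l \<in> laurent_polys" "x - (poly_at p y1 + l) \<in> twists" by blast
        have "degree (smult c p) \<le> m" using x(1) degree_smult_le le_trans by blast
        moreover have "fls_const c * l \<in> laurent_polys"
          using x(2) by (intro fls_mod.subspace_scale subspace_laurent_polys)
        moreover have "fls_const c * x - (poly_at (smult c p) y1 + fls_const c * l) \<in> twists"
          using fls_mod.subspace_scale[OF subspace_twists x(3), of c]
          by (simp add: poly_at_smult right_diff_distrib distrib_left)
        ultimately show "fls_const c * x \<in> ?V" by blast
        fix y assume "y \<in> ?V"
        then obtain q l' where y: "degree q \<le> m" "l' \<in> laurent_polys" "y - (poly_at q y1 + l') \<in> twists" by blast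
        have "degree (p + q) \<le> m" using x(1) y(1) by (rule degree_add_le)
        moreover have "l + l' \<in> laurent_polys"
          using x(2) y(2) by (intro fls_mod.subspace_add subspace_laurent_polys)
        moreover have "x + y - (poly_at (p + q) y1 + (l + l')) =
            (x - (poly_at p y1 + l)) + (y - (poly_at q y1 + l'))"
          by (simp add: poly_at_add)
        then have "x + y - (poly_at (p + q) y1 + (l + l')) \<in> twists"
          using fls_mod.subspace_add[OF subspace_twists x(3) y(3)] by (simp only:)
        ultimately show "x + y \<in> ?V" by blast
      qed
    qed
    moreover have "y1 ^ Suc m \<in> A" using B_intros(10)[OF y1_mem] B_subset_A by blast
    ultimately obtain v where "v \<in> ?V" and tv: "y1 ^ Suc m - v \<in> twists" using cover by blast
    then obtain p l where p: "degree p \<le> m" "l \<in> laurent_polys" "v - (poly_at p y1 + l) \<in> twists" by blast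
    have "(y1 ^ Suc m - v) + (v - (poly_at p y1 + l)) \<in> twists"
      using tv p(3) by (intro fls_mod.subspace_add subspace_twists)
    moreover have "(y1 ^ Suc m - v) + (v - (poly_at p y1 + l)) = poly_at (monom 1 (Suc m) - p) y1 + (- l)"
      unfolding poly_at_diff poly_at_monom by simp
    ultimately have "poly_at (monom 1 (Suc m) - p) y1 + (- l) \<in> twists" by (simp only:)
    then have "degree (monom 1 (Suc m) - p) = 0"
      by (rule principal_part_twists[OF eps fls_mod.subspace_neg[OF subspace_laurent_polys p(2)]])
    moreover have "coeff (monom 1 (Suc m) - p) (Suc m) = 1" using p(1) by (simp add: coeff_eq_0)
    ultimately show False using le_degree[of "monom 1 (Suc m) - p" "Suc m"] by simp
  qed
qed

end

theorem theorem1: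
  fixes lam mu :: "'k::comm_ring_1"
    and B A :: "'k fls set"
    and f g :: "'k fls \<Rightarrow> 'k fls"
  assumes "lam * mu = 1" and "lam \<noteq> 0" and "lam \<noteq> 1"
    and "B = punctured {0, 1}" and "A = punctured {0, 1, lam}"
    and "algebra_hom B A f" and "f fls_X = fls_X"
    and "algebra_hom B A g" and "g fls_X = fls_const mu * fls_X"
  defines "H \<equiv> diag_cohomology B A f g 2"
    and "W \<equiv> diag_coboundaries B A f g 2"
    and "F \<equiv> first_class B A f g lam"
    and "S \<equiv> second_class B A f g lam"
    and "R \<equiv> regular_classes B A f g lam"
  shows
    "\<not> coset_finite_dim W H
     \<and> F \<subseteq> H \<and> S \<subseteq> H \<and> R \<subseteq> H \<and> F \<inter> S = {}
     \<and> is_singleton F \<and> coset_independent W F \<and> F \<subseteq> R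
     \<and> infinite S \<and> S \<inter> R = {}
     \<and> ((1 - lam) dvd 1 \<longrightarrow> coset_independent W (F \<union> S)
         \<and> coset_span W (R \<union> S) = H \<and> coset_span W S \<inter> R = {W})
     \<and> ((\<forall>m>0. (1 - lam ^ m) dvd 1) \<longrightarrow> coset_span W (F \<union> S) = H \<and> coset_span W F = R)"
proof -
  interpret parallel_maps lam mu B A f g by unfold_locales fact+
  have F: "F = kappa ` {fls_X}" and S: "S = kappa ` y1_powers" and R: "R = kappa ` laurent_polys"
    and H: "H = kappa ` A"
    by (simp_all add: F_def S_def R_def H_def first_class_eq second_class_eq regular_classes_eq
        cohomology_eq)
  have FR: "F \<subseteq> R" unfolding F R using X_in_laurent_polys by blast
  have SR: "S \<inter> R = {}" unfolding S R by (rule second_class_not_regular)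
  have "R \<subseteq> H" "S \<subseteq> H"
    unfolding H R S using laurent_polys_subset_A y1_powers_subset_A by (intro image_mono; blast)+
  moreover have "F \<union> S = kappa ` ({fls_X} \<union> y1_powers)" "R \<union> S = kappa ` (laurent_polys \<union> y1_powers)"
    unfolding F R S by (rule image_Un[symmetric])+
  ultimately show ?thesis
    using FR SR infinite_dimensional first_class_independent infinite_second_class generators_independent
      span_generators span_second_class_regular span_both_classes span_first_class
    unfolding H_def[symmetric] W_def[symmetric] F[symmetric] S[symmetric] R[symmetric]
    by (auto simp: F)
qed

end
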